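(* Let $\mathbf{T}=S^1\times D^2$ be the solid torus and let $\mathcal{F}$ be its partition into the level sets $f^{-1}(t)$, $t\in[0;1]$, of the function $f\colon\mathbf{T}\to\mathbb{R}$, $f(w,z)=|z|^2$. Then the pair of groups $\bigl(\mathcal{D}^{lp}(\mathcal{F}),\ \mathcal{D}^{lp}(\mathcal{F},\partial\mathbf{T})\bigr)$ is a strong deformation retract of the pair $\bigl(\mathcal{D}^{fol}(\mathcal{F}),\ \mathcal{D}^{fol}(\mathcal{F},\partial\mathbf{T})\bigr)$.
   Context: $D^2=\{z\in\mathbb{C}: |z|\le 1\}$ and $S^1=\partial D^2$. All manifolds and diffeomorphisms are $C^\infty$. For a partition $\mathcal{F}$ of a manifold $M$, a map $h\colon M\to M$ is $\mathcal{F}$-foliated if for each leaf $\omega\in\mathcal{F}$ the image $h(\omega)$ is a (possibly different) leaf of $\mathcal{F}$; it is $\mathcal{F}$-leaf preserving if $h(\omega)=\omega$ for each $\omega\in\mathcal{F}$. $\mathcal{D}^{fol}(\mathcal{F})$ and $\mathcal{D}^{lp}(\mathcal{F})$ are the groups of $\mathcal{F}$-foliated and $\mathcal{F}$-leaf preserving $C^\infty$ diffeomorphisms of $M$, and $\mathcal{D}^{fol}(\mathcal{F},X)$, $\mathcal{D}^{lp}(\mathcal{F},X)$ are their subgroups of diffeomorphisms equal to the identity on $X\subset M$. All these groups carry the $C^\infty$ Whitney topology. *)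

theory Defs
  imports "HOL-Analysis.Analysis"
begin

section \<open>Smooth maps and diffeomorphisms of subsets of Euclidean spaces\<close>

fun Ck_on :: "nat \<Rightarrow> 'a::real_normed_vector set \<Rightarrow> ('a \<Rightarrow> 'b::real_normed_vector) \<Rightarrow> bool" where
  "Ck_on 0 U f \<longleftrightarrow> continuous_on U f"
| "Ck_on (Suc k) U f \<longleftrightarrow>
     (\<forall>x\<in>U. f differentiable (at x)) \<and>
     (\<forall>v. Ck_on k U (\<lambda>x. frechet_derivative f (at x) v))"

text \<open>
  Smoothness on an arbitrary subset \<open>M\<close> of a Euclidean space is understood in the usual way:
  locally there is a \<open>C\<^sup>\<infinity>\<close> extension to an open subset of the ambient space.  For embedded
  submanifolds with boundary this is smoothness (up to and including the boundary).
\<close>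

definition smooth_map_on :: "'a::euclidean_space set \<Rightarrow> ('a \<Rightarrow> 'b::euclidean_space) \<Rightarrow> bool" where
  "smooth_map_on M f \<longleftrightarrow>
     (\<forall>x\<in>M. \<exists>U g. open U \<and> x \<in> U \<and> (\<forall>k. Ck_on k U g) \<and> (\<forall>y\<in>M \<inter> U. g y = f y))"

text \<open>
  Self-maps of \<open>M\<close> are represented by the functions that take the value \<open>undefined\<close>
  outside \<open>M\<close>, so that distinct functions are distinct maps \<open>M \<rightarrow> M\<close>.
\<close>

definition smooth_self_maps :: "'a::euclidean_space set \<Rightarrow> ('a \<Rightarrow> 'a) set" where
  "smooth_self_maps M = {h \<in> M \<rightarrow>\<^sub>E M. smooth_map_on M h}"

definition diffeos :: "'a::euclidean_space set \<Rightarrow> ('a \<Rightarrow> 'a) set" where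
  "diffeos M = {h \<in> smooth_self_maps M. bij_betw h M M \<and> smooth_map_on M (inv_into M h)}"


section \<open>Foliated and leaf preserving diffeomorphisms\<close>

definition foliated :: "'a set set \<Rightarrow> ('a \<Rightarrow> 'a) \<Rightarrow> bool" where
  "foliated F h \<longleftrightarrow> (\<forall>\<omega>\<in>F. h ` \<omega> \<in> F)"

definition leaf_preserving :: "'a set set \<Rightarrow> ('a \<Rightarrow> 'a) \<Rightarrow> bool" where
  "leaf_preserving F h \<longleftrightarrow> (\<forall>\<omega>\<in>F. h ` \<omega> = \<omega>)"

definition fol_diffeos :: "'a::euclidean_space set \<Rightarrow> 'a set set \<Rightarrow> ('a \<Rightarrow> 'a) set" where
  "fol_diffeos M F = {h \<in> diffeos M. foliated F h}"

definition lp_diffeos :: "'a::euclidean_space set \<Rightarrow> 'a set set \<Rightarrow> ('a \<Rightarrow> 'a) set" where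
  "lp_diffeos M F = {h \<in> diffeos M. leaf_preserving F h}"

definition fol_diffeos_rel ::
    "'a::euclidean_space set \<Rightarrow> 'a set set \<Rightarrow> 'a set \<Rightarrow> ('a \<Rightarrow> 'a) set" where
  "fol_diffeos_rel M F X = {h \<in> fol_diffeos M F. \<forall>x\<in>X. h x = x}"

definition lp_diffeos_rel ::
    "'a::euclidean_space set \<Rightarrow> 'a set set \<Rightarrow> 'a set \<Rightarrow> ('a \<Rightarrow> 'a) set" where
  "lp_diffeos_rel M F X = {h \<in> lp_diffeos M F. \<forall>x\<in>X. h x = x}"


section \<open>The solid torus\<close>

definition solid_torus :: "(complex \<times> complex) set" where
  "solid_torus = sphere 0 1 \<times> cball 0 1"

definition solid_torus_boundary :: "(complex \<times> complex) set" where
  "solid_torus_boundary = sphere 0 1 \<times> sphere 0 1"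

definition torus_fun :: "complex \<times> complex \<Rightarrow> real" where
  "torus_fun p = (norm (snd p))\<^sup>2"

definition torus_foliation :: "(complex \<times> complex) set set" where
  "torus_foliation = (\<lambda>t. {p \<in> solid_torus. torus_fun p = t}) ` {0..1}"


section \<open>The Whitney topology on the smooth self-maps of the solid torus\<close>

text \<open>
  Iterated directional derivatives along the vectors of a list, relative to \<open>S\<close>.  They are
  used only for smooth functions on a convex set \<open>S\<close> with nonempty interior, where the
  derivative relative to \<open>S\<close> is unique, also at boundary points.
\<close>

fun partials :: "'a::real_normed_vector set \<Rightarrow> 'a list \<Rightarrow> ('a \<Rightarrow> 'b::real_normed_vector) \<Rightarrow> 'a \<Rightarrow> 'b" where
  "partials S [] f = f"
| "partials S (v # vs) f = partials S vs (\<lambda>x. frechet_derivative f (at x within S) v)"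

text \<open>
  The inverse of \<open>torus_coords\<close> on an arc of length less than \<open>2 * pi\<close> times the disk is
  a chart of the solid torus; together these charts cover it.
\<close>

definition coord_domain :: "(real \<times> complex) set" where
  "coord_domain = UNIV \<times> cball 0 1"

definition torus_coords :: "real \<times> complex \<Rightarrow> complex \<times> complex" where
  "torus_coords p = (cis (fst p), snd p)"

text \<open>
  The solid torus is compact, so the \<open>C\<^sup>\<infinity>\<close> Whitney topology is that of uniform
  convergence, in finitely many charts, of the maps and of each of their partial derivatives.
  In the source we use the coordinates \<open>(\<theta>, z)\<close> with \<open>w = cis \<theta>\<close>; everything is
  \<open>2 * pi\<close>-periodic in \<open>\<theta>\<close>, so taking all of \<open>coord_domain\<close> amounts to taking two
  compact pieces of it, each inside a chart.  In the target we use the coordinates of the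
  ambient space \<open>complex \<times> complex\<close>.
\<close>

definition Cr_nbhd ::
    "nat \<Rightarrow> real \<Rightarrow> (complex \<times> complex \<Rightarrow> complex \<times> complex) \<Rightarrow>
     (complex \<times> complex \<Rightarrow> complex \<times> complex) set" where
  "Cr_nbhd r \<epsilon> h =
     {g \<in> smooth_self_maps solid_torus.
        \<forall>vs. set vs \<subseteq> Basis \<and> length vs \<le> r \<longrightarrow>
          (\<forall>p\<in>coord_domain.
             norm (partials coord_domain vs (g \<circ> torus_coords) p -
                   partials coord_domain vs (h \<circ> torus_coords) p) < \<epsilon>)}"

definition whitney_topology :: "(complex \<times> complex \<Rightarrow> complex \<times> complex) topology" where
  "whitney_topology =
     topology (\<lambda>\<U>. \<U> \<subseteq> smooth_self_maps solid_torus \<and>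
                   (\<forall>h\<in>\<U>. \<exists>r. \<exists>\<epsilon>>0. Cr_nbhd r \<epsilon> h \<subseteq> \<U>))"

lemma openin_whitney_topology:
  "openin whitney_topology \<U> \<longleftrightarrow>
     \<U> \<subseteq> smooth_self_maps solid_torus \<and> (\<forall>h\<in>\<U>. \<exists>r. \<exists>\<epsilon>>0. Cr_nbhd r \<epsilon> h \<subseteq> \<U>)"
proof -
  have mono: "Cr_nbhd r' \<epsilon>' h \<subseteq> Cr_nbhd r \<epsilon> h" if "r \<le> r'" "\<epsilon>' \<le> \<epsilon>" for r r' \<epsilon> \<epsilon>' h
    using that unfolding Cr_nbhd_def by (fastforce intro: less_le_trans)
  have "istopology (\<lambda>\<U>. \<U> \<subseteq> smooth_self_maps solid_torus \<and>
                   (\<forall>h\<in>\<U>. \<exists>r. \<exists>\<epsilon>>0. Cr_nbhd r \<epsilon> h \<subseteq> \<U>))" (is "istopology ?P")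
    unfolding istopology_def
  proof (intro conjI allI impI)
    fix \<U> \<V> assume \<U>: "?P \<U>" and \<V>: "?P \<V>"
    show "\<U> \<inter> \<V> \<subseteq> smooth_self_maps solid_torus" using \<U> by blast
    show "\<forall>h\<in>\<U> \<inter> \<V>. \<exists>r. \<exists>\<epsilon>>0. Cr_nbhd r \<epsilon> h \<subseteq> \<U> \<inter> \<V>"
    proof
      fix h assume "h \<in> \<U> \<inter> \<V>"
      then obtain r e s d where "e > 0" "Cr_nbhd r e h \<subseteq> \<U>" "d > 0" "Cr_nbhd s d h \<subseteq> \<V>"
        using \<U> \<V> by blast
      then have "min e d > 0" "Cr_nbhd (max r s) (min e d) h \<subseteq> \<U> \<inter> \<V>"
        using mono[of r "max r s" "min e d" e h] mono[of s "max r s" "min e d" d h] by auto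
      then show "\<exists>r. \<exists>\<epsilon>>0. Cr_nbhd r \<epsilon> h \<subseteq> \<U> \<inter> \<V>" by blast
    qed
  next
    fix \<K> assume \<K>: "\<forall>K\<in>\<K>. ?P K"
    show "\<Union> \<K> \<subseteq> smooth_self_maps solid_torus" using \<K> by blast
    show "\<forall>h\<in>\<Union> \<K>. \<exists>r. \<exists>\<epsilon>>0. Cr_nbhd r \<epsilon> h \<subseteq> \<Union> \<K>"
    proof
      fix h assume "h \<in> \<Union> \<K>"
      then obtain K where K: "K \<in> \<K>" "h \<in> K" by blast
      then obtain r e where "e > 0" "Cr_nbhd r e h \<subseteq> K" using \<K> by blast
      then show "\<exists>r. \<exists>\<epsilon>>0. Cr_nbhd r \<epsilon> h \<subseteq> \<Union> \<K>" using K by blast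
    qed
  qed
  then show ?thesis
    unfolding whitney_topology_def by (simp add: topology_inverse')
qed

lemma topspace_whitney_topology: "topspace whitney_topology = smooth_self_maps solid_torus"
proof -
  have "Cr_nbhd r e h \<subseteq> smooth_self_maps solid_torus" for r e h
    by (auto simp: Cr_nbhd_def)
  then have "openin whitney_topology (smooth_self_maps solid_torus)"
    unfolding openin_whitney_topology using zero_less_one by blast
  then show ?thesis
    by (metis openin_subset openin_topspace openin_whitney_topology subset_antisym)
qed


section \<open>Strong deformation retracts of pairs\<close>

text \<open>
  \<open>(Y, B)\<close> is a strong deformation retract of the pair \<open>(X, A)\<close>, where \<open>X\<close> is a
  topological space: a homotopy of the pair \<open>(X, A)\<close> in itself, stationary on \<open>Y\<close>,
  from the identity to a map of pairs into \<open>(Y, B)\<close>.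
\<close>

definition strong_deformation_retract_of_pair ::
    "'a set \<Rightarrow> 'a set \<Rightarrow> 'a topology \<Rightarrow> 'a set \<Rightarrow> bool" where
  "strong_deformation_retract_of_pair Y B X A \<longleftrightarrow>
     A \<subseteq> topspace X \<and> Y \<subseteq> topspace X \<and> B \<subseteq> Y \<inter> A \<and>
     (\<exists>H. continuous_map (prod_topology (top_of_set {0..1::real}) X) X H \<and>
          (\<forall>x\<in>topspace X. H (0, x) = x) \<and>
          (\<forall>t\<in>{0..1}. \<forall>y\<in>Y. H (t, y) = y) \<and>
          (\<forall>t\<in>{0..1}. \<forall>a\<in>A. H (t, a) \<in> A) \<and>
          (\<forall>x\<in>topspace X. H (1, x) \<in> Y) \<and>
          (\<forall>a\<in>A. H (1, a) \<in> B))"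

end

theory Submission
  imports Defs
begin

text \<open>
  A foliated diffeomorphism \<open>h\<close> preserves the core circle: otherwise a two-dimensional torus
  would embed into a circle.  Hence the radius \<open>|h\<^sub>2|\<close> of \<open>h = (h\<^sub>1, h\<^sub>2)\<close> is an increasing
  function of \<open>|z|\<close>, and \<open>|h\<^sub>2| = |z| sqrt (Q |z|)\<close> for a positive even smooth function \<open>Q\<close> of
  one variable, obtained from \<open>|h\<^sub>2|\<^sup>2\<close> by Hadamard division.  Interpolating the radius linearly
  between \<open>|h\<^sub>2|\<close> and \<open>|z|\<close> gives the homotopy
  \<open>h\<^sub>t = (h\<^sub>1, (1 - t + t |z| / |h\<^sub>2|) h\<^sub>2)\<close>.  It consists of diffeomorphisms, because \<open>h\<^sub>t\<close> is \<open>h\<close>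
  followed by a map of the form \<open>(w, z) \<mapsto> (w, l |z| z)\<close> whose radius function \<open>x (l x)\<close> has positive
  derivative.  It depends continuously on \<open>t\<close> and \<open>h\<close>, because the derivatives of \<open>Q\<close> are integrals
  of derivatives of \<open>|h\<^sub>2|\<^sup>2\<close>.
\<close>

section \<open>Functions of class C^k\<close>

text \<open>The obstacle is the core circle, where neither |z| nor |h_2| is smooth and |z| / |h_2|
  has the form 0/0. Everything radial therefore passes through even functions K of one real
  variable: evenness makes K(|z|) smooth in z, and K |-> K'(x) / x stays within even functions, so
  that inductions on the order of differentiation close. The functions live on open intervals larger
  than [-1, 1], so that the boundary radius 1 is an interior point.

  Radii are interpolated, not the maps, because increasing diffeomorphisms of [0, 1] form a convex
  set. The factor |z| / |h_2| is used in two forms. As a function of |h_2| it is the radial factor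
  of the inverse of h, which exhibits h_t as h followed by a radial diffeomorphism. As a function of
  |z| it is Q(|z|)^(-1/2), which depends continuously on h without any appeal to continuity of
  inversion. The inverse of h also supplies what injectivity alone cannot: strict positivity of Q at
  0 and of the derivative of the radius function.\<close>

lemma Ck_on_cong:
  assumes "open U" "\<And>x. x \<in> U \<Longrightarrow> f x = g x"
  shows "Ck_on k U f \<longleftrightarrow> Ck_on k U g"
  using assms(2)
proof (induction k arbitrary: f g)
  case 0
  then show ?case by (auto intro: continuous_on_cong[THEN iffD1])
next
  case (Suc k)
  have D: "(f has_derivative D) (at x) \<longleftrightarrow> (g has_derivative D) (at x)" if "x \<in> U" for x D
    using Suc.prems assms(1) that by (auto elim!: has_derivative_transform_within_open)
  \<comment> \<open>\<open>frechet_derivative\<close> is a choice term; both choices range over the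
    same candidates, so they agree even at points where no derivative exists.\<close>
  then have "frechet_derivative f (at x) = frechet_derivative g (at x)" if "x \<in> U" for x
    using that by (simp add: frechet_derivative_def)
  then have "Ck_on k U (\<lambda>x. frechet_derivative f (at x) v)
      \<longleftrightarrow> Ck_on k U (\<lambda>x. frechet_derivative g (at x) v)" for v
    by (intro Suc.IH) auto
  then show ?case using D by (simp add: differentiable_def)
qed

text \<open>The derivative may be given by any formula, so later proofs need not handle the chosen
  \<open>frechet_derivative\<close>.\<close>

lemma Ck_on_SucI:
  assumes "open U" "\<And>x. x \<in> U \<Longrightarrow> (f has_derivative D x) (at x)"
    and "\<And>v. Ck_on k U (\<lambda>x. D x v)"
  shows "Ck_on (Suc k) U f"
proof -
  have "Ck_on k U (\<lambda>x. frechet_derivative f (at x) v)" for v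
    using assms(3)[of v] frechet_derivative_at[OF assms(2)]
    by (subst Ck_on_cong[where g = "\<lambda>x. D x v"]) (auto simp: assms(1))
  then show ?thesis using assms(2) by (auto simp: differentiable_def)
qed

lemma Ck_on_SucD:
  assumes "Ck_on (Suc k) U f"
  shows "x \<in> U \<Longrightarrow> (f has_derivative frechet_derivative f (at x)) (at x)"
    and "Ck_on k U (\<lambda>x. frechet_derivative f (at x) v)"
  using assms frechet_derivative_works by auto

lemma Ck_on_continuous: "Ck_on k U f \<Longrightarrow> continuous_on U f"
  by (cases k) (auto intro!: differentiable_imp_continuous_on
      simp: differentiable_on_def differentiable_at_withinI)

lemma Ck_on_mono: "Ck_on k U f \<Longrightarrow> j \<le> k \<Longrightarrow> Ck_on j U f"
proof (induction k arbitrary: f j)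
  case (Suc k)
  then show ?case
    by (cases j) (auto simp: Ck_on_continuous[OF Suc.prems(1)])
qed auto

lemma Ck_on_subset: "Ck_on k U f \<Longrightarrow> V \<subseteq> U \<Longrightarrow> Ck_on k V f"
  by (induction k arbitrary: f) (auto intro: continuous_on_subset)

lemma Ck_on_local:
  assumes "\<And>x. x \<in> U \<Longrightarrow> \<exists>V. open V \<and> x \<in> V \<and> Ck_on k V f"
  shows "Ck_on k U f"
  using assms
proof (induction k arbitrary: f)
  case 0
  then show ?case
    by (metis Ck_on.simps(1) continuous_at_imp_continuous_on continuous_on_eq_continuous_at)
next
  case (Suc k)
  have "f differentiable at x" if "x \<in> U" for x using Suc.prems[OF that] by auto
  moreover have "Ck_on k U (\<lambda>x. frechet_derivative f (at x) v)" for v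
    using Suc.prems by (intro Suc.IH) (metis Ck_on.simps(2))
  ultimately show ?case by simp
qed

lemma Ck_on_const [simp]: "open U \<Longrightarrow> Ck_on k U (\<lambda>x. c)"
proof (induction k arbitrary: c)
  case (Suc k)
  then show ?case by (intro Ck_on_SucI[where D = "\<lambda>x v. 0"]) simp_all
qed simp

lemma Ck_on_linear_compose:
  assumes "open U" "bounded_linear L" "Ck_on k U f"
  shows "Ck_on k U (\<lambda>x. L (f x))"
  using assms(3)
proof (induction k arbitrary: f)
  case 0
  then show ?case using assms by (auto intro: bounded_linear.continuous_on)
next
  case (Suc k)
  note Ck_on_SucD[OF Suc.prems]
  then show ?case
    using Suc.IH assms(2) by (intro Ck_on_SucI[OF assms(1)]) (auto intro: bounded_linear.has_derivative)
qed

lemma Ck_on_linear: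
  assumes "open U" "bounded_linear L" shows "Ck_on k U L"
proof (cases k)
  case 0
  then show ?thesis using assms(2) by (simp add: linear_continuous_on)
next
  case (Suc j)
  then show ?thesis
    using bounded_linear.has_derivative[OF assms(2) has_derivative_ident] assms(1)
    unfolding Suc by (intro Ck_on_SucI[where D = "\<lambda>x. L"]) simp_all
qed

lemma Ck_on_add:
  assumes "open U" "Ck_on k U f" "Ck_on k U g"
  shows "Ck_on k U (\<lambda>x. f x + g x)"
  using assms(2,3)
proof (induction k arbitrary: f g)
  case (Suc k)
  note Ck_on_SucD[OF Suc.prems(1)] Ck_on_SucD[OF Suc.prems(2)]
  then show ?case
    using Suc.IH by (intro Ck_on_SucI[OF assms(1)]) (auto intro: has_derivative_add)
qed (auto intro: continuous_on_add)

lemma Ck_on_sum: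
  assumes "open U" "\<And>i. i \<in> I \<Longrightarrow> Ck_on k U (f i)"
  shows "Ck_on k U (\<lambda>x. \<Sum>i\<in>I. f i x)"
  using assms(2) by (induction I rule: infinite_finite_induct) (auto simp: assms(1) intro: Ck_on_add)

lemma Ck_on_bilinear:
  assumes "open U" "bounded_bilinear B" "Ck_on k U f" "Ck_on k U g"
  shows "Ck_on k U (\<lambda>x. B (f x) (g x))"
  using assms(3,4)
proof (induction k arbitrary: f g)
  case 0
  then show ?case using assms(2) by (auto intro: bounded_bilinear.continuous_on)
next
  case (Suc k)
  note f = Ck_on_SucD[OF Suc.prems(1)] and g = Ck_on_SucD[OF Suc.prems(2)]
  have "Ck_on k U f" "Ck_on k U g" using Suc.prems Ck_on_mono le_SucI by blast+
  then have "Ck_on k U (\<lambda>x. B (f x) (frechet_derivative g (at x) v) + B (frechet_derivative f (at x) v) (g x))" for v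
    by (intro Ck_on_add[OF assms(1)] Suc.IH f g)
  then show ?case
    using bounded_bilinear.FDERIV[OF assms(2) f(1) g(1)] by (intro Ck_on_SucI[OF assms(1)])
qed

lemmas Ck_on_mult = Ck_on_bilinear[OF _ bounded_bilinear_mult]
lemmas Ck_on_scaleR = Ck_on_bilinear[OF _ bounded_bilinear_scaleR]

lemma Ck_on_compose:
  fixes f :: "'a::real_normed_vector \<Rightarrow> 'b::euclidean_space"
  assumes "open U" "f ` U \<subseteq> V" "Ck_on k V g" "Ck_on k U f"
  shows "Ck_on k U (\<lambda>x. g (f x))"
  using assms(3,4)
proof (induction k arbitrary: g)
  case 0
  then show ?case using assms(2) by (auto intro: continuous_on_compose2)
next
  case (Suc k)
  note f = Ck_on_SucD[OF Suc.prems(2)] and g = Ck_on_SucD[OF Suc.prems(1)]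
  \<comment> \<open>The direction in which g is differentiated varies with x, whereas the induction
    hypothesis speaks of derivatives of g in one fixed direction. Expanding in the basis separates
    the two.\<close>
  let ?D = "\<lambda>x v. \<Sum>b\<in>Basis. (frechet_derivative f (at x) v \<bullet> b) *\<^sub>R frechet_derivative g (at (f x)) b"
  have "((\<lambda>x. g (f x)) has_derivative ?D x) (at x)" if "x \<in> U" for x
  proof -
    have dg: "(g has_derivative frechet_derivative g (at (f x))) (at (f x))"
      using g(1) assms(2) that by blast
    have "((\<lambda>x. g (f x)) has_derivative (\<lambda>v. frechet_derivative g (at (f x)) (frechet_derivative f (at x) v))) (at x)"
      using has_derivative_compose[OF f(1)[OF that] dg] .
    moreover have "frechet_derivative g (at (f x)) w = (\<Sum>b\<in>Basis. (w \<bullet> b) *\<^sub>R frechet_derivative g (at (f x)) b)" for w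
    proof -
      have "linear (frechet_derivative g (at (f x)))" using dg has_derivative_linear by blast
      then have "(\<Sum>b\<in>Basis. (w \<bullet> b) *\<^sub>R frechet_derivative g (at (f x)) b)
          = frechet_derivative g (at (f x)) (\<Sum>b\<in>Basis. (w \<bullet> b) *\<^sub>R b)"
        by (simp add: linear_sum linear_cmul)
      then show ?thesis by (simp add: euclidean_representation)
    qed
    then have "(\<lambda>v. frechet_derivative g (at (f x)) (frechet_derivative f (at x) v)) = ?D x"
      by (rule ext)
    ultimately show ?thesis by (simp only:)
  qed
  moreover have "Ck_on k U f" using Suc.prems Ck_on_mono le_SucI by blast
  then have "Ck_on k U (\<lambda>x. frechet_derivative g (at (f x)) b)" for b
    by (rule Suc.IH[OF g(2)])
  then have "Ck_on k U (\<lambda>x. ?D x v)" for v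
    using Ck_on_linear_compose[OF assms(1) bounded_linear_inner_left f(2)]
    by (intro Ck_on_sum[OF assms(1)] Ck_on_scaleR[OF assms(1)])
  ultimately show ?case by (rule Ck_on_SucI[OF assms(1)])
qed

lemma Ck_on_realI:
  fixes f :: "real \<Rightarrow> 'b::real_normed_vector"
  assumes "open U" "\<And>x. x \<in> U \<Longrightarrow> (f has_vector_derivative f' x) (at x)" "Ck_on k U f'"
  shows "Ck_on (Suc k) U f"
proof (rule Ck_on_SucI[OF assms(1)])
  show "(f has_derivative (\<lambda>v. v *\<^sub>R f' x)) (at x)" if "x \<in> U" for x
    using assms(2)[OF that] by (simp add: has_vector_derivative_def)
  show "Ck_on k U (\<lambda>x. v *\<^sub>R f' x)" for v
    by (intro Ck_on_scaleR Ck_on_const assms)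
qed

text \<open>Differentiation lowers the exponent, so the induction runs over all real exponents.
  Square roots, inverses and inverse square roots below are instances.\<close>

lemma Ck_on_powr: "Ck_on k {0<..} (\<lambda>x::real. x powr m)"
proof (induction k arbitrary: m)
  case 0
  then show ?case by (auto intro!: continuous_intros)
next
  case (Suc k)
  have "((\<lambda>x. x powr m) has_vector_derivative m * x powr (m - 1)) (at x)" if "x > 0" for x
    using has_real_derivative_powr[OF that, of m]
    by (simp add: has_real_derivative_iff_has_vector_derivative)
  moreover have "Ck_on k {0<..} (\<lambda>x. m * x powr (m - 1))"
    using Ck_on_mult[OF _ Ck_on_const Suc.IH] by simp
  ultimately show ?case by (intro Ck_on_realI) simp_all
qed

lemma Ck_on_cis: "Ck_on k UNIV cis"
proof -
  \<comment> \<open>The derivative of c cis is (c i) cis, so the family over all constants c is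
    closed under differentiation.\<close>
  have "Ck_on k UNIV (\<lambda>x. c * cis x)" for c
  proof (induction k arbitrary: c)
    case 0
    then show ?case by (auto intro!: continuous_intros)
  next
    case (Suc k)
    have "((\<lambda>x. c * cis x) has_vector_derivative (c * \<i>) * cis x) (at x)" for x
    proof -
      have "(cis has_vector_derivative \<i> * cis x) (at x)"
        unfolding has_vector_derivative_def by (auto intro!: derivative_eq_intros simp: scaleR_conv_of_real)
      then show ?thesis
        using has_vector_derivative_mult_right[of cis "\<i> * cis x" "at x" c] by (simp add: mult.assoc)
    qed
    then show ?case using Suc.IH by (intro Ck_on_realI) simp_all
  qed
  from this[of 1] show ?thesis by simp
qed

section \<open>Smooth maps on arbitrary subsets of Euclidean space\<close>

definition Cinf_on :: "'a::real_normed_vector set \<Rightarrow> ('a \<Rightarrow> 'b::real_normed_vector) \<Rightarrow> bool" where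
  "Cinf_on U f \<longleftrightarrow> (\<forall>k. Ck_on k U f)"

lemma Cinf_on_continuous: "Cinf_on U f \<Longrightarrow> continuous_on U f"
  unfolding Cinf_on_def using Ck_on_continuous by blast

lemma Cinf_on_subset: "Cinf_on U f \<Longrightarrow> V \<subseteq> U \<Longrightarrow> Cinf_on V f"
  unfolding Cinf_on_def using Ck_on_subset by blast

lemma Cinf_on_cong:
  "open U \<Longrightarrow> (\<And>x. x \<in> U \<Longrightarrow> f x = g x) \<Longrightarrow> Cinf_on U f \<longleftrightarrow> Cinf_on U g"
  unfolding Cinf_on_def using Ck_on_cong by blast

lemma Cinf_onD:
  assumes "Cinf_on U f"
  shows "x \<in> U \<Longrightarrow> (f has_derivative frechet_derivative f (at x)) (at x)"
    and "Cinf_on U (\<lambda>x. frechet_derivative f (at x) v)"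
  using assms Ck_on_SucD unfolding Cinf_on_def by blast+

lemma Cinf_on_compose:
  fixes f :: "'a::real_normed_vector \<Rightarrow> 'b::euclidean_space"
  shows "open U \<Longrightarrow> f ` U \<subseteq> V \<Longrightarrow> Cinf_on V g \<Longrightarrow> Cinf_on U f \<Longrightarrow> Cinf_on U (\<lambda>x. g (f x))"
  unfolding Cinf_on_def using Ck_on_compose by blast

lemma Cinf_on_add:
  "open U \<Longrightarrow> Cinf_on U f \<Longrightarrow> Cinf_on U g \<Longrightarrow> Cinf_on U (\<lambda>x. f x + g x)"
  unfolding Cinf_on_def using Ck_on_add by blast

lemma Cinf_on_bilinear:
  assumes "open U" "bounded_bilinear B" "Cinf_on U f" "Cinf_on U g"
  shows "Cinf_on U (\<lambda>x. B (f x) (g x))"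
  using assms Ck_on_bilinear[OF assms(1,2)] unfolding Cinf_on_def by blast

lemma smooth_map_on_iff:
  "smooth_map_on M f \<longleftrightarrow>
    (\<forall>x\<in>M. \<exists>U g. open U \<and> x \<in> U \<and> Cinf_on U g \<and> (\<forall>y\<in>M \<inter> U. g y = f y))"
  unfolding smooth_map_on_def Cinf_on_def ..

lemma smooth_map_onE:
  assumes "smooth_map_on M f" "x \<in> M"
  obtains U g where "open U" "x \<in> U" "Cinf_on U g" "\<And>y. y \<in> M \<Longrightarrow> y \<in> U \<Longrightarrow> g y = f y"
  using assms unfolding smooth_map_on_iff by (metis IntI)

lemma smooth_map_onI_open:
  "open U \<Longrightarrow> M \<subseteq> U \<Longrightarrow> Cinf_on U f \<Longrightarrow> smooth_map_on M f"
  unfolding smooth_map_on_iff by blast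

lemma smooth_map_on_subset:
  assumes "smooth_map_on M f" "N \<subseteq> M"
  shows "smooth_map_on N f"
  unfolding smooth_map_on_iff
proof
  fix x assume "x \<in> N"
  then obtain U g where "open U" "x \<in> U" "Cinf_on U g" "\<And>y. y \<in> M \<Longrightarrow> y \<in> U \<Longrightarrow> g y = f y"
    using smooth_map_onE[OF assms(1), of x] assms(2) by (metis subsetD)
  then show "\<exists>U g. open U \<and> x \<in> U \<and> Cinf_on U g \<and> (\<forall>y\<in>N \<inter> U. g y = f y)"
    using assms(2) by (intro exI[of _ U] exI[of _ g]) auto
qed

lemma smooth_map_on_cong:
  "(\<And>x. x \<in> M \<Longrightarrow> f x = g x) \<Longrightarrow> smooth_map_on M f \<longleftrightarrow> smooth_map_on M g"
  unfolding smooth_map_on_iff by simp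

text \<open>Near a point of an open set a local extension agrees with f itself. This lets the
  algebra of smooth maps, proved for arbitrary subsets, be used for functions on open
  intervals.\<close>

lemma smooth_map_on_open:
  assumes "open U" shows "smooth_map_on U f \<longleftrightarrow> Cinf_on U f"
proof
  assume f: "smooth_map_on U f"
  have "Ck_on k U f" for k
  proof (rule Ck_on_local)
    fix x assume "x \<in> U"
    then obtain V g where "open V" "x \<in> V" "Cinf_on V g" "\<And>y. y \<in> U \<Longrightarrow> y \<in> V \<Longrightarrow> g y = f y"
      using f smooth_map_onE by metis
    then show "\<exists>V. open V \<and> x \<in> V \<and> Ck_on k V f"
      using assms \<open>x \<in> U\<close> Cinf_on_cong[of "U \<inter> V" g f] Cinf_on_subset[of V g "U \<inter> V"]
      by (intro exI[of _ "U \<inter> V"]) (auto simp: Cinf_on_def)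
  qed
  then show "Cinf_on U f" by (simp add: Cinf_on_def)
qed (use assms smooth_map_onI_open in blast)

lemma smooth_map_on_continuous:
  assumes "smooth_map_on M f" shows "continuous_on M f"
proof (rule continuous_on_eq_continuous_within[THEN iffD2], rule ballI)
  fix x assume "x \<in> M"
  then obtain U g where U: "open U" "x \<in> U" "Cinf_on U g" "\<And>y. y \<in> M \<Longrightarrow> y \<in> U \<Longrightarrow> g y = f y"
    using assms smooth_map_onE by metis
  then have "continuous (at x within M) g"
    using Cinf_on_continuous by (metis continuous_at_imp_continuous_at_within continuous_on_eq_continuous_at)
  then have "(g \<longlongrightarrow> f x) (at x within M)"
    using U \<open>x \<in> M\<close> by (simp add: continuous_within)
  moreover have "openin (top_of_set M) (M \<inter> U)" "x \<in> M \<inter> U" "\<And>y. y \<in> M \<inter> U \<Longrightarrow> y \<noteq> x \<Longrightarrow> g y = f y"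
    using U \<open>x \<in> M\<close> by auto
  ultimately show "continuous (at x within M) f"
    unfolding continuous_within by (rule Lim_transform_within_openin)
qed

lemma smooth_map_on_compose:
  assumes "smooth_map_on M f" "f ` M \<subseteq> N" "smooth_map_on N g"
  shows "smooth_map_on M (\<lambda>x. g (f x))"
  unfolding smooth_map_on_iff
proof
  fix x assume x: "x \<in> M"
  obtain U f' where U: "open U" "x \<in> U" "Cinf_on U f'" "\<And>y. y \<in> M \<Longrightarrow> y \<in> U \<Longrightarrow> f' y = f y"
    using smooth_map_onE[OF assms(1) x] by metis
  have fx: "f x \<in> N" using assms(2) x by blast
  obtain V g' where V: "open V" "f x \<in> V" "Cinf_on V g'" "\<And>y. y \<in> N \<Longrightarrow> y \<in> V \<Longrightarrow> g' y = g y"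
    using smooth_map_onE[OF assms(3) fx] by metis
  let ?W = "U \<inter> f' -` V"
  have W: "open ?W"
    using continuous_open_preimage[OF Cinf_on_continuous[OF U(3)] U(1) V(1)] .
  moreover have "Cinf_on ?W (\<lambda>x. g' (f' x))"
    by (rule Cinf_on_compose[OF W _ V(3) Cinf_on_subset[OF U(3)]]) auto
  moreover have "x \<in> ?W" using U V x by simp
  moreover have "\<forall>y\<in>M \<inter> ?W. g' (f' y) = g (f y)"
    using U(4) V(4) assms(2) by (metis IntE image_subset_iff vimageE)
  ultimately show "\<exists>U h. open U \<and> x \<in> U \<and> Cinf_on U h \<and> (\<forall>y\<in>M \<inter> U. h y = g (f y))"
    by (intro exI[of _ ?W] exI[of _ "\<lambda>x. g' (f' x)"] conjI)
qed

lemma smooth_map_on_bilinear: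
  assumes "bounded_bilinear B" "smooth_map_on M f" "smooth_map_on M g"
  shows "smooth_map_on M (\<lambda>x. B (f x) (g x))"
  unfolding smooth_map_on_iff
proof
  fix x assume x: "x \<in> M"
  obtain U f' where U: "open U" "x \<in> U" "Cinf_on U f'" "\<And>y. y \<in> M \<Longrightarrow> y \<in> U \<Longrightarrow> f' y = f y"
    using smooth_map_onE[OF assms(2) x] by metis
  obtain V g' where V: "open V" "x \<in> V" "Cinf_on V g'" "\<And>y. y \<in> M \<Longrightarrow> y \<in> V \<Longrightarrow> g' y = g y"
    using smooth_map_onE[OF assms(3) x] by metis
  have "Cinf_on (U \<inter> V) (\<lambda>x. B (f' x) (g' x))"
    by (rule Cinf_on_bilinear[OF open_Int[OF U(1) V(1)] assms(1) Cinf_on_subset[OF U(3)] Cinf_on_subset[OF V(3)]]) auto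
  moreover have "open (U \<inter> V)" "x \<in> U \<inter> V" using U V by auto
  moreover have "\<forall>y\<in>M \<inter> (U \<inter> V). B (f' y) (g' y) = B (f y) (g y)"
    using U(4) V(4) by simp
  ultimately show "\<exists>U h. open U \<and> x \<in> U \<and> Cinf_on U h \<and> (\<forall>y\<in>M \<inter> U. h y = B (f y) (g y))"
    by (intro exI[of _ "U \<inter> V"] exI[of _ "\<lambda>x. B (f' x) (g' x)"] conjI)
qed

lemma smooth_map_on_const: "smooth_map_on M (\<lambda>x. c)"
  by (rule smooth_map_onI_open[of UNIV]) (auto simp: Cinf_on_def)

lemma smooth_map_on_linear: "bounded_linear L \<Longrightarrow> smooth_map_on M L"
  by (rule smooth_map_onI_open[of UNIV]) (auto simp: Cinf_on_def Ck_on_linear)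

lemma smooth_map_on_id: "smooth_map_on M (\<lambda>x. x)"
  by (rule smooth_map_on_linear) (rule bounded_linear_ident)

lemma smooth_map_on_linear_compose:
  "bounded_linear L \<Longrightarrow> smooth_map_on M f \<Longrightarrow> smooth_map_on M (\<lambda>x. L (f x))"
  by (rule smooth_map_on_compose[where N = UNIV]) (auto simp: smooth_map_on_linear)

lemma smooth_map_on_add:
  assumes "smooth_map_on M f" "smooth_map_on M g"
  shows "smooth_map_on M (\<lambda>x. f x + g x)"
  unfolding smooth_map_on_iff
proof
  fix x assume x: "x \<in> M"
  obtain U f' where U: "open U" "x \<in> U" "Cinf_on U f'" "\<And>y. y \<in> M \<Longrightarrow> y \<in> U \<Longrightarrow> f' y = f y"
    using smooth_map_onE[OF assms(1) x] by metis
  obtain V g' where V: "open V" "x \<in> V" "Cinf_on V g'" "\<And>y. y \<in> M \<Longrightarrow> y \<in> V \<Longrightarrow> g' y = g y"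
    using smooth_map_onE[OF assms(2) x] by metis
  have "Cinf_on (U \<inter> V) (\<lambda>x. f' x + g' x)"
    by (rule Cinf_on_add[OF open_Int[OF U(1) V(1)] Cinf_on_subset[OF U(3)] Cinf_on_subset[OF V(3)]]) auto
  moreover have "open (U \<inter> V)" "x \<in> U \<inter> V" using U V by auto
  moreover have "\<forall>y\<in>M \<inter> (U \<inter> V). f' y + g' y = f y + g y"
    using U(4) V(4) by simp
  ultimately show "\<exists>U h. open U \<and> x \<in> U \<and> Cinf_on U h \<and> (\<forall>y\<in>M \<inter> U. h y = f y + g y)"
    by (intro exI[of _ "U \<inter> V"] exI[of _ "\<lambda>x. f' x + g' x"] conjI)
qed

lemma smooth_map_on_Pair:
  assumes "smooth_map_on M f" "smooth_map_on M g"
  shows "smooth_map_on M (\<lambda>x. (f x, g x))"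
proof -
  have "bounded_linear (\<lambda>a. (a, 0))" "bounded_linear (\<lambda>b. (0, b))"
    by (intro bounded_linear_Pair bounded_linear_ident bounded_linear_zero)+
  then have "smooth_map_on M (\<lambda>x. (f x, 0) + (0, g x))"
    using assms by (intro smooth_map_on_add smooth_map_on_linear_compose[where L = "\<lambda>a. (a, 0)"]
      smooth_map_on_linear_compose[where L = "\<lambda>b. (0, b)"])
  then show ?thesis by simp
qed

lemmas smooth_map_on_snd = smooth_map_on_linear_compose[OF bounded_linear_snd]
lemmas smooth_map_on_mult = smooth_map_on_bilinear[OF bounded_bilinear_mult]
lemmas smooth_map_on_scaleR = smooth_map_on_bilinear[OF bounded_bilinear_scaleR]
lemmas smooth_map_on_inner = smooth_map_on_bilinear[OF bounded_bilinear_inner]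

lemma smooth_map_on_powr:
  fixes f :: "_ \<Rightarrow> real"
  assumes "smooth_map_on M f" "\<And>x. x \<in> M \<Longrightarrow> f x > 0"
  shows "smooth_map_on M (\<lambda>x. f x powr m)"
proof -
  have "smooth_map_on {0<..} (\<lambda>x::real. x powr m)"
    by (simp add: smooth_map_on_open Cinf_on_def Ck_on_powr)
  moreover have "f ` M \<subseteq> {0<..}" using assms(2) by auto
  ultimately show ?thesis using smooth_map_on_compose[OF assms(1)] by simp
qed

lemma smooth_map_on_sqrt:
  fixes f :: "_ \<Rightarrow> real"
  assumes "smooth_map_on M f" "\<And>x. x \<in> M \<Longrightarrow> f x > 0"
  shows "smooth_map_on M (\<lambda>x. sqrt (f x))"
  using smooth_map_on_powr[OF assms, of "1/2"] assms(2)
  by (subst smooth_map_on_cong[where g = "\<lambda>x. f x powr (1/2)"]) (auto simp: powr_half_sqrt less_imp_le)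

lemma smooth_map_on_inverse:
  fixes f :: "_ \<Rightarrow> real"
  assumes "smooth_map_on M f" "\<And>x. x \<in> M \<Longrightarrow> f x > 0"
  shows "smooth_map_on M (\<lambda>x. inverse (f x))"
  using smooth_map_on_powr[OF assms, of "-1"] assms(2)
  by (subst smooth_map_on_cong[where g = "\<lambda>x. f x powr (-1)"]) (auto simp: powr_minus less_imp_le)

section \<open>Derivatives relative to a convex set with interior\<close>

text \<open>The difference L of two derivatives kills y - x for every y in S, as is seen along the
  segment from x to y. Since S contains a ball, differences of such vectors cover every
  direction.\<close>

lemma has_derivative_within_unique_convex:
  fixes f :: "'a::real_normed_vector \<Rightarrow> 'b::real_normed_vector"
  assumes "convex S" "interior S \<noteq> {}" "x \<in> S"
    and "(f has_derivative f') (at x within S)" "(f has_derivative f'') (at x within S)"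
  shows "f' = f''"
proof -
  define L where "L = (\<lambda>v. f' v - f'' v)"
  have L: "((\<lambda>_. 0) has_derivative L) (at x within S)"
    using has_derivative_diff[OF assms(4,5)] by (simp add: L_def)
  then have lin: "linear L" by (rule has_derivative_linear)
  have zero: "L (y - x) = 0" if "y \<in> S" for y
  proof -
    let ?p = "\<lambda>t::real. x + t *\<^sub>R (y - x)"
    have "?p t \<in> S" if "t \<in> {0..1}" for t
      using convexD_alt[OF assms(1,3) \<open>y \<in> S\<close>, of t] that by (simp add: algebra_simps)
    then have sub: "?p ` {0..1} \<subseteq> S" by blast
    have "(?p has_derivative (\<lambda>t. t *\<^sub>R (y - x))) (at 0 within {0..1})"
      by (auto intro!: derivative_eq_intros)
    moreover have "((\<lambda>_. 0) has_derivative L) (at (?p 0) within ?p ` {0..1})"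
      using has_derivative_subset[OF L sub] by simp
    ultimately have "((\<lambda>_. 0) has_derivative (\<lambda>t. L (t *\<^sub>R (y - x)))) (at 0 within {0..1})"
      by (rule has_derivative_in_compose)
    then have "((\<lambda>_. 0) has_vector_derivative L (y - x)) (at (0::real) within {0..1})"
      using lin by (simp add: has_vector_derivative_def linear_cmul)
    then show ?thesis
      using vector_derivative_unique_within_closed_interval[of 0 1 0 "\<lambda>_. 0" "L (y - x)" 0] by simp
  qed
  obtain c e where ce: "e > 0" "ball c e \<subseteq> S"
    using assms(2) by (metis all_not_in_conv mem_interior)
  have "L v = 0" for v
  proof (cases "v = 0")
    case False
    \<comment> \<open>Scaled so that s v has length e / 2 and c + s v stays in the ball.\<close>
    define s where "s = e / 2 / norm v"
    have "c + s *\<^sub>R v \<in> S" "c \<in> S" "s \<noteq> 0"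
      using ce False by (auto simp: s_def dist_norm intro!: subsetD[OF ce(2)])
    then have "L (c + s *\<^sub>R v - x) - L (c - x) = 0" by (simp add: zero)
    then have "s *\<^sub>R L v = 0" using lin by (simp flip: linear_diff linear_cmul)
    then show ?thesis using \<open>s \<noteq> 0\<close> by simp
  qed (use lin linear_0 in auto)
  then show ?thesis by (auto simp: L_def fun_eq_iff)
qed

lemma frechet_derivative_within_eq:
  assumes "convex S" "interior S \<noteq> {}" "x \<in> S" "(f has_derivative f') (at x within S)"
  shows "frechet_derivative f (at x within S) = f'"
  using assms has_derivative_within_unique_convex frechet_derivative_works
  by (metis differentiableI)

lemma has_derivative_within_cong:
  assumes "x \<in> S" "\<And>y. y \<in> S \<Longrightarrow> f y = g y"
  shows "(f has_derivative D) (at x within S) \<longleftrightarrow> (g has_derivative D) (at x within S)"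
  using has_derivative_transform[OF assms(1), of f g D] has_derivative_transform[OF assms(1), of g f D] assms(2)
  by metis

text \<open>Each local extension has, at the points of S, the derivative of f relative to S;
  uniqueness makes this independent of the extension. Hence derivatives of local extensions are
  local extensions of the derivative.\<close>

lemma smooth_map_on_derivative:
  assumes "convex S" "interior S \<noteq> {}" "smooth_map_on S f"
  shows "x \<in> S \<Longrightarrow> (f has_derivative frechet_derivative f (at x within S)) (at x within S)"
    and "smooth_map_on S (\<lambda>x. frechet_derivative f (at x within S) v)"
proof -
  have *: "\<exists>U g. open U \<and> x \<in> U \<and> Cinf_on U g \<and>
      (\<forall>y\<in>S \<inter> U. (f has_derivative frechet_derivative g (at y)) (at y within S))" if x: "x \<in> S" for x
  proof -
    obtain U g where U: "open U" "x \<in> U" "Cinf_on U g" "\<And>y. y \<in> S \<Longrightarrow> y \<in> U \<Longrightarrow> g y = f y"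
      using smooth_map_onE[OF assms(3) x] by metis
    have "(f has_derivative frechet_derivative g (at y)) (at y within S)" if y: "y \<in> S \<inter> U" for y
    proof -
      have "(g has_derivative frechet_derivative g (at y)) (at y within S)"
        using has_derivative_at_withinI[OF Cinf_onD(1)[OF U(3)]] y by simp
      moreover obtain d where "d > 0" "ball y d \<subseteq> U"
        using U(1) y unfolding open_contains_ball by (metis IntD2)
      ultimately show ?thesis
        using U(4) y by (elim has_derivative_transform_within) (auto simp: dist_commute subset_iff)
    qed
    then show ?thesis using U(1,2,3) by (intro exI[of _ U] exI[of _ g] conjI ballI)
  qed
  show "x \<in> S \<Longrightarrow> (f has_derivative frechet_derivative f (at x within S)) (at x within S)"
    using *[of x] frechet_derivative_works[of f "at x within S"] by (auto simp: differentiable_def)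
  show "smooth_map_on S (\<lambda>x. frechet_derivative f (at x within S) v)"
    unfolding smooth_map_on_iff
  proof
    fix x assume "x \<in> S"
    then obtain U g where U: "open U" "x \<in> U" "Cinf_on U g"
      "\<forall>y\<in>S \<inter> U. (f has_derivative frechet_derivative g (at y)) (at y within S)" using * by metis
    then have "\<forall>y\<in>S \<inter> U. frechet_derivative g (at y) v = frechet_derivative f (at y within S) v"
      using frechet_derivative_within_eq[OF assms(1,2)] by (metis IntD1)
    then show "\<exists>U h. open U \<and> x \<in> U \<and> Cinf_on U h \<and>
        (\<forall>y\<in>S \<inter> U. h y = frechet_derivative f (at y within S) v)"
      using U(1,2) Cinf_onD(2)[OF U(3), of v]
      by (intro exI[of _ U] exI[of _ "\<lambda>y. frechet_derivative g (at y) v"] conjI)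
  qed
qed

lemma partials_cong:
  assumes "x \<in> S" "\<And>y. y \<in> S \<Longrightarrow> f y = g y"
  shows "partials S vs f x = partials S vs g x"
  using assms(2)
proof (induction vs arbitrary: f g)
  case (Cons v vs)
  have "frechet_derivative f (at y within S) = frechet_derivative g (at y within S)" if "y \<in> S" for y
    unfolding frechet_derivative_def using has_derivative_within_cong[OF that, of f g] Cons.prems by metis
  then show ?case unfolding partials.simps by (intro Cons.IH) simp
next
  case Nil
  then show ?case using assms(1) by simp
qed

section \<open>Hadamard division and even functions of one variable\<close>

lemma Cinf_on_realD:
  fixes f :: "real \<Rightarrow> real"
  assumes "open U" "Cinf_on U f"
  shows "x \<in> U \<Longrightarrow> (f has_real_derivative deriv f x) (at x)"
    and "Cinf_on U (deriv f)"
proof -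
  have *: "(f has_real_derivative frechet_derivative f (at x) 1) (at x)" if "x \<in> U" for x
  proof -
    have D: "(f has_derivative frechet_derivative f (at x)) (at x)"
      using Cinf_onD(1)[OF assms(2) that] .
    then have "linear (frechet_derivative f (at x))" by (rule has_derivative_linear)
    then have "frechet_derivative f (at x) v = frechet_derivative f (at x) 1 * v" for v
      using linear_cmul[of "frechet_derivative f (at x)" v 1] by (simp add: mult.commute)
    then have "frechet_derivative f (at x) = (*) (frechet_derivative f (at x) 1)"
      by (rule ext)
    then show ?thesis unfolding has_field_derivative_def using D by metis
  qed
  then have eq: "deriv f x = frechet_derivative f (at x) 1" if "x \<in> U" for x
    using that DERIV_imp_deriv by blast
  show "x \<in> U \<Longrightarrow> (f has_real_derivative deriv f x) (at x)"
    using * eq by metis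
  show "Cinf_on U (deriv f)"
    using Cinf_on_cong[OF assms(1), of "deriv f" "\<lambda>x. frechet_derivative f (at x) 1"] eq Cinf_onD(2)[OF assms(2), of 1]
    by simp
qed

lemma Cinf_on_funpow_deriv:
  fixes f :: "real \<Rightarrow> real"
  assumes "open U" "Cinf_on U f"
  shows "Cinf_on U ((deriv ^^ n) f)"
  using assms by (induction n) (auto intro: Cinf_on_realD(2))

lemma Ck_on_real_derivativeI:
  fixes f :: "real \<Rightarrow> real"
  assumes "open U" "\<And>x. x \<in> U \<Longrightarrow> (f has_real_derivative f' x) (at x)" "Ck_on k U f'"
  shows "Ck_on (Suc k) U f"
  using assms Ck_on_realI by (metis has_real_derivative_iff_has_vector_derivative)

text \<open>With n = 0 and f replaced by its derivative this is the Hadamard quotient. Each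
  differentiation in x brings out a factor u, and the weight u^n makes the family closed under
  it.\<close>

definition dilation_integral :: "nat \<Rightarrow> (real \<Rightarrow> real) \<Rightarrow> real \<Rightarrow> real" where
  "dilation_integral n f x = integral {0..1} (\<lambda>u. u ^ n * f (u * x))"

lemma dilation_mem:
  fixes a u x :: real
  assumes "x \<in> {-a<..<a}" "u \<in> {0..1}" shows "u * x \<in> {-a<..<a}"
proof -
  have "\<bar>u * x\<bar> \<le> \<bar>x\<bar>" using assms(2) by (simp add: abs_mult mult_left_le_one_le)
  then show ?thesis using assms(1) by auto
qed

lemma continuous_on_dilation:
  assumes "continuous_on {-a<..<a} f"
  shows "continuous_on ({-a<..<a} \<times> {0..1}) (\<lambda>(x, u::real). u ^ n * f (u * x :: real))"
proof -
  have "continuous_on ({-a<..<a} \<times> {0..1}) (\<lambda>p. f (snd p * fst p))"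
    using assms by (rule continuous_on_compose2)
      (use dilation_mem in \<open>auto intro!: continuous_intros simp del: greaterThanLessThan_iff\<close>)
  then show ?thesis by (simp add: case_prod_beta continuous_intros)
qed

lemma dilation_integrable:
  assumes "continuous_on {-a<..<a} f" "x \<in> {-a<..<a}"
  shows "(\<lambda>u::real. u ^ n * f (u * x :: real)) integrable_on {0..1}"
proof -
  have "continuous_on {0..1} (\<lambda>u. f (u * x))"
    using assms(1) by (rule continuous_on_compose2)
      (use dilation_mem[OF assms(2)] in \<open>auto intro!: continuous_intros simp del: greaterThanLessThan_iff\<close>)
  then show ?thesis
    by (intro integrable_continuous_real continuous_intros)
qed

text \<open>Differentiation under the integral sign: the differentiated integrand is jointly
  continuous over the compact range of u.\<close>

lemma has_derivative_dilation_integral: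
  assumes "Cinf_on {-a<..<a} f" "x \<in> {-a<..<a}"
  shows "(dilation_integral n f has_real_derivative dilation_integral (Suc n) (deriv f) x) (at x)"
proof -
  let ?J = "{-a<..<a}"
  have D: "((\<lambda>x. u ^ n * f (u * x)) has_field_derivative u ^ Suc n * deriv f (u * x)) (at x within ?J)"
    if "x \<in> ?J" "u \<in> cbox 0 1" for x u
  proof -
    have "(f has_real_derivative deriv f (u * x)) (at (u * x))"
      using Cinf_on_realD(1)[OF _ assms(1)] dilation_mem that by (auto simp del: greaterThanLessThan_iff)
    then have "((\<lambda>x. f (u * x)) has_real_derivative deriv f (u * x) * u) (at x)"
      by (rule DERIV_chain2) (auto intro!: derivative_eq_intros)
    then have "((\<lambda>x. u ^ n * f (u * x)) has_real_derivative u ^ n * (deriv f (u * x) * u)) (at x)"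
      by (rule DERIV_cmult)
    then show ?thesis by (simp add: mult.assoc mult.commute mult.left_commute has_field_derivative_at_within)
  qed
  have "((\<lambda>x. integral (cbox 0 1) (\<lambda>u. u ^ n * f (u * x))) has_field_derivative
      integral (cbox 0 1) (\<lambda>u. u ^ Suc n * deriv f (u * x))) (at x within ?J)"
  proof (rule leibniz_rule_field_derivative[OF D])
    show "(\<lambda>u. u ^ n * f (u * x)) integrable_on cbox 0 1" if "x \<in> ?J" for x
      using dilation_integrable[OF Cinf_on_continuous[OF assms(1)] that] by simp
    show "continuous_on (?J \<times> cbox 0 1) (\<lambda>(x, u). u ^ Suc n * deriv f (u * x))"
      using continuous_on_dilation[OF Cinf_on_continuous[OF Cinf_on_realD(2)[OF _ assms(1)]], of "Suc n"]
      by (simp del: power_Suc)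
  qed (use assms in auto)
  then show ?thesis
    using assms(2) at_within_open[OF assms(2)]
    by (simp add: dilation_integral_def[abs_def] del: power_Suc greaterThanLessThan_iff)
qed

lemma Cinf_on_dilation_integral:
  assumes "Cinf_on {-a<..<a} f"
  shows "Cinf_on {-a<..<a} (dilation_integral n f)"
proof -
  have "Ck_on k {-a<..<a} (dilation_integral n f)" for k
    using assms
  proof (induction k arbitrary: n f)
    case 0
    have "continuous_on {-a<..<a} (dilation_integral n f)"
      by (intro continuous_at_imp_continuous_on ballI)
        (rule DERIV_isCont[OF has_derivative_dilation_integral[OF 0]])
    then show ?case by simp
  next
    case (Suc k)
    show ?case
      by (rule Ck_on_real_derivativeI[OF _ has_derivative_dilation_integral[OF Suc.prems]])
        (auto intro: Suc.IH[OF Cinf_on_realD(2)[OF _ Suc.prems]])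
  qed
  then show ?thesis by (simp add: Cinf_on_def)
qed

lemma funpow_deriv_dilation_integral:
  assumes "Cinf_on {-a<..<a} f" "x \<in> {-a<..<a}"
  shows "(deriv ^^ m) (dilation_integral n f) x = dilation_integral (n + m) ((deriv ^^ m) f) x"
  using assms(2)
proof (induction m arbitrary: x)
  case (Suc m)
  have "Cinf_on {-a<..<a} ((deriv ^^ m) f)" using assms(1) by (rule Cinf_on_funpow_deriv[OF open_greaterThanLessThan])
  then have "(dilation_integral (n + m) ((deriv ^^ m) f) has_real_derivative
      dilation_integral (Suc (n + m)) (deriv ((deriv ^^ m) f)) x) (at x)"
    using Suc.prems by (rule has_derivative_dilation_integral)
  then have "((deriv ^^ m) (dilation_integral n f) has_real_derivative
      dilation_integral (Suc (n + m)) (deriv ((deriv ^^ m) f)) x) (at x)"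
    using Suc.prems Suc.IH
    by (elim has_field_derivative_transform_within_open[where S = "{-a<..<a}"]) auto
  then show ?case by (simp add: DERIV_imp_deriv)
qed simp

definition divide_by_id :: "(real \<Rightarrow> real) \<Rightarrow> real \<Rightarrow> real" where
  "divide_by_id f = dilation_integral 0 (deriv f)"

lemma Cinf_on_divide_by_id:
  "Cinf_on {-a<..<a} f \<Longrightarrow> Cinf_on {-a<..<a} (divide_by_id f)"
  unfolding divide_by_id_def by (intro Cinf_on_dilation_integral Cinf_on_realD(2)) auto

text \<open>Hadamard's lemma: integrate the derivative of u |-> f (u x) over [0, 1]; the lower limit
  contributes f 0 = 0.\<close>

lemma divide_by_id:
  assumes "Cinf_on {-a<..<a} f" "x \<in> {-a<..<a}" "f 0 = 0"
  shows "f x = x * divide_by_id f x"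
proof -
  have D: "((\<lambda>u. f (u * x)) has_vector_derivative x * deriv f (u * x)) (at u within {0..1})"
    if "u \<in> {0..1}" for u
  proof -
    have "(f has_real_derivative deriv f (u * x)) (at (u * x))"
      using Cinf_on_realD(1)[OF _ assms(1)] dilation_mem[OF assms(2) that] by simp
    then have "((\<lambda>u. f (u * x)) has_real_derivative deriv f (u * x) * x) (at u)"
      by (rule DERIV_chain2) (auto intro!: derivative_eq_intros)
    then show ?thesis
      by (simp add: mult.commute has_real_derivative_iff_has_vector_derivative has_vector_derivative_at_within)
  qed
  have "((\<lambda>u. x * deriv f (u * x)) has_integral f (1 * x) - f (0 * x)) {0..1}"
    by (rule fundamental_theorem_of_calculus) (use D in auto)
  then have "integral {0..1} (\<lambda>u. x * deriv f (u * x)) = f x"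
    using assms(3) by (simp add: integral_unique del: integral_mult_right)
  then show ?thesis by (simp add: divide_by_id_def dilation_integral_def)
qed

section \<open>Even functions and their composition with the norm\<close>

lemma deriv_even:
  fixes K :: "real \<Rightarrow> real"
  assumes "Cinf_on {-a<..<a} K" "\<And>x. x \<in> {-a<..<a} \<Longrightarrow> K (- x) = K x" "x \<in> {-a<..<a}"
  shows "deriv K (- x) = - deriv K x"
proof -
  have "(K has_real_derivative deriv K (- x)) (at (- x))"
    using Cinf_on_realD(1)[OF _ assms(1)] assms(3) by auto
  then have "((\<lambda>x. K (- x)) has_real_derivative deriv K (- x) * (- 1)) (at x)"
    by (rule DERIV_chain2) (auto intro!: derivative_eq_intros)
  then have "(K has_real_derivative deriv K (- x) * (- 1)) (at x)"
    using assms by (elim has_field_derivative_transform_within_open[where S = "{-a<..<a}"]) auto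
  then have "deriv K x = deriv K (- x) * (- 1)" by (rule DERIV_imp_deriv)
  then show ?thesis by simp
qed

lemma divide_by_id_odd:
  fixes f :: "real \<Rightarrow> real"
  assumes "Cinf_on {-a<..<a} f" "\<And>x. x \<in> {-a<..<a} \<Longrightarrow> f (- x) = - f x" "x \<in> {-a<..<a}"
  shows "divide_by_id f (- x) = divide_by_id f x"
proof (cases "x = 0")
  case False
  have "f 0 = 0" using assms(2)[of 0] assms(3) by auto
  then have "- x * divide_by_id f (- x) = - (x * divide_by_id f x)"
    using divide_by_id[OF assms(1), of x] divide_by_id[OF assms(1), of "- x"] assms(2)[OF assms(3)] assms(3)
    by auto
  then show ?thesis using False by simp
qed simp

text \<open>The operation K |-> K'(x) / x does not leave the smooth even functions, since K' is odd
  and vanishes at 0. This closure is what lets inductions on the order of differentiation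
  run.\<close>

lemma even_deriv_quotient:
  fixes K :: "real \<Rightarrow> real"
  assumes "Cinf_on {-a<..<a} K" "\<And>x. x \<in> {-a<..<a} \<Longrightarrow> K (- x) = K x"
  shows "Cinf_on {-a<..<a} (divide_by_id (deriv K))"
    and "x \<in> {-a<..<a} \<Longrightarrow> divide_by_id (deriv K) (- x) = divide_by_id (deriv K) x"
    and "x \<in> {-a<..<a} \<Longrightarrow> deriv K x = x * divide_by_id (deriv K) x"
proof -
  have D: "Cinf_on {-a<..<a} (deriv K)" by (rule Cinf_on_realD(2)[OF _ assms(1)]) simp
  then show "Cinf_on {-a<..<a} (divide_by_id (deriv K))" by (rule Cinf_on_divide_by_id)
  show "divide_by_id (deriv K) (- x) = divide_by_id (deriv K) x" if "x \<in> {-a<..<a}"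
    by (rule divide_by_id_odd[OF D deriv_even[OF assms] that])
  show "deriv K x = x * divide_by_id (deriv K) x" if x: "x \<in> {-a<..<a}"
  proof (rule divide_by_id[OF D x])
    have "deriv K (- 0) = - deriv K 0" by (rule deriv_even[OF assms]) (use x in auto)
    then show "deriv K 0 = 0" by simp
  qed
qed

text \<open>For z different from 0 the chain rule gives K'(|z|) times the inner product with z /
  |z|, and the quotient absorbs the division by |z|. In this form the derivative makes sense at 0 as
  well.\<close>

lemma has_derivative_even_norm:
  fixes K :: "real \<Rightarrow> real" and z :: "'a::euclidean_space"
  assumes "Cinf_on {-a<..<a} K" "\<And>x. x \<in> {-a<..<a} \<Longrightarrow> K (- x) = K x" "norm z < a"
  shows "((\<lambda>z. K (norm z)) has_derivative (\<lambda>v. (v \<bullet> z) * divide_by_id (deriv K) (norm z))) (at z)"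
proof -
  have mem: "norm z \<in> {-a<..<a}" using assms(3) norm_ge_zero[of z] by (auto simp del: norm_ge_zero)
  have K: "(K has_derivative (\<lambda>h. deriv K (norm z) * h)) (at (norm z))"
    using Cinf_on_realD(1)[OF _ assms(1) mem] by (simp add: has_field_derivative_def)
  show ?thesis
  proof (cases "z = 0")
    case False
    have "(norm has_derivative (\<lambda>v. v \<bullet> sgn z)) (at z)"
      using has_derivative_norm[OF False] by simp
    from has_derivative_compose[OF this K]
    have "((\<lambda>z. K (norm z)) has_derivative (\<lambda>v. deriv K (norm z) * (v \<bullet> sgn z))) (at z)" .
    moreover have "deriv K (norm z) * (v \<bullet> sgn z) = (v \<bullet> z) * divide_by_id (deriv K) (norm z)" for v
      using even_deriv_quotient(3)[OF assms(1,2) mem] False by (simp add: sgn_div_norm)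
    ultimately show ?thesis by simp
  next
    \<comment> \<open>The norm has no derivative here. Evenness gives K'(0) = 0, so K(|z|) - K(0) is
      of smaller order than |z|.\<close>
    case True
    have "deriv K 0 = 0" using even_deriv_quotient(3)[OF assms(1,2), of 0] mem True by auto
    then have "(K has_derivative (\<lambda>_. 0)) (at 0)" using K True by simp
    then have "((\<lambda>z::'a. K (norm z)) has_derivative (\<lambda>_. 0)) (at 0)"
      unfolding has_derivative_at_alt
      by (auto simp: bounded_linear_zero) (metis abs_norm_cancel real_norm_def)
    then show ?thesis using True by simp
  qed
qed


text \<open>One derivative of K(|z|) is a linear function of z times E(|z|), where E = K'/x is again
  smooth and even, so the induction hypothesis applies to E.\<close>

lemma Cinf_on_even_norm:
  fixes K :: "real \<Rightarrow> real"
  assumes "Cinf_on {-a<..<a} K" "\<And>x. x \<in> {-a<..<a} \<Longrightarrow> K (- x) = K x"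
  shows "Cinf_on (ball 0 a) (\<lambda>z::'a::euclidean_space. K (norm z))"
proof -
  have "Ck_on k (ball 0 a) (\<lambda>z::'a. K (norm z))" for k
    using assms
  proof (induction k arbitrary: K)
    case 0
    have "isCont (\<lambda>z::'a. K (norm z)) z" if "norm z < a" for z
      using has_derivative_continuous[OF has_derivative_even_norm[OF 0 that]] .
    then show ?case by (auto intro!: continuous_at_imp_continuous_on)
  next
    case (Suc k)
    note E = even_deriv_quotient[OF Suc.prems]
    show ?case
    proof (rule Ck_on_SucI)
      show "((\<lambda>z. K (norm z)) has_derivative (\<lambda>v. (v \<bullet> z) * divide_by_id (deriv K) (norm z))) (at z)"
        if "z \<in> ball 0 a" for z :: 'a
        using that by (intro has_derivative_even_norm[OF Suc.prems]) auto
      show "Ck_on k (ball 0 a) (\<lambda>z::'a. (v \<bullet> z) * divide_by_id (deriv K) (norm z))" for v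
        by (rule Ck_on_mult[OF open_ball Ck_on_linear[OF open_ball bounded_linear_inner_right]
              Suc.IH[OF E(1,2)]])
    qed simp
  qed
  then show ?thesis by (simp add: Cinf_on_def)
qed

section \<open>Inverses and extensions of functions of one variable\<close>

text \<open>Bootstrapping: g' = 1 / f'(g), so if g is of class C^k then so is g'. The reciprocal is
  written as a power with exponent -1, whose smoothness on the positive reals is known.\<close>

lemma Cinf_on_inverse_function:
  fixes f g :: "real \<Rightarrow> real"
  assumes "open U" "open V" "Cinf_on U f" "g ` V \<subseteq> U"
    and "\<And>x. x \<in> U \<Longrightarrow> g (f x) = x" "\<And>y. y \<in> V \<Longrightarrow> f (g y) = y"
    and "\<And>x. x \<in> U \<Longrightarrow> deriv f x > 0"
  shows "Cinf_on V g"
proof -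
  have D: "(g has_real_derivative inverse (deriv f (g y))) (at y)" if y: "y \<in> V" for y
  proof -
    have gy: "g y \<in> U" using assms(4) y by blast
    have "(g has_derivative (*) (inverse (deriv f (g y)))) (at (f (g y)))"
    proof (rule has_derivative_inverse_strong[OF assms(1) gy Cinf_on_continuous[OF assms(3)] assms(5)])
      show "(f has_derivative (*) (deriv f (g y))) (at (g y))"
        using Cinf_on_realD(1)[OF assms(1,3) gy] by (simp add: has_field_derivative_def)
      show "(*) (deriv f (g y)) \<circ> (*) (inverse (deriv f (g y))) = id"
        using assms(7)[OF gy] by (auto simp: fun_eq_iff)
    qed
    then show ?thesis using assms(6)[OF y] by (simp add: has_field_derivative_def)
  qed
  have "Ck_on k V g" for k
  proof (induction k)
    case 0
    have "continuous_on V g"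
      by (intro continuous_at_imp_continuous_on ballI) (rule DERIV_isCont[OF D])
    then show ?case by simp
  next
    case (Suc k)
    have f': "Ck_on k U (deriv f)"
      using Cinf_on_realD(2)[OF assms(1,3)] by (simp add: Cinf_on_def)
    have c: "Ck_on k V (\<lambda>y. deriv f (g y))"
      by (rule Ck_on_compose[OF assms(2,4) f' Suc.IH])
    have "(\<lambda>y. deriv f (g y)) ` V \<subseteq> {0<..}" using assms(4,7) by auto
    then have p: "Ck_on k V (\<lambda>y. deriv f (g y) powr (- 1))"
      by (rule Ck_on_compose[OF assms(2) _ Ck_on_powr c])
    have "(g has_real_derivative deriv f (g y) powr (- 1)) (at y)" if "y \<in> V" for y
    proof -
      have "deriv f (g y) > 0" using assms(4,7) that by blast
      then show ?thesis using D[OF that] by (simp add: powr_minus)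
    qed
    then show ?case by (rule Ck_on_real_derivativeI[OF assms(2) _ p])
  qed
  then show ?thesis by (simp add: Cinf_on_def)
qed

lemma odd_diffeo_inverse:
  fixes f :: "real \<Rightarrow> real"
  assumes "Cinf_on {-a<..<a} f" "\<And>x. x \<in> {-a<..<a} \<Longrightarrow> f (- x) = - f x"
    and "\<And>x. x \<in> {-a<..<a} \<Longrightarrow> deriv f x > 0" "1 < a" "f 1 = 1"
  obtains b g where "1 < b" "Cinf_on {-b<..<b} g" "\<And>y. y \<in> {-b<..<b} \<Longrightarrow> g y \<in> {-a<..<a}"
    and "\<And>y. y \<in> {-b<..<b} \<Longrightarrow> f (g y) = y" "\<And>y. y \<in> {-b<..<b} \<Longrightarrow> g (- y) = - g y"
    and "\<And>y. 0 \<le> y \<Longrightarrow> y \<le> 1 \<Longrightarrow> 0 \<le> g y \<and> g y \<le> 1" "\<And>x. x \<in> {-a<..<a} \<Longrightarrow> g (f x) = x"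
proof -
  let ?J = "{-a<..<a}"
  have less: "f x < f y" if "x \<in> ?J" "y \<in> ?J" "x < y" for x y
  proof (rule DERIV_pos_imp_increasing[OF that(3)])
    fix z assume "x \<le> z" "z \<le> y"
    then have "z \<in> ?J" using that by auto
    then show "\<exists>d. (f has_real_derivative d) (at z) \<and> d > 0"
      using Cinf_on_realD(1)[OF open_greaterThanLessThan assms(1)] assms(3) by blast
  qed
  have le: "f x \<le> f y \<longleftrightarrow> x \<le> y" if "x \<in> ?J" "y \<in> ?J" for x y
    using less[OF that] less[OF that(2,1)] by (cases x y rule: linorder_cases) auto
  have inj: "inj_on f ?J" using less by (intro linorder_inj_onI') (metis less_irrefl)
  define g where "g = inv_into ?J f"
  \<comment> \<open>Any point strictly between 1 and a would do: the closed interval [-c, c] lies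
    inside the domain, and its image [-b, b] reaches beyond 1 because f increases and f 1 =
    1.\<close>
  define c where "c = (1 + a) / 2"
  have c: "1 < c" "c < a" using assms(4) by (auto simp: c_def)
  define b where "b = f c"
  have b: "1 < b" using less[of 1 c] c assms(4,5) by (simp add: b_def)
  have gf: "g (f x) = x" if "x \<in> ?J" for x
    unfolding g_def using inj that by (rule inv_into_f_f)
  have ex: "\<exists>x\<in>?J. f x = y" if "y \<in> {-b<..<b}" for y
  proof -
    have "continuous_on {-c..c} f"
      using Cinf_on_continuous[OF assms(1)] c by (rule_tac continuous_on_subset) auto
    moreover have "f (- c) \<le> y" "y \<le> f c" using that assms(2)[of c] c by (auto simp: b_def)
    ultimately obtain x where "-c \<le> x" "x \<le> c" "f x = y"
      using IVT'[of f "-c" y c] c by auto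
    then show ?thesis using c by (intro bexI[of _ x]) auto
  qed
  then have fim: "y \<in> f ` ?J" if "y \<in> {-b<..<b}" for y using that by blast
  have fg: "f (g y) = y" and gJ: "g y \<in> ?J" if "y \<in> {-b<..<b}" for y
    unfolding g_def using f_inv_into_f[OF fim[OF that]] inv_into_into[OF fim[OF that]] by auto
  have "Cinf_on {-b<..<b} g"
    by (rule Cinf_on_inverse_function[OF _ _ assms(1) _ gf fg assms(3)]) (use gJ in auto)
  moreover have "g (- y) = - g y" if "y \<in> {-b<..<b}" for y
  proof -
    have "f (- g y) = - y" using assms(2)[OF gJ[OF that]] fg[OF that] by simp
    moreover have "- g y \<in> ?J" using gJ[OF that] by auto
    ultimately show ?thesis using gf by metis
  qed
  moreover have "0 \<le> g y \<and> g y \<le> 1" if "0 \<le> y" "y \<le> 1" for y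
  proof -
    have y: "y \<in> {-b<..<b}" using that b by auto
    have "f 0 = 0" using assms(2)[of 0] assms(4) by auto
    then show ?thesis
      using le[OF _ gJ[OF y], of 0] le[OF gJ[OF y], of 1] fg[OF y] that assms(4,5) by simp
  qed
  ultimately show ?thesis using that[of b g] b fg gJ gf by blast
qed

text \<open>Near 1 a local smooth extension is taken and near -1 its reflection, so evenness
  survives. Passing beyond [-1, 1] makes the calculus on open symmetric intervals available up to
  the boundary radius.\<close>

lemma even_smooth_extension:
  fixes f :: "real \<Rightarrow> real"
  assumes "smooth_map_on {-1..1} f" "\<And>x. f (- x) = f x"
  obtains a K where "1 < a" "Cinf_on {-a<..<a} K" "\<And>x. K (- x) = K x"
    and "\<And>x. x \<in> {-1..1} \<Longrightarrow> K x = f x"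
proof -
  obtain U g where U: "open U" "1 \<in> U" "Cinf_on U g" "\<And>y. y \<in> {-1..1} \<Longrightarrow> y \<in> U \<Longrightarrow> g y = f y"
    using smooth_map_onE[OF assms(1), of 1] by auto
  obtain d where d: "d > 0" "ball 1 d \<subseteq> U" using U(1,2) openE by blast
  \<comment> \<open>With e at most 1 every point of \<open>ball 1 e\<close> is positive, so it lies
    in [-1, 1] as soon as it is at most 1.\<close>
  define e where "e = min d 1"
  have e: "0 < e" "e \<le> 1" "ball 1 e \<subseteq> U" using d by (auto simp: e_def)
  define K where "K x = (if x \<in> {-1..1} then f x else g \<bar>x\<bar>)" for x
  have K1: "K x = f x" if "x \<in> {-1..1}" for x using that by (simp add: K_def)
  have Kg: "K x = g x" if "x \<in> ball 1 e" for x
  proof (cases "x \<le> 1")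
    case True
    then have "x \<in> {-1..1}" using that e by (auto simp: dist_real_def)
    then show ?thesis using U(4)[of x] that e(3) K1 by auto
  next
    case False
    then show ?thesis by (simp add: K_def)
  qed
  have even: "K (- x) = K x" for x using assms(2) by (auto simp: K_def)
  have Cg: "Cinf_on (ball 1 e) g" using U(3) e(3) by (rule Cinf_on_subset)
  have "Cinf_on (ball (-1) e) (\<lambda>x. g (- x))"
  proof (rule Cinf_on_compose[OF open_ball _ Cg])
    show "Cinf_on (ball (- 1) e) (\<lambda>x::real. - x)"
      unfolding Cinf_on_def by (intro allI Ck_on_linear open_ball bounded_linear_minus bounded_linear_ident)
  qed (auto simp: dist_real_def)
  moreover have "Cinf_on {-1<..<1} f"
    using smooth_map_on_subset[OF assms(1), of "{-1<..<1}"] smooth_map_on_open[of "{-1<..<1}" f]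
    by (simp add: greaterThanLessThan_subseteq_atLeastAtMost_iff)
  moreover have "K x = g (- x)" if "x \<in> ball (-1) e" for x
    using even[of x] Kg[of "- x"] that by (simp add: dist_real_def abs_minus_commute add.commute)
  ultimately have "smooth_map_on {-(1 + e)<..<1 + e} K"
    unfolding smooth_map_on_iff
  proof (intro ballI, goal_cases)
    case (1 x)
    then consider "x \<in> {-1<..<1}" | "x \<in> ball 1 e" | "x \<in> ball (-1) e"
      by (fastforce simp: dist_real_def)
    then show ?case
    proof cases
      case 1
      then show ?thesis
        using \<open>Cinf_on {-1<..<1} f\<close> K1 by (intro exI[of _ "{-1<..<1}"] exI[of _ f]) auto
    next
      case 2
      then show ?thesis using Cg Kg by (intro exI[of _ "ball 1 e"] exI[of _ g]) auto
    next
      case 3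
      then show ?thesis
        using \<open>Cinf_on (ball (-1) e) (\<lambda>x. g (- x))\<close> \<open>\<And>x. x \<in> ball (-1) e \<Longrightarrow> K x = g (- x)\<close>
        by (intro exI[of _ "ball (-1) e"] exI[of _ "\<lambda>x. g (- x)"]) auto
    qed
  qed
  then have "Cinf_on {-(1 + e)<..<1 + e} K" by (simp add: smooth_map_on_open)
  then show ?thesis using that[of "1 + e" K] e even K1 by simp
qed

section \<open>The radius function of a foliated diffeomorphism\<close>

definition radius :: "complex \<times> complex \<Rightarrow> real" where
  "radius p = norm (snd p)"

lemma radius_Pair [simp]: "radius (w, z) = norm z"
  by (simp add: radius_def)

lemma mem_solid_torus: "p \<in> solid_torus \<longleftrightarrow> norm (fst p) = 1 \<and> radius p \<le> 1"
  by (auto simp: solid_torus_def radius_def mem_Times_iff)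

lemma radius_nonneg [simp]: "0 \<le> radius p"
  by (simp add: radius_def)

text \<open>Radii are used in place of their squares; the square root maps [0, 1] onto itself, so
  the family of leaves is the same.\<close>

lemma torus_foliation_leaves:
  "torus_foliation = (\<lambda>r. {p \<in> solid_torus. radius p = r}) ` {0..1}"
proof -
  have "{p \<in> solid_torus. torus_fun p = t} = {p \<in> solid_torus. radius p = sqrt t}" if "t \<in> {0..1}" for t
    using that by (auto simp: torus_fun_def radius_def real_sqrt_unique)
  then have "torus_foliation = (\<lambda>t. {p \<in> solid_torus. radius p = sqrt t}) ` {0..1}"
    unfolding torus_foliation_def by (rule image_cong[OF refl])
  also have "\<dots> = (\<lambda>r. {p \<in> solid_torus. radius p = r}) ` sqrt ` {0..1}"
    by (simp add: image_image)
  also have "sqrt ` {0..1} = {0..1::real}"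
  proof
    show "{0..1::real} \<subseteq> sqrt ` {0..1}"
    proof
      fix x :: real assume "x \<in> {0..1}"
      then have "x = sqrt (x\<^sup>2)" "x\<^sup>2 \<in> {0..1}" by (auto simp: power_le_one)
      then show "x \<in> sqrt ` {0..1}" by blast
    qed
  qed auto
  finally show ?thesis .
qed

text \<open>The leaves are the fibres of \<open>radius\<close>. Injectivity lets membership of h q
  in the image of a leaf be pulled back to q; surjectivity makes the image of a leaf fill a whole
  leaf.\<close>

lemma foliated_torus_iff:
  assumes "bij_betw h solid_torus solid_torus"
  shows "foliated torus_foliation h \<longleftrightarrow>
    (\<forall>p\<in>solid_torus. \<forall>q\<in>solid_torus. radius p = radius q \<longleftrightarrow> radius (h p) = radius (h q))"
    (is "_ \<longleftrightarrow> ?R")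
proof
  have inj: "inj_on h solid_torus" and im: "h ` solid_torus = solid_torus"
    using assms by (auto simp: bij_betw_def)
  let ?leaf = "\<lambda>r. {p \<in> solid_torus. radius p = r}"
  {
    assume L: "foliated torus_foliation h"
    have "radius p = radius q \<longleftrightarrow> radius (h p) = radius (h q)" if p: "p \<in> solid_torus" and q: "q \<in> solid_torus" for p q
    proof -
      have "radius p \<in> {0..1}" using p by (auto simp: mem_solid_torus)
      then have "h ` ?leaf (radius p) \<in> torus_foliation"
        using L unfolding foliated_def torus_foliation_leaves by blast
      then obtain s where s: "h ` ?leaf (radius p) = ?leaf s"
        unfolding torus_foliation_leaves by blast
      have hp: "radius (h p) = s" using s p by blast
      have hq: "h q \<in> solid_torus" using im q by blast
      have "radius (h q) = s \<longleftrightarrow> h q \<in> h ` ?leaf (radius p)" using s hq by auto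
      also have "\<dots> \<longleftrightarrow> q \<in> ?leaf (radius p)"
        by (rule inj_on_image_mem_iff[OF inj q]) auto
      finally show ?thesis using hp q by (metis (mono_tags, lifting) mem_Collect_eq)
    qed
    then show ?R by blast
  }
  assume R: ?R
  show "foliated torus_foliation h"
    unfolding foliated_def
  proof
    fix \<omega> assume "\<omega> \<in> torus_foliation"
    then obtain r where r: "r \<in> {0..1}" "\<omega> = ?leaf r" unfolding torus_foliation_leaves by blast
    \<comment> \<open>Every leaf has a point on this ray, so leaves are never empty, and h p
      determines the leaf that receives the image.\<close>
    define p where "p = (1::complex, complex_of_real r)"
    have p: "p \<in> solid_torus" "radius p = r" using r by (auto simp: p_def mem_solid_torus)
    have "h ` \<omega> = ?leaf (radius (h p))"
    proof
      show "h ` \<omega> \<subseteq> ?leaf (radius (h p))"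
      proof
        fix q assume "q \<in> h ` \<omega>"
        then obtain x where x: "x \<in> solid_torus" "radius x = r" "q = h x" using r(2) by blast
        have "h x \<in> solid_torus" using imageI[OF x(1), of h] im by simp
        then show "q \<in> ?leaf (radius (h p))"
          using bspec[OF bspec[OF R x(1)] p(1)] x p(2) by simp
      qed
      show "?leaf (radius (h p)) \<subseteq> h ` \<omega>"
      proof
        fix q assume q: "q \<in> ?leaf (radius (h p))"
        then have "q \<in> h ` solid_torus" unfolding im by simp
        then obtain x where x: "x \<in> solid_torus" "q = h x" by (rule imageE)
        have "radius q = radius (h p)" using q by simp
        then have "radius x = r" using bspec[OF bspec[OF R x(1)] p(1)] x(2) p(2) by metis
        then have "x \<in> \<omega>" using x(1) r(2) by blast
        then show "q \<in> h ` \<omega>" unfolding x(2) by (rule imageI)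
      qed
    qed
    moreover have "h p \<in> solid_torus" using im p by blast
    then have "radius (h p) \<in> {0..1}" by (simp add: mem_solid_torus)
    ultimately show "h ` \<omega> \<in> torus_foliation" unfolding torus_foliation_leaves by blast
  qed
qed

lemma leaf_preserving_torusI:
  assumes "bij_betw h solid_torus solid_torus" "\<And>p. p \<in> solid_torus \<Longrightarrow> radius (h p) = radius p"
  shows "leaf_preserving torus_foliation h"
  unfolding leaf_preserving_def torus_foliation_leaves
proof (intro ballI, clarify)
  fix r :: real
  have im: "h ` solid_torus = solid_torus" using assms by (auto simp: bij_betw_def)
  show "h ` {p \<in> solid_torus. radius p = r} = {p \<in> solid_torus. radius p = r}"
  proof
    show "h ` {p \<in> solid_torus. radius p = r} \<subseteq> {p \<in> solid_torus. radius p = r}"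
      using im assms(2) by auto
    show "{p \<in> solid_torus. radius p = r} \<subseteq> h ` {p \<in> solid_torus. radius p = r}"
    proof
      fix q assume q: "q \<in> {p \<in> solid_torus. radius p = r}"
      then obtain x where "x \<in> solid_torus" "q = h x" using im by blast
      then show "q \<in> h ` {p \<in> solid_torus. radius p = r}" using assms(2) q by auto
    qed
  qed
qed

lemma leaf_preserving_torusD:
  assumes "leaf_preserving torus_foliation h" "p \<in> solid_torus"
  shows "radius (h p) = radius p"
proof -
  have "radius p \<in> {0..1}" using assms(2) by (auto simp: mem_solid_torus)
  then have "{q \<in> solid_torus. radius q = radius p} \<in> torus_foliation"
    unfolding torus_foliation_leaves by (rule imageI)
  then have "h ` {q \<in> solid_torus. radius q = radius p} = {q \<in> solid_torus. radius q = radius p}"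
    by (rule bspec[OF assms(1)[unfolded leaf_preserving_def]])
  moreover have "h p \<in> h ` {q \<in> solid_torus. radius q = radius p}" using assms(2) by simp
  ultimately show ?thesis by simp
qed

section \<open>Inverses, the core circle and the boundary torus\<close>

text \<open>The restriction puts the inverse into the normal form of self-maps, with value
  \<open>undefined\<close> off M.\<close>

lemma diffeos_inverse:
  assumes "h \<in> diffeos M"
  shows "restrict (inv_into M h) M \<in> diffeos M"
proof -
  let ?k = "restrict (inv_into M h) M"
  have h: "bij_betw h M M" "smooth_map_on M h" "smooth_map_on M (inv_into M h)" "h \<in> M \<rightarrow>\<^sub>E M"
    using assms by (auto simp: diffeos_def smooth_self_maps_def)
  have bi: "bij_betw (inv_into M h) M M" using h(1) by (rule bij_betw_inv_into)
  have b: "bij_betw ?k M M" using bi by (simp cong: bij_betw_cong)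
  have s: "smooth_map_on M ?k" using h(3) by (subst smooth_map_on_cong[of M _ "inv_into M h"]) auto
  have "inv_into M ?k p = h p" if "p \<in> M" for p
  proof (rule inv_into_f_eq)
    show "inj_on ?k M" using b by (rule bij_betw_imp_inj_on)
    show "h p \<in> M" using h(4) that by auto
    then show "?k (h p) = p" using h(1) that by (simp add: bij_betw_inv_into_left)
  qed
  then have "smooth_map_on M (inv_into M ?k)" using h(2) smooth_map_on_cong[of M "inv_into M ?k" h] by simp
  moreover have "?k \<in> M \<rightarrow>\<^sub>E M" using bi by (auto dest: bij_betwE)
  ultimately show ?thesis using b s by (simp add: diffeos_def smooth_self_maps_def)
qed

lemma diffeosI:
  assumes "h \<in> M \<rightarrow>\<^sub>E M" "smooth_map_on M h" "k ` M \<subseteq> M" "smooth_map_on M k"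
    and "\<And>p. p \<in> M \<Longrightarrow> k (h p) = p" "\<And>p. p \<in> M \<Longrightarrow> h (k p) = p"
  shows "h \<in> diffeos M"
proof -
  have b: "bij_betw h M M"
    by (rule bij_betwI[of _ _ _ k]) (use assms in auto)
  then have "inv_into M h p = k p" if "p \<in> M" for p
    by (intro inv_into_f_eq) (use assms that in \<open>auto dest: bij_betw_imp_inj_on\<close>)
  then have "smooth_map_on M (inv_into M h)"
    using assms(4) smooth_map_on_cong[of M "inv_into M h" k] by simp
  then show ?thesis using b assms by (simp add: diffeos_def smooth_self_maps_def)
qed

lemma fol_diffeosD:
  assumes "h \<in> fol_diffeos solid_torus torus_foliation"
  shows "h \<in> solid_torus \<rightarrow>\<^sub>E solid_torus" "smooth_map_on solid_torus h"
    and "bij_betw h solid_torus solid_torus" "foliated torus_foliation h"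
    and "p \<in> solid_torus \<Longrightarrow> q \<in> solid_torus \<Longrightarrow> radius p = radius q \<longleftrightarrow> radius (h p) = radius (h q)"
    and "p \<in> solid_torus \<Longrightarrow> h p \<in> solid_torus"
proof -
  show h: "h \<in> solid_torus \<rightarrow>\<^sub>E solid_torus" "smooth_map_on solid_torus h"
    "bij_betw h solid_torus solid_torus" "foliated torus_foliation h"
    using assms by (auto simp: fol_diffeos_def diffeos_def smooth_self_maps_def)
  show "p \<in> solid_torus \<Longrightarrow> h p \<in> solid_torus" using h(1) by auto
  show "p \<in> solid_torus \<Longrightarrow> q \<in> solid_torus \<Longrightarrow> radius p = radius q \<longleftrightarrow> radius (h p) = radius (h q)"
    using h(4) unfolding foliated_torus_iff[OF h(3)] by blast
qed

lemma fol_diffeos_inverse: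
  assumes "h \<in> fol_diffeos solid_torus torus_foliation"
  obtains k where "k \<in> fol_diffeos solid_torus torus_foliation"
    "\<And>p. p \<in> solid_torus \<Longrightarrow> k (h p) = p" "\<And>p. p \<in> solid_torus \<Longrightarrow> h (k p) = p"
proof -
  let ?k = "restrict (inv_into solid_torus h) solid_torus"
  note h = fol_diffeosD[OF assms]
  have k: "?k \<in> diffeos solid_torus"
    using assms by (intro diffeos_inverse) (simp add: fol_diffeos_def)
  then have kb: "bij_betw ?k solid_torus solid_torus" and kM: "\<And>p. p \<in> solid_torus \<Longrightarrow> ?k p \<in> solid_torus"
    by (auto simp: diffeos_def dest: bij_betwE)
  have kh: "?k (h p) = p" if "p \<in> solid_torus" for p
    using h(3) h(6)[OF that] that by (simp add: bij_betw_inv_into_left)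
  have hk: "h (?k p) = p" if "p \<in> solid_torus" for p
    using h(3) that by (simp add: bij_betw_inv_into_right)
  have "foliated torus_foliation ?k"
    unfolding foliated_torus_iff[OF kb]
  proof (intro ballI)
    fix p q assume "p \<in> solid_torus" "q \<in> solid_torus"
    then show "radius p = radius q \<longleftrightarrow> radius (?k p) = radius (?k q)"
      using h(5)[OF kM[of p] kM[of q]] hk[of p] hk[of q] by simp
  qed
  then have "?k \<in> fol_diffeos solid_torus torus_foliation" using k by (simp add: fol_diffeos_def)
  then show ?thesis using kh hk by (rule that)
qed

lemma fol_diffeos_core:
  assumes h: "h \<in> fol_diffeos solid_torus torus_foliation" and p: "p \<in> solid_torus" "radius p = 0"
  shows "radius (h p) = 0"
proof (rule ccontr)
  assume ne: "radius (h p) \<noteq> 0"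
  define s where "s = radius (h p)"
  obtain k where k: "k \<in> fol_diffeos solid_torus torus_foliation"
    and kh: "\<And>p. p \<in> solid_torus \<Longrightarrow> k (h p) = p" and hk: "\<And>p. p \<in> solid_torus \<Longrightarrow> h (k p) = p"
    using fol_diffeos_inverse[OF h] by metis
  note H = fol_diffeosD[OF h] and K = fol_diffeosD[OF k]
  have s: "0 < s" "s \<le> 1"
    using ne H(6)[OF p(1)] by (auto simp: s_def mem_solid_torus order_less_le)
  define q where "q a b = (cis a, complex_of_real s * cis b)" for a b
  have q: "q a b \<in> solid_torus" "radius (q a b) = s" for a b
    using s by (auto simp: q_def mem_solid_torus norm_mult)
  have kq: "k (q a b) \<in> solid_torus" "radius (k (q a b)) = 0" for a b
    using K(6)[OF q(1)] H(5)[OF K(6)[OF q(1)] p(1)] hk[OF q(1)] q(2) p(2) s_def by auto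
  \<comment> \<open>The inverse k sends the torus of radius s to the core, so two angles would be
    embedded into a circle. Invariance of dimension compares open subsets of Euclidean spaces; the
    third coordinate, used as a modulus, turns this into an injective map from an open box of
    dimension 3 into the plane.\<close>
  define \<phi> where "\<phi> = (\<lambda>x :: real \<times> real \<times> real. of_real (snd (snd x)) * fst (k (q (fst x) (fst (snd x)))))"
  define S where "S = {0<..<1::real} \<times> {0<..<1::real} \<times> {0<..<1::real}"
  have "continuous_on UNIV (\<lambda>x :: real \<times> real \<times> real. q (fst x) (fst (snd x)))"
    unfolding q_def by (intro continuous_intros)
  then have kc: "continuous_on UNIV (\<lambda>x :: real \<times> real \<times> real. k (q (fst x) (fst (snd x))))"
    using continuous_on_compose2[OF smooth_map_on_continuous[OF K(2)]] q(1) by blast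
  have "continuous_on UNIV \<phi>"
    unfolding \<phi>_def by (intro continuous_intros kc)
  then have "continuous_on S \<phi>" by (rule continuous_on_subset) simp
  moreover have "open S" by (simp add: S_def open_Times)
  moreover have "inj_on \<phi> S"
  proof (rule inj_onI)
    fix x y assume xy: "x \<in> S" "y \<in> S" "\<phi> x = \<phi> y"
    obtain a b r a' b' r' where xe: "x = (a, b, r)" "y = (a', b', r')" by (cases x, cases y) auto
    have pos: "a \<in> {0<..<1}" "b \<in> {0<..<1}" "r > 0" "a' \<in> {0<..<1}" "b' \<in> {0<..<1}" "r' > 0"
      using xy xe by (auto simp: S_def)
    have n: "norm (fst (k (q a b))) = 1" "norm (fst (k (q a' b'))) = 1"
      using kq(1) by (auto simp: mem_solid_torus)
    have e: "of_real r * fst (k (q a b)) = of_real r' * fst (k (q a' b'))"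
      using xy(3) by (simp add: \<phi>_def xe)
    then have "norm (of_real r * fst (k (q a b))) = norm (of_real r' * fst (k (q a' b')))" by simp
    then have r: "r = r'" using n pos by (simp add: norm_mult)
    then have "fst (k (q a b)) = fst (k (q a' b'))" using e pos by simp
    moreover have "snd (k (q a b)) = 0" "snd (k (q a' b')) = 0"
      using kq(2) by (auto simp: radius_def)
    ultimately have "k (q a b) = k (q a' b')" by (simp add: prod_eq_iff)
    then have "q a b = q a' b'" using hk q(1) by metis
    then have c: "cis a = cis a'" "cis b = cis b'" using s by (auto simp: q_def)
    \<comment> \<open>Angles in (0, 1) lie within [-pi/2, pi/2], where the sine alone separates
      them.\<close>
    have ci: "u = v" if "cis u = cis v" "u \<in> {0<..<1}" "v \<in> {0<..<1}" for u v
    proof -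
      have "sin u = sin v" using that(1) by (metis cis.sel(2))
      moreover have "\<bar>u\<bar> \<le> pi / 2" "\<bar>v\<bar> \<le> pi / 2" using that pi_gt3 by auto
      ultimately show ?thesis using sin_inj_pi by (metis abs_le_D1 abs_le_D2 minus_divide_left minus_le_iff)
    qed
    show "x = y" using ci[OF c(1)] ci[OF c(2)] pos r xe by simp
  qed
  moreover have "(1/2, 1/2, 1/2) \<in> S" by (simp add: S_def)
  then have "S \<noteq> {}" by blast
  ultimately have "DIM(real \<times> real \<times> real) \<le> DIM(complex)" by (rule invariance_of_dimension)
  then show False by simp
qed

lemma fol_diffeos_radius_eq_0_iff:
  assumes h: "h \<in> fol_diffeos solid_torus torus_foliation" and p: "p \<in> solid_torus"
  shows "radius (h p) = 0 \<longleftrightarrow> radius p = 0"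
proof -
  have "(1, 0) \<in> solid_torus" by (simp add: mem_solid_torus)
  then show ?thesis
    using fol_diffeosD(5)[OF h p, of "(1, 0)"] fol_diffeos_core[OF h, of "(1, 0)"] by simp
qed

text \<open>The radius profile \<rho> along a ray is continuous and injective, has \<rho> 0 = 0, and
  takes the value 1 at some x by surjectivity. The intermediate value theorem yields y \<le> x with
  \<rho> y = \<rho> 1; injectivity gives y = 1, hence x = 1.\<close>

lemma fol_diffeos_boundary:
  assumes h: "h \<in> fol_diffeos solid_torus torus_foliation" and p: "p \<in> solid_torus" "radius p = 1"
  shows "radius (h p) = 1"
proof -
  obtain k where k: "k \<in> fol_diffeos solid_torus torus_foliation"
    and kh: "\<And>p. p \<in> solid_torus \<Longrightarrow> k (h p) = p" and hk: "\<And>p. p \<in> solid_torus \<Longrightarrow> h (k p) = p"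
    using fol_diffeos_inverse[OF h] by metis
  note H = fol_diffeosD[OF h] and K = fol_diffeosD[OF k]
  define e where "e x = (1::complex, complex_of_real x)" for x
  have e: "e x \<in> solid_torus" "radius (e x) = x" if "x \<in> {0..1}" for x
    using that by (auto simp: e_def mem_solid_torus)
  define \<rho> where "\<rho> x = radius (h (e x))" for x
  have "continuous_on {0..1} (\<lambda>x. h (e x))"
    by (rule continuous_on_compose2[OF smooth_map_on_continuous[OF H(2)]])
      (use e in \<open>auto simp: e_def intro!: continuous_intros\<close>)
  then have cont: "continuous_on {0..1} \<rho>"
    unfolding \<rho>_def radius_def by (intro continuous_intros)
  have inj: "x = y" if "\<rho> x = \<rho> y" "x \<in> {0..1}" "y \<in> {0..1}" for x y
    using that H(5)[OF e(1) e(1)] e(2) unfolding \<rho>_def by metis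
  have 0: "\<rho> 0 = 0" using fol_diffeos_core[OF h e(1), of 0] e(2) by (simp add: \<rho>_def)
  define q where "q = k (e 1)"
  have q: "q \<in> solid_torus" "h q = e 1" using K(6) hk e(1) by (auto simp: q_def)
  define x where "x = radius q"
  have x: "x \<in> {0..1}" using q by (auto simp: x_def mem_solid_torus)
  have x1: "\<rho> x = 1"
    using H(5)[OF q(1) e(1)[OF x]] e(2)[OF x] q(2) e(2)[of 1] by (simp add: \<rho>_def x_def)
  have "h (e 1) \<in> solid_torus" using H(6) e(1) by simp
  then have "\<rho> 1 \<le> 1" "0 \<le> \<rho> 1" by (auto simp: \<rho>_def mem_solid_torus)
  then obtain y where y: "0 \<le> y" "y \<le> x" "\<rho> y = \<rho> 1"
    using IVT'[of \<rho> 0 "\<rho> 1" x] 0 x1 x continuous_on_subset[OF cont, of "{0..x}"] by auto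
  then have "y = 1" using inj[of y 1] x by auto
  then have "\<rho> 1 = 1" using y x x1 by auto
  then show ?thesis
    using H(5)[OF p(1) e(1)[of 1]] e(2)[of 1] p(2) by (simp add: \<rho>_def)
qed

section \<open>The squared radius and its division by the square of the variable\<close>

lemma open_contains_symmetric_interval:
  assumes "open U" "{-1..1::real} \<subseteq> U" "1 < b"
  obtains a where "1 < a" "a \<le> b" "{-a<..<a} \<subseteq> U"
proof -
  have "1 \<in> U" "-1 \<in> U" using assms(2) by auto
  then obtain d e where d: "d > 0" "ball 1 d \<subseteq> U" and e: "e > 0" "ball (-1) e \<subseteq> U"
    using assms(1) unfolding open_contains_ball by metis
  define a where "a = min b (1 + min d e)"
  have "x \<in> U" if "x \<in> {-a<..<a}" for x
  proof -
    have "x \<in> {-1..1} \<or> x \<in> ball 1 d \<or> x \<in> ball (-1) e"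
      using that by (auto simp: a_def dist_real_def)
    then show ?thesis using d e assms(2) by blast
  qed
  then have "{-a<..<a} \<subseteq> U" by blast
  moreover have "1 < a" "a \<le> b" using d e assms(3) by (auto simp: a_def)
  ultimately show ?thesis using that by blast
qed

text \<open>For an even \<open>K\<close> with \<open>K 0 = 0\<close> this is \<open>K x / x\<^sup>2\<close>, including its smooth value at 0.\<close>

definition radial_quotient :: "(real \<Rightarrow> real) \<Rightarrow> real \<Rightarrow> real" where
  "radial_quotient K = dilation_integral 1 (divide_by_id (deriv K))"

text \<open>Hadamard division twice: K x is x times the integral of K'(u x), and K'(u x) = u x E(u
  x) with E = K'/x. The factor u is the weight of order 1 in the definition.\<close>

lemma radial_quotient:
  assumes "Cinf_on {-a<..<a} K" "\<And>x. x \<in> {-a<..<a} \<Longrightarrow> K (- x) = K x" "K 0 = 0"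
  shows "Cinf_on {-a<..<a} (radial_quotient K)"
    and "x \<in> {-a<..<a} \<Longrightarrow> radial_quotient K (- x) = radial_quotient K x"
    and "x \<in> {-a<..<a} \<Longrightarrow> K x = x\<^sup>2 * radial_quotient K x"
proof -
  note Ev = even_deriv_quotient[OF assms(1,2)]
  show "Cinf_on {-a<..<a} (radial_quotient K)"
    unfolding radial_quotient_def by (rule Cinf_on_dilation_integral[OF Ev(1)])
  show "radial_quotient K (- x) = radial_quotient K x" if x: "x \<in> {-a<..<a}"
    unfolding radial_quotient_def dilation_integral_def
  proof (rule integral_cong)
    fix u :: real assume "u \<in> {0..1}"
    then have "u * x \<in> {-a<..<a}" by (rule dilation_mem[OF x])
    from Ev(2)[OF _ this]
    show "u ^ 1 * divide_by_id (deriv K) (u * - x) = u ^ 1 * divide_by_id (deriv K) (u * x)" by simp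
  qed
  show "K x = x\<^sup>2 * radial_quotient K x" if x: "x \<in> {-a<..<a}"
  proof -
    have "K x = x * integral {0..1} (\<lambda>u. deriv K (u * x))"
      using divide_by_id[OF assms(1) x assms(3)] by (simp add: divide_by_id_def dilation_integral_def)
    also have "integral {0..1} (\<lambda>u. deriv K (u * x)) =
        integral {0..1} (\<lambda>u. x * (u ^ 1 * divide_by_id (deriv K) (u * x)))"
    proof (rule integral_cong)
      fix u :: real assume "u \<in> {0..1}"
      then have "u * x \<in> {-a<..<a}" by (rule dilation_mem[OF x])
      from Ev(3)[OF _ this]
      show "deriv K (u * x) = x * (u ^ 1 * divide_by_id (deriv K) (u * x))" by simp
    qed
    finally show ?thesis by (simp add: radial_quotient_def dilation_integral_def power2_eq_square)
  qed
qed

text \<open>Division by x^2 costs two derivatives: the m-th derivative of the quotient is a double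
  weighted integral of the derivative of K of order m + 2. Uniform convergence of the derivatives of
  K will pass to the quotient through this formula.\<close>

lemma funpow_deriv_radial_quotient:
  assumes "Cinf_on {-a<..<a} K" "x \<in> {-a<..<a}"
  shows "(deriv ^^ m) (radial_quotient K) x =
    dilation_integral (Suc m) (dilation_integral m ((deriv ^^ (m + 2)) K)) x"
proof -
  have D: "Cinf_on {-a<..<a} ((deriv ^^ n) K)" for n
    by (rule Cinf_on_funpow_deriv[OF open_greaterThanLessThan assms(1)])
  have D2: "Cinf_on {-a<..<a} (deriv (deriv K))" using D[of 2] by (simp add: numeral_2_eq_2)
  have L: "divide_by_id (deriv K) = dilation_integral 0 (deriv (deriv K))"
    by (simp add: divide_by_id_def)
  have "(deriv ^^ m) (radial_quotient K) x =
      dilation_integral (1 + m) ((deriv ^^ m) (divide_by_id (deriv K))) x"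
    unfolding radial_quotient_def L
    by (rule funpow_deriv_dilation_integral[OF Cinf_on_dilation_integral[OF D2] assms(2)])
  also have "\<dots> = dilation_integral (1 + m) (dilation_integral (0 + m) ((deriv ^^ m) (deriv (deriv K)))) x"
    unfolding dilation_integral_def[of "1 + m"]
  proof (rule integral_cong)
    fix u :: real assume "u \<in> {0..1}"
    then have "u * x \<in> {-a<..<a}" by (rule dilation_mem[OF assms(2)])
    from funpow_deriv_dilation_integral[OF D2 this, of m 0]
    show "u ^ (1 + m) * (deriv ^^ m) (divide_by_id (deriv K)) (u * x) =
        u ^ (1 + m) * dilation_integral (0 + m) ((deriv ^^ m) (deriv (deriv K))) (u * x)"
      unfolding L by simp
  qed
  also have "(deriv ^^ m) (deriv (deriv K)) = (deriv ^^ (m + 2)) K"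
    by (simp only: funpow_add o_def) (simp add: numeral_2_eq_2)
  finally show ?thesis by simp
qed

lemma solid_torus_axis: "x \<in> {-1..1} \<Longrightarrow> (1, complex_of_real x) \<in> solid_torus"
  by (simp add: mem_solid_torus abs_le_iff)

text \<open>The profile is read off on the diameter w = 1, z = x real. Squaring makes it smooth
  across the core, and it is even because (1, x) and (1, -x) lie on one leaf.\<close>

lemma fol_diffeos_radius_profile:
  assumes h: "h \<in> fol_diffeos solid_torus torus_foliation"
  obtains a K where "1 < a" "Cinf_on {-a<..<a} K" "\<And>x. K (- x) = K x" "K 0 = 0"
    and "\<And>p. p \<in> solid_torus \<Longrightarrow> K (radius p) = (radius (h p))\<^sup>2"
proof -
  note H = fol_diffeosD[OF h]
  define f where "f x = (radius (h (1, complex_of_real x)))\<^sup>2" for x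
  have f: "f (radius p) = (radius (h p))\<^sup>2" if p: "p \<in> solid_torus" for p
  proof -
    have "(1, complex_of_real (radius p)) \<in> solid_torus"
      using p by (intro solid_torus_axis) (auto simp: mem_solid_torus intro: order_trans[OF _ radius_nonneg])
    from H(5)[OF this p] show ?thesis by (simp add: f_def)
  qed
  have even: "f (- x) = f x" for x
  proof (cases "x \<in> {-1..1}")
    case True
    then show ?thesis
      using H(5)[of "(1, complex_of_real x)" "(1, complex_of_real (- x))"]
        solid_torus_axis[of x] solid_torus_axis[of "- x"] by (simp add: f_def)
  next
    \<comment> \<open>Outside the torus h is \<open>undefined\<close> at both points, which gives
      the evenness on the whole line that the extension asks for.\<close>
    case False
    then have "(1, complex_of_real x) \<notin> solid_torus" "(1, complex_of_real (- x)) \<notin> solid_torus"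
      by (auto simp: mem_solid_torus)
    then show ?thesis unfolding f_def using PiE_arb[OF H(1)] by metis
  qed
  have "smooth_map_on {-1..1} (\<lambda>x. (1::complex, complex_of_real x))"
    by (intro smooth_map_on_Pair smooth_map_on_const smooth_map_on_linear bounded_linear_of_real)
  then have "smooth_map_on {-1..1} (\<lambda>x. h (1, complex_of_real x))"
    by (rule smooth_map_on_compose[OF _ _ H(2)]) (use solid_torus_axis in auto)
  then have "smooth_map_on {-1..1} (\<lambda>x. snd (h (1, complex_of_real x)))"
    by (rule smooth_map_on_snd)
  then have "smooth_map_on {-1..1} (\<lambda>x. snd (h (1, complex_of_real x)) \<bullet> snd (h (1, complex_of_real x)))"
    by (intro smooth_map_on_inner)
  then have "smooth_map_on {-1..1} f"
    by (simp add: f_def[abs_def] radius_def power2_norm_eq_inner)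
  then obtain a K where K: "1 < a" "Cinf_on {-a<..<a} K" "\<And>x. K (- x) = K x"
    "\<And>x. x \<in> {-1..1} \<Longrightarrow> K x = f x"
    using even_smooth_extension[of f, OF _ even] by metis
  have "K (radius p) = (radius (h p))\<^sup>2" if "p \<in> solid_torus" for p
    using K(4)[of "radius p"] f[OF that] that radius_nonneg[of p] by (simp add: mem_solid_torus del: radius_nonneg)
  moreover have "K 0 = 0"
    using K(4)[of 0] fol_diffeos_core[OF h, of "(1, 0)"] by (simp add: f_def mem_solid_torus)
  ultimately show ?thesis using that[OF K(1-3)] by blast
qed

text \<open>For x different from 0 positivity says that only the core is mapped to the core. At 0 it
  is a statement about derivatives and comes from the inverse: the quotients Q_K of h and Q_L of k
  satisfy Q_K(\<rho> x) Q_L(x) = 1 on (0, 1), with \<rho> the radius profile of k, and this extends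
  to x = 0 by continuity.\<close>

lemma fol_diffeos_radial_quotient:
  assumes h: "h \<in> fol_diffeos solid_torus torus_foliation"
    and K: "1 < a" "Cinf_on {-a<..<a} K" "\<And>x. K (- x) = K x" "K 0 = 0"
    and KM: "\<And>p. p \<in> solid_torus \<Longrightarrow> K (radius p) = (radius (h p))\<^sup>2"
  shows "x \<in> {-1..1} \<Longrightarrow> radial_quotient K x > 0"
    and "radial_quotient K 1 = 1"
    and "p \<in> solid_torus \<Longrightarrow> radius (h p) = radius p * sqrt (radial_quotient K (radius p))"
proof -
  obtain k where k: "k \<in> fol_diffeos solid_torus torus_foliation"
    and kh: "\<And>p. p \<in> solid_torus \<Longrightarrow> k (h p) = p" and hk: "\<And>p. p \<in> solid_torus \<Longrightarrow> h (k p) = p"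
    using fol_diffeos_inverse[OF h] by metis
  obtain b L where L: "1 < b" "Cinf_on {-b<..<b} L" "\<And>x. L (- x) = L x" "L 0 = 0"
    and LM: "\<And>p. p \<in> solid_torus \<Longrightarrow> L (radius p) = (radius (k p))\<^sup>2"
    using fol_diffeos_radius_profile[OF k] by metis
  note H = fol_diffeosD[OF h] and k' = fol_diffeosD[OF k]
  note QK = radial_quotient[OF K(2) K(3) K(4)] and QL = radial_quotient[OF L(2) L(3) L(4)]
  have mem: "radius p \<in> {0..1}" if "p \<in> solid_torus" for p using that by (auto simp: mem_solid_torus)
  have memJ: "radius p \<in> {-c<..<c}" if "p \<in> solid_torus" "1 < c" for p c
    using that mem[OF that(1)] radius_nonneg[of p] by (simp del: radius_nonneg)
  have sq: "(radius (h p))\<^sup>2 = (radius p)\<^sup>2 * radial_quotient K (radius p)" if "p \<in> solid_torus" for p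
    using QK(3)[of "radius p"] KM[OF that] memJ[OF that K(1)] by simp
  have sqk: "(radius (k p))\<^sup>2 = (radius p)\<^sup>2 * radial_quotient L (radius p)" if "p \<in> solid_torus" for p
    using QL(3)[of "radius p"] LM[OF that] memJ[OF that L(1)] by simp
  have e: "(1, complex_of_real x) \<in> solid_torus" "radius (1, complex_of_real x) = x" if "x \<in> {0..1}" for x
    using that by (auto simp: mem_solid_torus)
  have pos: "radial_quotient K x > 0" if "x \<in> {0<..1}" for x
  proof -
    have x: "x \<in> {0..1}" using that by auto
    have "radius (h (1, complex_of_real x)) \<noteq> 0"
      using fol_diffeos_radius_eq_0_iff[OF h e(1)[OF x]] e(2)[OF x] that by simp
    then have "0 < (radius (h (1, complex_of_real x)))\<^sup>2" by simp
    then show ?thesis using sq[OF e(1)[OF x]] e(2)[OF x] that by (simp add: zero_less_mult_iff)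
  qed
  have "{0..1} \<subseteq> {-a<..<a}" "{0..1} \<subseteq> {-b<..<b}" using K(1) L(1) by auto
  then have cK: "continuous_on {0..1} (radial_quotient K)" and cL: "continuous_on {0..1} (radial_quotient L)"
    using continuous_on_subset[OF Cinf_on_continuous[OF QK(1)]]
      continuous_on_subset[OF Cinf_on_continuous[OF QL(1)]] by simp_all
  define \<rho> where "\<rho> x = radius (k (1, complex_of_real x))" for x
  have c\<rho>: "continuous_on {0..1} \<rho>"
  proof -
    have "continuous_on {0..1} (\<lambda>x. k (1, complex_of_real x))"
      by (rule continuous_on_compose2[OF smooth_map_on_continuous[OF k'(2)]])
        (use e in \<open>auto intro!: continuous_intros\<close>)
    then show ?thesis unfolding \<rho>_def radius_def by (intro continuous_intros)
  qed
  have \<rho>01: "\<rho> x \<in> {0..1}" if "x \<in> {0..1}" for x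
    using mem[OF k'(6)[OF e(1)[OF that]]] by (simp add: \<rho>_def)
  have "continuous_on {0..1} (\<lambda>x. radial_quotient K (\<rho> x))"
    by (rule continuous_on_compose2[OF cK c\<rho> image_subsetI[OF \<rho>01]])
  then have cont: "continuous_on (closure {0<..<1}) (\<lambda>x. radial_quotient K (\<rho> x) * radial_quotient L x)"
    using cL by (simp add: continuous_on_mult)
  have one: "radial_quotient K (\<rho> x) * radial_quotient L x = 1" if "x \<in> {0<..<1}" for x
  proof -
    have x: "x \<in> {0..1}" using that by auto
    have "x\<^sup>2 = (\<rho> x)\<^sup>2 * radial_quotient K (\<rho> x)"
      using sq[OF k'(6)[OF e(1)[OF x]]] hk[OF e(1)[OF x]] e(2)[OF x] by (simp add: \<rho>_def)
    also have "(\<rho> x)\<^sup>2 = x\<^sup>2 * radial_quotient L x"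
      using sqk[OF e(1)[OF x]] e(2)[OF x] by (simp add: \<rho>_def)
    finally have "x\<^sup>2 * (radial_quotient K (\<rho> x) * radial_quotient L x) = x\<^sup>2 * 1"
      by (simp add: mult_ac)
    then show ?thesis using that by (simp only: mult_cancel_left) auto
  qed
  have "radial_quotient K (\<rho> 0) * radial_quotient L 0 = 1"
    using continuous_constant_on_closure[OF cont one, of 0] by simp
  moreover have "\<rho> 0 = 0" using fol_diffeos_core[OF k e(1), of 0] by (simp add: \<rho>_def)
  ultimately have "radial_quotient K 0 \<noteq> 0" by auto
  moreover have "radial_quotient K 0 \<ge> 0"
    using continuous_ge_on_closure[of "{0<..<1}" "radial_quotient K" 0 0] cK pos
    by (auto intro: less_imp_le)
  ultimately have pos01: "radial_quotient K x > 0" if "x \<in> {0..1}" for x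
    using pos[of x] that by (cases "x = 0") auto
  then show "radial_quotient K x > 0" if "x \<in> {-1..1}"
    using pos01[of x] pos01[of "- x"] QK(2)[of x] that K(1) by (cases "x \<ge> 0") auto
  have "radius (h (1, 1)) = 1" using fol_diffeos_boundary[OF h, of "(1, 1)"] by (simp add: mem_solid_torus)
  then show "radial_quotient K 1 = 1" using sq[of "(1, 1)"] by (simp add: mem_solid_torus)
  show "radius (h p) = radius p * sqrt (radial_quotient K (radius p))" if p: "p \<in> solid_torus"
  proof -
    have "radius (h p) = sqrt ((radius (h p))\<^sup>2)" by simp
    also have "\<dots> = radius p * sqrt (radial_quotient K (radius p))"
      unfolding sq[OF p] by (simp add: real_sqrt_mult)
    finally show ?thesis .
  qed
qed

text \<open>Here m is the square root of the radial quotient; the interval is shrunk until the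
  quotient is positive on all of it and not merely on [-1, 1].\<close>

lemma fol_diffeos_radial_factor:
  assumes h: "h \<in> fol_diffeos solid_torus torus_foliation"
  obtains a m where "1 < a" "Cinf_on {-a<..<a} m" "\<And>x. x \<in> {-a<..<a} \<Longrightarrow> m (- x) = m x"
    and "\<And>x. x \<in> {-a<..<a} \<Longrightarrow> m x > 0" "m 1 = 1"
    and "\<And>p. p \<in> solid_torus \<Longrightarrow> radius (h p) = radius p * m (radius p)"
proof -
  obtain b K where K: "1 < b" "Cinf_on {-b<..<b} K" "\<And>x. K (- x) = K x" "K 0 = 0"
    and KM: "\<And>p. p \<in> solid_torus \<Longrightarrow> K (radius p) = (radius (h p))\<^sup>2"
    using fol_diffeos_radius_profile[OF h] by metis
  note Q = radial_quotient[OF K(2) K(3) K(4)]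
  note P = fol_diffeos_radial_quotient[OF h K KM]
  let ?U = "{-b<..<b} \<inter> radial_quotient K -` {0<..}"
  have "open ?U" by (rule continuous_open_preimage[OF Cinf_on_continuous[OF Q(1)]]) auto
  moreover have "{-1..1} \<subseteq> ?U" using P(1) K(1) by auto
  ultimately obtain a where a: "1 < a" "a \<le> b" "{-a<..<a} \<subseteq> ?U"
    using open_contains_symmetric_interval K(1) by metis
  have pos: "radial_quotient K x > 0" if "x \<in> {-a<..<a}" for x using a(3) that by auto
  have "{-a<..<a} \<subseteq> {-b<..<b}" using a(2) by auto
  from Cinf_on_subset[OF Q(1) this] have "smooth_map_on {-a<..<a} (radial_quotient K)"
    by (simp add: smooth_map_on_open)
  then have "smooth_map_on {-a<..<a} (\<lambda>x. sqrt (radial_quotient K x))"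
    using pos by (rule smooth_map_on_sqrt)
  then have "Cinf_on {-a<..<a} (\<lambda>x. sqrt (radial_quotient K x))" by (simp add: smooth_map_on_open)
  then show ?thesis
    using that[of a "\<lambda>x. sqrt (radial_quotient K x)"] a pos Q(2) P(2,3) by simp
qed

section \<open>Radial maps and the homotopy\<close>

definition radial_map :: "(real \<Rightarrow> real) \<Rightarrow> complex \<times> complex \<Rightarrow> complex \<times> complex" where
  "radial_map m p = (fst p, m (radius p) *\<^sub>R snd p)"

text \<open>The first factor is left general so that the same statement serves the torus and
  \<open>coord_domain\<close>.\<close>

lemma smooth_map_on_radial:
  fixes K :: "real \<Rightarrow> real"
  assumes "1 < a" "Cinf_on {-a<..<a} K" "\<And>x. x \<in> {-a<..<a} \<Longrightarrow> K (- x) = K x"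
    and "M \<subseteq> UNIV \<times> cball (0::'b::euclidean_space) 1"
  shows "smooth_map_on (M :: ('a::euclidean_space \<times> 'b) set) (\<lambda>p. K (norm (snd p)))"
proof -
  have s: "smooth_map_on (ball (0::'b) a) (\<lambda>z. K (norm z))"
    using Cinf_on_even_norm[OF assms(2,3)] by (simp add: smooth_map_on_open)
  have "snd ` M \<subseteq> ball 0 a" using assms(1,4) by (fastforce simp: subset_iff)
  then show ?thesis
    by (rule smooth_map_on_compose[OF smooth_map_on_linear[OF bounded_linear_snd] _ s])
qed

lemma smooth_radial_map:
  assumes "1 < a" "Cinf_on {-a<..<a} m" "\<And>x. x \<in> {-a<..<a} \<Longrightarrow> m (- x) = m x"
  shows "smooth_map_on solid_torus (radial_map m)"
proof -
  have "solid_torus \<subseteq> UNIV \<times> cball (0::complex) 1" by (auto simp: mem_solid_torus)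
  from smooth_map_on_radial[OF assms this] have "smooth_map_on solid_torus (\<lambda>p. m (radius p))"
    unfolding radius_def .
  then show ?thesis
    unfolding radial_map_def[abs_def]
    by (rule smooth_map_on_Pair[OF smooth_map_on_linear[OF bounded_linear_fst]
          smooth_map_on_scaleR[OF _ smooth_map_on_linear[OF bounded_linear_snd]]])
qed

lemma radius_radial_map: "0 \<le> m (radius p) \<Longrightarrow> radius (radial_map m p) = radius p * m (radius p)"
  by (simp add: radial_map_def radius_def)

text \<open>The inverse is radial too. If g inverts f x = x m(x), its factor is g(y) / y, taken in
  the form 1 / m(g y), which is smooth at y = 0 as well.\<close>

lemma radial_map_fol_diffeos:
  assumes "1 < a" "Cinf_on {-a<..<a} m" "\<And>x. x \<in> {-a<..<a} \<Longrightarrow> m (- x) = m x"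
    and "\<And>x. x \<in> {-a<..<a} \<Longrightarrow> m x > 0" "m 1 = 1"
    and "\<And>x. x \<in> {-a<..<a} \<Longrightarrow> deriv (\<lambda>x. x * m x) x > 0"
  shows "restrict (radial_map m) solid_torus \<in> fol_diffeos solid_torus torus_foliation"
proof -
  let ?J = "{-a<..<a}"
  define f where "f x = x * m x" for x
  have sm: "smooth_map_on ?J m" using assms(2) by (simp add: smooth_map_on_open)
  have Cf: "Cinf_on ?J f"
    using smooth_map_on_mult[OF smooth_map_on_id sm] by (simp add: smooth_map_on_open f_def[abs_def])
  have odd: "f (- x) = - f x" if "x \<in> ?J" for x using assms(3)[OF that] by (simp add: f_def)
  have f': "deriv f x > 0" if "x \<in> ?J" for x using assms(6)[OF that] by (simp add: f_def[abs_def])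
  have f1: "f 1 = 1" using assms(5) by (simp add: f_def)
  obtain b g where g: "1 < b" "Cinf_on {-b<..<b} g" "\<And>y. y \<in> {-b<..<b} \<Longrightarrow> g y \<in> ?J"
    "\<And>y. y \<in> {-b<..<b} \<Longrightarrow> f (g y) = y" "\<And>y. y \<in> {-b<..<b} \<Longrightarrow> g (- y) = - g y"
    "\<And>y. 0 \<le> y \<Longrightarrow> y \<le> 1 \<Longrightarrow> 0 \<le> g y \<and> g y \<le> 1" "\<And>x. x \<in> ?J \<Longrightarrow> g (f x) = x"
    using odd_diffeo_inverse[OF Cf odd f' assms(1) f1] by blast
  define \<kappa> where "\<kappa> y = inverse (m (g y))" for y
  have "smooth_map_on {-b<..<b} g" using g(2) by (simp add: smooth_map_on_open)
  then have "smooth_map_on {-b<..<b} (\<lambda>y. m (g y))"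
    by (rule smooth_map_on_compose[OF _ _ sm]) (use g(3) in blast)
  then have "smooth_map_on {-b<..<b} \<kappa>"
    unfolding \<kappa>_def[abs_def] by (rule smooth_map_on_inverse) (rule assms(4)[OF g(3)])
  then have C\<kappa>: "Cinf_on {-b<..<b} \<kappa>" by (simp add: smooth_map_on_open)
  have even\<kappa>: "\<kappa> (- y) = \<kappa> y" if "y \<in> {-b<..<b}" for y
    using g(5)[OF that] assms(3)[OF g(3)[OF that]] by (simp add: \<kappa>_def)
  let ?h = "restrict (radial_map m) solid_torus"
  have rJ: "radius p \<in> ?J" "radius p \<in> {-b<..<b}" if "p \<in> solid_torus" for p
    using that radius_nonneg[of p] assms(1) g(1) by (auto simp: mem_solid_torus simp del: radius_nonneg)
  have rh: "radius (radial_map m p) = f (radius p)" if "p \<in> solid_torus" for p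
    using radius_radial_map[of m p] assms(4)[OF rJ(1)[OF that]] by (simp add: f_def)
  \<comment> \<open>Monotonicity together with f 1 = 1 keeps the image inside the torus.\<close>
  have f_le: "f x \<le> 1" if "0 \<le> x" "x \<le> 1" for x
  proof -
    have "f x \<le> f 1"
    proof (rule DERIV_nonneg_imp_nondecreasing[OF that(2)])
      fix z assume "x \<le> z" "z \<le> 1"
      then have "z \<in> ?J" using that assms(1) by auto
      then show "\<exists>d. (f has_real_derivative d) (at z) \<and> 0 \<le> d"
        using Cinf_on_realD(1)[OF open_greaterThanLessThan Cf] f' by (meson less_imp_le)
    qed
    then show ?thesis using f1 by simp
  qed
  have hM: "radial_map m p \<in> solid_torus" if "p \<in> solid_torus" for p
    using that rh[OF that] f_le[of "radius p"] by (auto simp: mem_solid_torus radial_map_def)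
  have \<kappa>r: "radius (radial_map \<kappa> p) = g (radius p)" "m (g (radius p)) * \<kappa> (radius p) = 1"
    if p: "p \<in> solid_torus" for p
  proof -
    have pos: "m (g (radius p)) > 0" using assms(4)[OF g(3)[OF rJ(2)[OF p]]] .
    then show one: "m (g (radius p)) * \<kappa> (radius p) = 1" by (simp add: \<kappa>_def)
    have "radius p * \<kappa> (radius p) = g (radius p) * (m (g (radius p)) * \<kappa> (radius p))"
      using g(4)[OF rJ(2)[OF p]] by (simp add: f_def mult.assoc[symmetric])
    then have "radius p * \<kappa> (radius p) = g (radius p)" using one by simp
    then show "radius (radial_map \<kappa> p) = g (radius p)"
      using radius_radial_map[of \<kappa> p] pos by (simp add: \<kappa>_def)
  qed
  have kM: "radial_map \<kappa> p \<in> solid_torus" if "p \<in> solid_torus" for p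
    using that \<kappa>r(1)[OF that] g(6)[of "radius p"] by (auto simp: mem_solid_torus radial_map_def)
  have d: "?h \<in> diffeos solid_torus"
  proof (rule diffeosI[where k = "radial_map \<kappa>"])
    show "?h \<in> solid_torus \<rightarrow>\<^sub>E solid_torus" using hM by auto
    show "smooth_map_on solid_torus ?h"
      using smooth_radial_map[OF assms(1-3)] smooth_map_on_cong[of solid_torus ?h "radial_map m"] by simp
    show "radial_map \<kappa> ` solid_torus \<subseteq> solid_torus" using kM by blast
    show "smooth_map_on solid_torus (radial_map \<kappa>)" by (rule smooth_radial_map[OF g(1) C\<kappa> even\<kappa>])
    fix p assume p: "p \<in> solid_torus"
    have "\<kappa> (radius (radial_map m p)) * m (radius p) = 1"
      using rh[OF p] g(7)[OF rJ(1)[OF p]] assms(4)[OF rJ(1)[OF p]] by (simp add: \<kappa>_def)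
    then show "radial_map \<kappa> (?h p) = p"
      using p by (simp add: radial_map_def[of \<kappa>]) (simp add: radial_map_def prod_eq_iff)
    have "m (radius (radial_map \<kappa> p)) * \<kappa> (radius p) = 1" using \<kappa>r[OF p] by simp
    then show "?h (radial_map \<kappa> p) = p"
      using kM[OF p] by (simp add: radial_map_def[of m]) (simp add: radial_map_def prod_eq_iff)
  qed
  then have bij: "bij_betw ?h solid_torus solid_torus" by (simp add: diffeos_def)
  have "foliated torus_foliation ?h"
    unfolding foliated_torus_iff[OF bij]
  proof (intro ballI)
    fix p q assume pq: "p \<in> solid_torus" "q \<in> solid_torus"
    have "radius (?h p) = f (radius p)" "radius (?h q) = f (radius q)"
      using rh pq by simp_all
    then show "radius p = radius q \<longleftrightarrow> radius (?h p) = radius (?h q)"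
      using g(7)[OF rJ(1)[OF pq(1)]] g(7)[OF rJ(1)[OF pq(2)]] by metis
  qed
  then show ?thesis using d by (simp add: fol_diffeos_def)
qed

lemma fol_diffeos_compose:
  assumes "g \<in> fol_diffeos solid_torus torus_foliation" "h \<in> fol_diffeos solid_torus torus_foliation"
  shows "restrict (\<lambda>p. g (h p)) solid_torus \<in> fol_diffeos solid_torus torus_foliation"
proof -
  let ?c = "restrict (\<lambda>p. g (h p)) solid_torus"
  note G = fol_diffeosD[OF assms(1)] and H = fol_diffeosD[OF assms(2)]
  obtain g' where g': "g' \<in> fol_diffeos solid_torus torus_foliation"
    "\<And>p. p \<in> solid_torus \<Longrightarrow> g' (g p) = p" "\<And>p. p \<in> solid_torus \<Longrightarrow> g (g' p) = p"
    using fol_diffeos_inverse[OF assms(1)] by metis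
  obtain h' where h': "h' \<in> fol_diffeos solid_torus torus_foliation"
    "\<And>p. p \<in> solid_torus \<Longrightarrow> h' (h p) = p" "\<And>p. p \<in> solid_torus \<Longrightarrow> h (h' p) = p"
    using fol_diffeos_inverse[OF assms(2)] by metis
  note G' = fol_diffeosD[OF g'(1)] and H' = fol_diffeosD[OF h'(1)]
  have d: "?c \<in> diffeos solid_torus"
  proof (rule diffeosI[where k = "\<lambda>p. h' (g' p)"])
    show "?c \<in> solid_torus \<rightarrow>\<^sub>E solid_torus" using G(6) H(6) by simp
    have "smooth_map_on solid_torus (\<lambda>p. g (h p))"
      by (rule smooth_map_on_compose[OF H(2) _ G(2)]) (use H(6) in blast)
    then show "smooth_map_on solid_torus ?c"
      using smooth_map_on_cong[of solid_torus ?c "\<lambda>p. g (h p)"] by simp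
    show "smooth_map_on solid_torus (\<lambda>p. h' (g' p))"
      by (rule smooth_map_on_compose[OF G'(2) _ H'(2)]) (use G'(6) in blast)
    show "(\<lambda>p. h' (g' p)) ` solid_torus \<subseteq> solid_torus" using G'(6) H'(6) by blast
    show "h' (g' (?c p)) = p" "?c (h' (g' p)) = p" if "p \<in> solid_torus" for p
      using that g'(2)[OF H(6)[OF that]] h'(2)[OF that] h'(3)[OF G'(6)[OF that]] g'(3)[OF that]
        H'(6)[OF G'(6)[OF that]] by simp_all
  qed
  then have bij: "bij_betw ?c solid_torus solid_torus" by (simp add: diffeos_def)
  have "foliated torus_foliation ?c"
    unfolding foliated_torus_iff[OF bij]
  proof (intro ballI)
    fix p q assume pq: "p \<in> solid_torus" "q \<in> solid_torus"
    then show "radius p = radius q \<longleftrightarrow> radius (?c p) = radius (?c q)"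
      using H(5)[OF pq] G(5)[OF H(6)[OF pq(1)] H(6)[OF pq(2)]] by simp
  qed
  then show ?thesis using d by (simp add: fol_diffeos_def)
qed

lemma deriv_odd:
  fixes f :: "real \<Rightarrow> real"
  assumes "Cinf_on {-a<..<a} f" "\<And>x. x \<in> {-a<..<a} \<Longrightarrow> f (- x) = - f x" "x \<in> {-a<..<a}"
  shows "deriv f (- x) = deriv f x"
proof -
  have "(f has_real_derivative deriv f (- x)) (at (- x))"
    using Cinf_on_realD(1)[OF _ assms(1)] assms(3) by auto
  then have "((\<lambda>x. f (- x)) has_real_derivative deriv f (- x) * (- 1)) (at x)"
    by (rule DERIV_chain2) (auto intro!: derivative_eq_intros)
  then have "((\<lambda>x. - f (- x)) has_real_derivative - (deriv f (- x) * (- 1))) (at x)"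
    by (rule DERIV_minus)
  then have "(f has_real_derivative - (deriv f (- x) * (- 1))) (at x)"
    using assms by (elim has_field_derivative_transform_within_open[where S = "{-a<..<a}"]) auto
  then have "deriv f x = - (deriv f (- x) * (- 1))" by (rule DERIV_imp_deriv)
  then show ?thesis by simp
qed

text \<open>With g the radius function of the inverse, g (f x) = x gives g'(f x) f'(x) = 1 on (0,
  1), and on [0, 1] by continuity. So f' has no zero there, and its sign is that of f'(0) = m 0 > 0.
  Oddness of f covers the negative half.\<close>

lemma fol_diffeos_radius_deriv_pos:
  assumes h: "h \<in> fol_diffeos solid_torus torus_foliation"
    and m: "1 < a" "Cinf_on {-a<..<a} m" "\<And>x. x \<in> {-a<..<a} \<Longrightarrow> m (- x) = m x"
      "\<And>x. x \<in> {-a<..<a} \<Longrightarrow> m x > 0"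
      "\<And>p. p \<in> solid_torus \<Longrightarrow> radius (h p) = radius p * m (radius p)"
    and x: "x \<in> {-1..1}"
  shows "deriv (\<lambda>x. x * m x) x > 0"
proof -
  obtain k where k: "k \<in> fol_diffeos solid_torus torus_foliation"
    and kh: "\<And>p. p \<in> solid_torus \<Longrightarrow> k (h p) = p"
    using fol_diffeos_inverse[OF h] by metis
  obtain b n where n: "1 < b" "Cinf_on {-b<..<b} n"
      "\<And>p. p \<in> solid_torus \<Longrightarrow> radius (k p) = radius p * n (radius p)"
    using fol_diffeos_radial_factor[OF k] by metis
  define f where "f x = x * m x" for x
  define g where "g x = x * n x" for x
  have "smooth_map_on {-a<..<a} m" "smooth_map_on {-b<..<b} n" using m(2) n(2) by (simp_all add: smooth_map_on_open)
  then have Cf: "Cinf_on {-a<..<a} f" and Cg: "Cinf_on {-b<..<b} g"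
    using smooth_map_on_mult[OF smooth_map_on_id, of "{-a<..<a}" m] smooth_map_on_mult[OF smooth_map_on_id, of "{-b<..<b}" n]
    by (simp_all add: smooth_map_on_open f_def[abs_def] g_def[abs_def])
  note f' = Cinf_on_realD[OF open_greaterThanLessThan Cf] and g' = Cinf_on_realD[OF open_greaterThanLessThan Cg]
  have e: "(1, complex_of_real x) \<in> solid_torus" "radius (1, complex_of_real x) = x" if "x \<in> {0..1}" for x
    using that by (auto simp: mem_solid_torus)
  have f01: "f x \<in> {0..1}" and gf: "g (f x) = x" if "x \<in> {0..1}" for x
  proof -
    have *: "radius (h (1, complex_of_real x)) = f x" using m(5)[OF e(1)[OF that]] e(2)[OF that] by (simp add: f_def)
    have hM: "h (1, complex_of_real x) \<in> solid_torus" using fol_diffeosD(6)[OF h e(1)[OF that]] .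
    then show "f x \<in> {0..1}" using * radius_nonneg[of "h (1, complex_of_real x)"] by (simp add: mem_solid_torus del: radius_nonneg)
    show "g (f x) = x" using n(3)[OF hM] kh[OF e(1)[OF that]] e(2)[OF that] * by (simp add: g_def)
  qed
  have fJ: "x \<in> {-a<..<a}" "f x \<in> {-b<..<b}" if "x \<in> {0..1}" for x
    using f01[OF that] that m(1) n(1) by auto
  have one: "deriv g (f x) * deriv f x = 1" if x: "x \<in> {0<..<1}" for x
  proof -
    have x': "x \<in> {0..1}" using x by auto
    have "((\<lambda>x. g (f x)) has_real_derivative deriv g (f x) * deriv f x) (at x)"
      by (rule DERIV_chain2[OF g'(1)[OF fJ(2)[OF x']] f'(1)[OF fJ(1)[OF x']]])
    then have "((\<lambda>x. x) has_real_derivative deriv g (f x) * deriv f x) (at x)"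
      by (rule has_field_derivative_transform_within_open[where S = "{0<..<1}"]) (use x gf in auto)
    then show ?thesis using DERIV_ident DERIV_unique by metis
  qed
  have cf': "continuous_on {0..1} (deriv f)"
    by (rule continuous_on_subset[OF Cinf_on_continuous[OF f'(2)]]) (use fJ in blast)
  have cf: "continuous_on {0..1} f"
    by (rule continuous_on_subset[OF Cinf_on_continuous[OF Cf]]) (use fJ in blast)
  have "continuous_on {0..1} (\<lambda>x. deriv g (f x))"
    by (rule continuous_on_compose2[OF Cinf_on_continuous[OF g'(2)] cf]) (use fJ in blast)
  then have cont: "continuous_on (closure {0<..<1}) (\<lambda>x. deriv g (f x) * deriv f x)"
    using cf' by (simp add: continuous_on_mult)
  have ne: "deriv f x \<noteq> 0" if "x \<in> {0..1}" for x
    using continuous_constant_on_closure[OF cont one, of x] that by auto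
  have "(f has_real_derivative m 0) (at 0)"
  proof -
    have "(m has_real_derivative deriv m 0) (at 0)"
      using Cinf_on_realD(1)[OF open_greaterThanLessThan m(2)] m(1) by auto
    from DERIV_mult[OF DERIV_ident this] show ?thesis by (simp add: f_def[abs_def])
  qed
  then have f0: "deriv f 0 > 0" using m(4)[of 0] m(1) by (simp add: DERIV_imp_deriv)
  have pos: "deriv f x > 0" if x: "x \<in> {0..1}" for x
  proof (rule ccontr)
    assume "\<not> deriv f x > 0"
    then obtain y where "0 \<le> y" "y \<le> x" "deriv f y = 0"
      using IVT2'[of "deriv f" x 0 0] f0 x continuous_on_subset[OF cf', of "{0..x}"] by auto
    then show False using ne[of y] x by auto
  qed
  have odd: "f (- x) = - f x" if "x \<in> {-a<..<a}" for x using m(3)[OF that] by (simp add: f_def)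
  have "deriv f x > 0"
  proof (cases "x \<ge> 0")
    case True
    then show ?thesis using pos x by simp
  next
    case False
    have "x \<in> {-a<..<a}" using x m(1) by auto
    from deriv_odd[OF Cf odd this] show ?thesis using pos[of "- x"] False x by simp
  qed
  then show ?thesis by (simp add: f_def[abs_def])
qed

section \<open>The homotopy through foliated diffeomorphisms\<close>

text \<open>On the core a foliated diffeomorphism makes the quotient of radii 0/0, which evaluates
  to 0. The factor multiplies \<open>snd (h p) = 0\<close> there, so the value is the right
  one.\<close>

definition radius_homotopy :: "real \<Rightarrow> (complex \<times> complex \<Rightarrow> complex \<times> complex) \<Rightarrow> complex \<times> complex \<Rightarrow> complex \<times> complex" where
  "radius_homotopy t h = restrict (\<lambda>p. (fst (h p), (1 - t + t * (radius p / radius (h p))) *\<^sub>R snd (h p))) solid_torus"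

text \<open>Since |z| = |h_2| m(|h_2|) with m the radial factor of the inverse of h, the radial map
  to be applied after h has factor l = (1 - t) + t m. Its radius function x l(x) is a convex
  combination of x and x m(x), and so inherits a positive derivative.\<close>

lemma radius_homotopy_fol_diffeos:
  assumes h: "h \<in> fol_diffeos solid_torus torus_foliation" and t: "t \<in> {0..1}"
  shows "radius_homotopy t h \<in> fol_diffeos solid_torus torus_foliation"
    and "p \<in> solid_torus \<Longrightarrow> radius (radius_homotopy t h p) = (1 - t) * radius (h p) + t * radius p"
proof -
  obtain k where k: "k \<in> fol_diffeos solid_torus torus_foliation"
    and kh: "\<And>p. p \<in> solid_torus \<Longrightarrow> k (h p) = p"
    using fol_diffeos_inverse[OF h] by metis
  obtain b m where m: "1 < b" "Cinf_on {-b<..<b} m" "\<And>x. x \<in> {-b<..<b} \<Longrightarrow> m (- x) = m x"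
    "\<And>x. x \<in> {-b<..<b} \<Longrightarrow> m x > 0" "m 1 = 1"
    and mr: "\<And>p. p \<in> solid_torus \<Longrightarrow> radius (k p) = radius p * m (radius p)"
    using fol_diffeos_radial_factor[OF k] by metis
  define l where "l x = (1 - t) + t * m x" for x
  define f where "f x = x * m x" for x
  have sm: "smooth_map_on {-b<..<b} m" using m(2) by (simp add: smooth_map_on_open)
  have sl: "smooth_map_on {-b<..<b} l"
    unfolding l_def[abs_def] by (intro smooth_map_on_add smooth_map_on_const smooth_map_on_mult sm)
  have sf: "smooth_map_on {-b<..<b} f"
    unfolding f_def[abs_def] by (intro smooth_map_on_mult sm smooth_map_on_id)
  have Cf: "Cinf_on {-b<..<b} f" using sf by (simp add: smooth_map_on_open)
  have dl: "deriv (\<lambda>x. x * l x) x = (1 - t) + t * deriv f x" if "x \<in> {-b<..<b}" for x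
  proof -
    have "(f has_real_derivative deriv f x) (at x)"
      by (rule Cinf_on_realD(1)[OF open_greaterThanLessThan Cf that])
    then have "((\<lambda>x. (1 - t) * x + t * f x) has_real_derivative (1 - t) * 1 + t * deriv f x) (at x)"
      by (intro DERIV_add DERIV_cmult DERIV_ident)
    moreover have "(\<lambda>x. (1 - t) * x + t * f x) = (\<lambda>x. x * l x)"
      by (auto simp: f_def l_def algebra_simps)
    ultimately show ?thesis by (simp add: DERIV_imp_deriv)
  qed
  have lin: "0 < (1 - t) + t * c" if "c > 0" for c
  proof (cases "t = 0")
    case False
    then have "0 < t * c" using t that by simp
    then show ?thesis using t by simp
  qed simp
  \<comment> \<open>The derivative of f is known to be positive on [-1, 1] only; openness enlarges
    this to a longer symmetric interval.\<close>
  let ?U = "{-b<..<b} \<inter> deriv f -` {0<..}"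
  have "open ?U"
    by (rule continuous_open_preimage[OF Cinf_on_continuous[OF Cinf_on_realD(2)[OF _ Cf]]]) auto
  moreover have "{-1..1} \<subseteq> ?U"
    using fol_diffeos_radius_deriv_pos[OF k m(1-4) mr] m(1) by (auto simp: f_def[abs_def])
  ultimately obtain a where a: "1 < a" "a \<le> b" "{-a<..<a} \<subseteq> ?U"
    using open_contains_symmetric_interval m(1) by metis
  have ab: "x \<in> {-b<..<b}" if "x \<in> {-a<..<a}" for x using a(3) that by blast
  have "smooth_map_on {-a<..<a} l" by (rule smooth_map_on_subset[OF sl]) (use ab in blast)
  then have Cl: "Cinf_on {-a<..<a} l" by (simp add: smooth_map_on_open)
  have lpos: "l x > 0" if "x \<in> {-a<..<a}" for x using lin[OF m(4)[OF ab[OF that]]] by (simp add: l_def)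
  have R: "restrict (radial_map l) solid_torus \<in> fol_diffeos solid_torus torus_foliation"
  proof (rule radial_map_fol_diffeos[OF a(1) Cl])
    show "l (- x) = l x" if "x \<in> {-a<..<a}" for x using m(3)[OF ab[OF that]] by (simp add: l_def)
    show "l x > 0" if "x \<in> {-a<..<a}" for x using lpos[OF that] .
    show "l 1 = 1" by (simp add: l_def m(5))
    show "deriv (\<lambda>x. x * l x) x > 0" if "x \<in> {-a<..<a}" for x
    proof -
      have "deriv f x > 0" using a(3) that by auto
      then show ?thesis using lin dl[OF ab[OF that]] by simp
    qed
  qed
  have hM: "h p \<in> solid_torus" if "p \<in> solid_torus" for p using fol_diffeosD(6)[OF h that] .
  have rk: "radius p = radius (h p) * m (radius (h p))" if "p \<in> solid_torus" for p
    using mr[OF hM[OF that]] kh[OF that] by simp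
  have eq: "radius_homotopy t h p = radial_map l (h p)" if p: "p \<in> solid_torus" for p
  proof (cases "radius (h p) = 0")
    \<comment> \<open>Here \<open>snd (h p)\<close> is 0, so both sides agree whatever the two
      factors are.\<close>
    case True
    then show ?thesis using p by (simp add: radius_homotopy_def radial_map_def radius_def)
  next
    case False
    then have "radius p / radius (h p) = m (radius (h p))" using rk[OF p] by (simp add: field_simps)
    then show ?thesis using p
      by (simp only: radius_homotopy_def radial_map_def l_def restrict_apply if_True)
  qed
  have "radius_homotopy t h = restrict (\<lambda>p. restrict (radial_map l) solid_torus (h p)) solid_torus"
  proof
    fix p
    show "radius_homotopy t h p = restrict (\<lambda>p. restrict (radial_map l) solid_torus (h p)) solid_torus p"
      using eq[of p] hM[of p] by (cases "p \<in> solid_torus") (simp_all add: radius_homotopy_def)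
  qed
  then show "radius_homotopy t h \<in> fol_diffeos solid_torus torus_foliation"
    using fol_diffeos_compose[OF R h] by simp
  show "radius (radius_homotopy t h p) = (1 - t) * radius (h p) + t * radius p" if p: "p \<in> solid_torus"
  proof -
    have "radius (h p) \<in> {-a<..<a}"
      using hM[OF p] radius_nonneg[of "h p"] a(1) by (simp add: mem_solid_torus del: radius_nonneg)
    then have "radius (radial_map l (h p)) = radius (h p) * l (radius (h p))"
      using lpos by (intro radius_radial_map less_imp_le)
    then show ?thesis using eq[OF p] rk[OF p] by (simp add: l_def algebra_simps)
  qed
qed

section \<open>Convergence in the Whitney topology\<close>

lemma convex_coord_domain: "convex coord_domain"
  by (simp add: coord_domain_def convex_Times)

lemma interior_coord_domain: "interior coord_domain \<noteq> {}"
  by (simp add: coord_domain_def interior_Times)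

abbreviation pd :: "real \<times> complex \<Rightarrow> (real \<times> complex \<Rightarrow> 'b::real_normed_vector) \<Rightarrow> real \<times> complex \<Rightarrow> 'b" where
  "pd b u \<equiv> (\<lambda>p. frechet_derivative u (at p within coord_domain) b)"

lemma pd_eq:
  assumes "p \<in> coord_domain" "(u has_derivative D) (at p within coord_domain)"
  shows "pd b u p = D b"
  using frechet_derivative_within_eq[OF convex_coord_domain interior_coord_domain assms] by simp

text \<open>The domain is unbounded in the angle. Periodicity is carried along because it restores
  boundedness, and every partial derivative inherits it.\<close>

definition coord_smooth :: "(real \<times> complex \<Rightarrow> 'b::euclidean_space) \<Rightarrow> bool" where
  "coord_smooth u \<longleftrightarrow> smooth_map_on coord_domain u \<and>
    (\<forall>p\<in>coord_domain. u (p + (2 * pi, 0)) = u p)"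

lemma coord_smooth_has_derivative:
  "coord_smooth u \<Longrightarrow> p \<in> coord_domain \<Longrightarrow>
    (u has_derivative frechet_derivative u (at p within coord_domain)) (at p within coord_domain)"
  unfolding coord_smooth_def
  using smooth_map_on_derivative(1)[OF convex_coord_domain interior_coord_domain] by blast

lemma coord_domain_shift: "p \<in> coord_domain \<Longrightarrow> p + (c, 0) \<in> coord_domain"
  by (cases p) (simp add: coord_domain_def)

text \<open>Translation by the period maps the domain into itself and has the identity as
  derivative, so the chain rule carries periodicity over to the derivative.\<close>

lemma coord_smooth_pd:
  assumes "coord_smooth u" shows "coord_smooth (pd b u)"
  unfolding coord_smooth_def
proof (intro conjI ballI)
  let ?D = coord_domain and ?s = "\<lambda>p::real \<times> complex. p + (2 * pi, 0)"
  show "smooth_map_on ?D (pd b u)"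
    by (rule smooth_map_on_derivative(2)[OF convex_coord_domain interior_coord_domain
          conjunct1[OF assms[unfolded coord_smooth_def]]])
  fix p :: "real \<times> complex" assume p: "p \<in> ?D"
  have "(u has_derivative frechet_derivative u (at (?s p) within ?D)) (at (?s p) within ?D)"
    using coord_smooth_has_derivative[OF assms coord_domain_shift[OF p]] .
  then have "(u has_derivative frechet_derivative u (at (?s p) within ?D)) (at (?s p) within ?s ` ?D)"
    by (rule has_derivative_subset) (rule image_subsetI, rule coord_domain_shift)
  moreover have "(?s has_derivative (\<lambda>v. v)) (at p within ?D)"
    by (auto intro!: derivative_eq_intros)
  ultimately have "((\<lambda>p. u (?s p)) has_derivative frechet_derivative u (at (?s p) within ?D)) (at p within ?D)"
    by (rule has_derivative_in_compose[rotated])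
  then have "(u has_derivative frechet_derivative u (at (?s p) within ?D)) (at p within ?D)"
    using has_derivative_within_cong[OF p, of "\<lambda>p. u (?s p)" u] assms by (simp add: coord_smooth_def)
  from pd_eq[OF p this] show "pd b u (?s p) = pd b u p" by simp
qed

lemma coord_smooth_bounded:
  assumes "coord_smooth u" shows "bounded (u ` coord_domain)"
proof -
  let ?K = "{0..2 * pi} \<times> cball (0::complex) 1"
  have nat: "u (\<theta> + 2 * pi * real n, z) = u (\<theta>, z)" if "z \<in> cball 0 1" for \<theta> z n
  proof (induction n)
    case (Suc n)
    have "(\<theta> + 2 * pi * real n, z) \<in> coord_domain" using that by (simp add: coord_domain_def)
    then have "u ((\<theta> + 2 * pi * real n, z) + (2 * pi, 0)) = u (\<theta> + 2 * pi * real n, z)"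
      using assms unfolding coord_smooth_def by blast
    then show ?case using Suc.IH by (simp add: algebra_simps)
  qed simp
  have "u ` coord_domain \<subseteq> u ` ?K"
  proof
    fix y assume "y \<in> u ` coord_domain"
    then obtain \<theta> z where y: "y = u (\<theta>, z)" "z \<in> cball 0 1" by (auto simp: coord_domain_def)
    \<comment> \<open>The number of full turns. Periodicity has been iterated over the naturals
      only, so for negative k the roles of \<theta> and \<theta>' are exchanged.\<close>
    define k where "k = \<lfloor>\<theta> / (2 * pi)\<rfloor>"
    define \<theta>' where "\<theta>' = \<theta> - 2 * pi * of_int k"
    have "of_int k \<le> \<theta> / (2 * pi)" "\<theta> / (2 * pi) < of_int k + 1" unfolding k_def by linarith+
    then have "\<theta>' \<in> {0..2 * pi}" by (auto simp: \<theta>'_def field_simps)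
    moreover have "u (\<theta>', z) = u (\<theta>, z)"
    proof (cases "k \<ge> 0")
      case True
      then have "\<theta> = \<theta>' + 2 * pi * real (nat k)" by (simp add: \<theta>'_def)
      then show ?thesis using nat[OF y(2), of \<theta>' "nat k"] by simp
    next
      case False
      then have "\<theta>' = \<theta> + 2 * pi * real (nat (- k))" by (simp add: \<theta>'_def)
      then show ?thesis using nat[OF y(2), of \<theta> "nat (- k)"] by simp
    qed
    ultimately show "y \<in> u ` ?K" using y image_eqI[of y u "(\<theta>', z)" ?K] by simp
  qed
  moreover have "bounded (u ` ?K)"
  proof -
    have "continuous_on coord_domain u"
      using assms by (simp add: coord_smooth_def smooth_map_on_continuous)
    then have "continuous_on ?K u" by (rule continuous_on_subset) (auto simp: coord_domain_def)
    then show ?thesis by (intro compact_imp_bounded compact_continuous_image compact_Times) auto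
  qed
  ultimately show ?thesis using bounded_subset by blast
qed

lemma coord_smooth_bilinear:
  "bounded_bilinear B \<Longrightarrow> coord_smooth u \<Longrightarrow> coord_smooth v \<Longrightarrow> coord_smooth (\<lambda>p. B (u p) (v p))"
  unfolding coord_smooth_def using smooth_map_on_bilinear[of B coord_domain u v] by simp

lemma coord_smooth_linear_compose:
  "bounded_linear L \<Longrightarrow> coord_smooth u \<Longrightarrow> coord_smooth (\<lambda>p. L (u p))"
  unfolding coord_smooth_def using smooth_map_on_linear_compose[of L coord_domain u] by simp

lemma coord_smooth_add: "coord_smooth u \<Longrightarrow> coord_smooth v \<Longrightarrow> coord_smooth (\<lambda>p. u p + v p)"
  unfolding coord_smooth_def using smooth_map_on_add[of coord_domain u v] by simp

lemma coord_smooth_const: "coord_smooth (\<lambda>p. c)"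
  unfolding coord_smooth_def using smooth_map_on_const by simp

lemma coord_smooth_powr:
  fixes u :: "real \<times> complex \<Rightarrow> real"
  shows "coord_smooth u \<Longrightarrow> (\<And>p. p \<in> coord_domain \<Longrightarrow> u p > 0) \<Longrightarrow> coord_smooth (\<lambda>p. u p powr m)"
  unfolding coord_smooth_def using smooth_map_on_powr[of coord_domain u m] by simp

lemma coord_smooth_radial:
  fixes K :: "real \<Rightarrow> real"
  assumes "1 < a" "Cinf_on {-a<..<a} K" "\<And>x. x \<in> {-a<..<a} \<Longrightarrow> K (- x) = K x"
  shows "coord_smooth (\<lambda>p. K (norm (snd p)))"
  unfolding coord_smooth_def using smooth_map_on_radial[OF assms, of coord_domain]
  by (simp add: coord_domain_def)

section \<open>C^r convergence along a filter and its algebra\<close>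

text \<open>Peeling off one derivative at a time gives the algebraic rules below a common proof:
  differentiate once and apply the rule to the derivatives. The filter is arbitrary, so that it can
  be the neighbourhood filter of a point in a product topology.\<close>

fun Cr_lim :: "nat \<Rightarrow> 'i filter \<Rightarrow> ('i \<Rightarrow> real \<times> complex \<Rightarrow> 'b::real_normed_vector) \<Rightarrow>
    (real \<times> complex \<Rightarrow> 'b) \<Rightarrow> bool" where
  "Cr_lim 0 F u u0 \<longleftrightarrow> uniform_limit coord_domain u u0 F"
| "Cr_lim (Suc r) F u u0 \<longleftrightarrow> uniform_limit coord_domain u u0 F \<and>
     (\<forall>b\<in>Basis. Cr_lim r F (\<lambda>i. pd b (u i)) (pd b u0))"

lemma Cr_lim_iff_partials:
  "Cr_lim r F u u0 \<longleftrightarrow> (\<forall>vs. set vs \<subseteq> Basis \<and> length vs \<le> r \<longrightarrow>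
    uniform_limit coord_domain (\<lambda>i. partials coord_domain vs (u i)) (partials coord_domain vs u0) F)"
proof (induction r arbitrary: u u0)
  case (Suc r)
  have "(\<forall>vs. set vs \<subseteq> Basis \<and> length vs \<le> Suc r \<longrightarrow> P vs) \<longleftrightarrow>
      P [] \<and> (\<forall>b\<in>Basis. \<forall>vs. set vs \<subseteq> Basis \<and> length vs \<le> r \<longrightarrow> P (b # vs))" for P :: "(real \<times> complex) list \<Rightarrow> bool"
  proof (intro iffI conjI ballI allI impI; (elim conjE)?)
    fix vs :: "(real \<times> complex) list" assume "P []" "\<forall>b\<in>Basis. \<forall>vs. set vs \<subseteq> Basis \<and> length vs \<le> r \<longrightarrow> P (b # vs)"
      and "set vs \<subseteq> Basis" "length vs \<le> Suc r"
    then show "P vs" by (cases vs) auto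
  qed auto
  from this[of "\<lambda>vs. uniform_limit coord_domain (\<lambda>i. partials coord_domain vs (u i)) (partials coord_domain vs u0) F"]
  show ?case unfolding Cr_lim.simps Suc.IH by simp
qed simp

lemma Cr_lim_uniform: "Cr_lim r F u u0 \<Longrightarrow> uniform_limit coord_domain u u0 F"
  by (cases r) auto

lemma Cr_lim_SucD: "Cr_lim (Suc r) F u u0 \<Longrightarrow> Cr_lim r F u u0"
  unfolding Cr_lim_iff_partials by auto

lemma Cr_lim_cong:
  assumes "\<And>i p. p \<in> coord_domain \<Longrightarrow> u i p = v i p" "\<And>p. p \<in> coord_domain \<Longrightarrow> u0 p = v0 p"
  shows "Cr_lim r F u u0 \<longleftrightarrow> Cr_lim r F v v0"
proof -
  have "uniform_limit coord_domain (\<lambda>i. partials coord_domain vs (u i)) (partials coord_domain vs u0) F \<longleftrightarrow>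
    uniform_limit coord_domain (\<lambda>i. partials coord_domain vs (v i)) (partials coord_domain vs v0) F" for vs
  proof (rule uniform_limit_cong')
    show "partials coord_domain vs (u i) p = partials coord_domain vs (v i) p" if "p \<in> coord_domain" for i p
      by (rule partials_cong[OF that assms(1)])
    show "partials coord_domain vs u0 p = partials coord_domain vs v0 p" if "p \<in> coord_domain" for p
      by (rule partials_cong[OF that assms(2)])
  qed
  then show ?thesis unfolding Cr_lim_iff_partials by simp
qed

lemma Cr_lim_SucI:
  assumes "uniform_limit coord_domain u u0 F"
    and "\<And>i p. p \<in> coord_domain \<Longrightarrow> (u i has_derivative D i p) (at p within coord_domain)"
    and "\<And>p. p \<in> coord_domain \<Longrightarrow> (u0 has_derivative D0 p) (at p within coord_domain)"
    and "\<And>b. b \<in> Basis \<Longrightarrow> Cr_lim r F (\<lambda>i p. D i p b) (\<lambda>p. D0 p b)"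
  shows "Cr_lim (Suc r) F u u0"
proof -
  have "Cr_lim r F (\<lambda>i. pd b (u i)) (pd b u0)" if "b \<in> Basis" for b
  proof -
    have "Cr_lim r F (\<lambda>i. pd b (u i)) (pd b u0) \<longleftrightarrow> Cr_lim r F (\<lambda>i p. D i p b) (\<lambda>p. D0 p b)"
      by (rule Cr_lim_cong) (rule pd_eq[OF _ assms(2)] pd_eq[OF _ assms(3)]; assumption)+
    then show ?thesis using assms(4)[OF that] by simp
  qed
  then show ?thesis using assms(1) by simp
qed

lemma Cr_lim_const: "Cr_lim r F (\<lambda>i. u) u"
  by (induction r arbitrary: u) (auto intro: uniform_limit_const)

lemma Cr_lim_param:
  fixes c :: "'i \<Rightarrow> 'b::real_normed_vector"
  assumes "(c \<longlongrightarrow> c0) F"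
  shows "Cr_lim r F (\<lambda>i p. c i) (\<lambda>p. c0)"
proof -
  have u: "uniform_limit coord_domain (\<lambda>i p. c i) (\<lambda>p. c0) F"
    using assms by (auto simp: uniform_limit_iff tendsto_iff elim: eventually_mono)
  show ?thesis
  proof (cases r)
    case (Suc k)
    show ?thesis
      unfolding Suc by (rule Cr_lim_SucI[OF u has_derivative_const has_derivative_const Cr_lim_const])
  qed (use u in simp)
qed

lemma Cr_lim_add:
  assumes "\<And>i. coord_smooth (u i)" "coord_smooth u0" "\<And>i. coord_smooth (v i)" "coord_smooth v0"
    and "Cr_lim r F u u0" "Cr_lim r F v v0"
  shows "Cr_lim r F (\<lambda>i p. u i p + v i p) (\<lambda>p. u0 p + v0 p)"
  using assms
proof (induction r arbitrary: u u0 v v0)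
  case 0
  then show ?case by (simp add: uniform_limit_add)
next
  case (Suc r)
  show ?case
  proof (rule Cr_lim_SucI)
    show "uniform_limit coord_domain (\<lambda>i p. u i p + v i p) (\<lambda>p. u0 p + v0 p) F"
      by (intro uniform_limit_add Cr_lim_uniform[OF Suc.prems(5)] Cr_lim_uniform[OF Suc.prems(6)])
    show "((\<lambda>p. u i p + v i p) has_derivative (\<lambda>b. pd b (u i) p + pd b (v i) p)) (at p within coord_domain)"
      if "p \<in> coord_domain" for i p
      by (intro has_derivative_add coord_smooth_has_derivative Suc.prems that)
    show "((\<lambda>p. u0 p + v0 p) has_derivative (\<lambda>b. pd b u0 p + pd b v0 p)) (at p within coord_domain)"
      if "p \<in> coord_domain" for p
      by (intro has_derivative_add coord_smooth_has_derivative Suc.prems that)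
    show "Cr_lim r F (\<lambda>i p. pd b (u i) p + pd b (v i) p) (\<lambda>p. pd b u0 p + pd b v0 p)" if "b \<in> Basis" for b
      by (rule Suc.IH) (use Suc.prems that in \<open>auto intro: coord_smooth_pd\<close>)
  qed
qed

lemma Cr_lim_linear_compose:
  assumes "bounded_linear L" "\<And>i. coord_smooth (u i)" "coord_smooth u0" "Cr_lim r F u u0"
  shows "Cr_lim r F (\<lambda>i p. L (u i p)) (\<lambda>p. L (u0 p))"
  using assms(2-)
proof (induction r arbitrary: u u0)
  case 0
  then show ?case using bounded_linear.uniform_limit[OF assms(1)] by simp
next
  case (Suc r)
  show ?case
  proof (rule Cr_lim_SucI)
    show "uniform_limit coord_domain (\<lambda>i p. L (u i p)) (\<lambda>p. L (u0 p)) F"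
      by (rule bounded_linear.uniform_limit[OF assms(1) Cr_lim_uniform[OF Suc.prems(3)]])
    show "((\<lambda>p. L (u i p)) has_derivative (\<lambda>b. L (pd b (u i) p))) (at p within coord_domain)"
      if "p \<in> coord_domain" for i p
      by (rule bounded_linear.has_derivative[OF assms(1) coord_smooth_has_derivative[OF Suc.prems(1) that]])
    show "((\<lambda>p. L (u0 p)) has_derivative (\<lambda>b. L (pd b u0 p))) (at p within coord_domain)"
      if "p \<in> coord_domain" for p
      by (rule bounded_linear.has_derivative[OF assms(1) coord_smooth_has_derivative[OF Suc.prems(2) that]])
    show "Cr_lim r F (\<lambda>i p. L (pd b (u i) p)) (\<lambda>p. L (pd b u0 p))" if "b \<in> Basis" for b
      by (rule Suc.IH) (use Suc.prems that in \<open>auto intro: coord_smooth_pd\<close>)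
  qed
qed

text \<open>The product rule pairs derivatives of one factor with values of the other. Uniform
  convergence of such products rests on boundedness of the limits, which periodicity
  provides.\<close>

lemma Cr_lim_bilinear:
  fixes B :: "'a::euclidean_space \<Rightarrow> 'b::euclidean_space \<Rightarrow> 'c::euclidean_space"
  assumes "bounded_bilinear B" "\<And>i. coord_smooth (u i)" "coord_smooth u0" "\<And>i. coord_smooth (v i)" "coord_smooth v0"
    and "Cr_lim r F u u0" "Cr_lim r F v v0"
  shows "Cr_lim r F (\<lambda>i p. B (u i p) (v i p)) (\<lambda>p. B (u0 p) (v0 p))"
  using assms(2-)
proof (induction r arbitrary: u u0 v v0)
  case 0
  then show ?case
    using bounded_bilinear.bounded_uniform_limit[OF assms(1) 0(5)[unfolded Cr_lim.simps]
        0(6)[unfolded Cr_lim.simps] coord_smooth_bounded[OF 0(4)] coord_smooth_bounded[OF 0(2)]] by simp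
next
  case (Suc r)
  show ?case
  proof (rule Cr_lim_SucI)
    show "uniform_limit coord_domain (\<lambda>i p. B (u i p) (v i p)) (\<lambda>p. B (u0 p) (v0 p)) F"
      by (rule bounded_bilinear.bounded_uniform_limit[OF assms(1) Cr_lim_uniform[OF Suc.prems(5)]
            Cr_lim_uniform[OF Suc.prems(6)] coord_smooth_bounded[OF Suc.prems(4)] coord_smooth_bounded[OF Suc.prems(2)]])
    show "((\<lambda>p. B (u i p) (v i p)) has_derivative (\<lambda>b. B (u i p) (pd b (v i) p) + B (pd b (u i) p) (v i p)))
        (at p within coord_domain)" if "p \<in> coord_domain" for i p
      by (rule bounded_bilinear.FDERIV[OF assms(1)]) (intro coord_smooth_has_derivative Suc.prems that)+
    show "((\<lambda>p. B (u0 p) (v0 p)) has_derivative (\<lambda>b. B (u0 p) (pd b v0 p) + B (pd b u0 p) (v0 p)))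
        (at p within coord_domain)" if "p \<in> coord_domain" for p
      by (rule bounded_bilinear.FDERIV[OF assms(1)]) (intro coord_smooth_has_derivative Suc.prems that)+
    fix b :: "real \<times> complex" assume b: "b \<in> Basis"
    have d: "Cr_lim r F (\<lambda>i. pd b (u i)) (pd b u0)" "Cr_lim r F (\<lambda>i. pd b (v i)) (pd b v0)"
      using Suc.prems(5,6) b by auto
    have 1: "Cr_lim r F (\<lambda>i p. B (u i p) (pd b (v i) p)) (\<lambda>p. B (u0 p) (pd b v0 p))"
      by (rule Suc.IH[OF Suc.prems(1,2) coord_smooth_pd coord_smooth_pd Cr_lim_SucD[OF Suc.prems(5)] d(2)])
        (rule Suc.prems)+
    have 2: "Cr_lim r F (\<lambda>i p. B (pd b (u i) p) (v i p)) (\<lambda>p. B (pd b u0 p) (v0 p))"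
      by (rule Suc.IH[OF coord_smooth_pd coord_smooth_pd Suc.prems(3,4) d(1) Cr_lim_SucD[OF Suc.prems(6)]])
        (rule Suc.prems)+
    show "Cr_lim r F (\<lambda>i p. B (u i p) (pd b (v i) p) + B (pd b (u i) p) (v i p))
        (\<lambda>p. B (u0 p) (pd b v0 p) + B (pd b u0 p) (v0 p))"
      by (rule Cr_lim_add[OF _ _ _ _ 1 2]) (intro coord_smooth_bilinear[OF assms(1)] coord_smooth_pd Suc.prems)+
  qed
qed

lemma has_derivative_powr_const:
  fixes u :: "'a::real_normed_vector \<Rightarrow> real"
  assumes "(u has_derivative D) (at p within S)" "u p > 0"
  shows "((\<lambda>p. u p powr m) has_derivative (\<lambda>v. (m * u p powr (m - 1)) * D v)) (at p within S)"
proof -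
  have "((\<lambda>x. x powr m) has_derivative (*) (m * u p powr (m - 1))) (at (u p))"
    using has_real_derivative_powr[OF assms(2), of m] by (simp add: has_field_derivative_def)
  from has_derivative_compose[OF assms(1) this] show ?thesis .
qed

text \<open>A power may blow up or fail to be uniformly continuous near 0, hence the lower bound
  \<delta> on the limit. The derivative involves the exponent m - 1, so all exponents are treated
  together.\<close>

lemma Cr_lim_powr:
  fixes u :: "'i \<Rightarrow> real \<times> complex \<Rightarrow> real"
  assumes "\<And>i. coord_smooth (u i)" "coord_smooth u0" "\<And>i p. p \<in> coord_domain \<Longrightarrow> u i p > 0"
    and "\<delta> > 0" "\<And>p. p \<in> coord_domain \<Longrightarrow> u0 p \<ge> \<delta>" "Cr_lim r F u u0"
  shows "Cr_lim r F (\<lambda>i p. u i p powr m) (\<lambda>p. u0 p powr m)"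
  using assms(6)
proof (induction r arbitrary: m)
  have pos0: "u0 p > 0" if "p \<in> coord_domain" for p using assms(4,5) that by (meson less_le_trans)
  have ul: "uniform_limit coord_domain (\<lambda>i p. u i p powr m) (\<lambda>p. u0 p powr m) F"
    if U: "uniform_limit coord_domain u u0 F" for m
  proof -
    obtain C where C: "\<And>p. p \<in> coord_domain \<Longrightarrow> \<bar>u0 p\<bar> \<le> C"
      using coord_smooth_bounded[OF assms(2)] unfolding bounded_iff by auto
    \<comment> \<open>C bounds the limit from above; a perturbation smaller than min (\<delta> / 2)
      1 keeps u i inside this compact interval, which stays away from 0.\<close>
    let ?B = "{\<delta> / 2..C + 1}"
    have "continuous_on ?B (\<lambda>x. x powr m)" using assms(4) by (intro continuous_intros) auto
    then have "uniformly_continuous_on ?B (\<lambda>x. x powr m)" by (rule compact_uniformly_continuous) simp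
    moreover have "\<forall>\<^sub>F i in F. \<forall>p\<in>coord_domain. u i p \<in> ?B"
    proof -
      have "min (\<delta> / 2) 1 > 0" using assms(4) by simp
      then have "\<forall>\<^sub>F i in F. \<forall>p\<in>coord_domain. dist (u i p) (u0 p) < min (\<delta> / 2) 1"
        by (rule uniform_limitD[OF U])
      then show ?thesis
      proof eventually_elim
        case (elim i)
        show ?case
        proof
          fix p assume p: "p \<in> coord_domain"
          then have "\<bar>u i p - u0 p\<bar> < min (\<delta> / 2) 1" using elim by (simp add: dist_real_def)
          then have "\<delta> / 2 \<le> u i p" "u i p \<le> C + 1" using C[OF p] assms(5)[OF p] by linarith+
          then show "u i p \<in> ?B" by simp
        qed
      qed
    qed
    ultimately show ?thesis
      by (rule uniform_limit_compose_uniformly_continuous_on[OF U]) simp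
  qed
  {
    case 0
    then show ?case using ul by simp
  next
    case (Suc r)
    show ?case
    proof (rule Cr_lim_SucI)
      show "uniform_limit coord_domain (\<lambda>i p. u i p powr m) (\<lambda>p. u0 p powr m) F"
        by (rule ul[OF Cr_lim_uniform[OF Suc.prems]])
      show "((\<lambda>p. u i p powr m) has_derivative (\<lambda>b. (m * u i p powr (m - 1)) * pd b (u i) p)) (at p within coord_domain)"
        if "p \<in> coord_domain" for i p
        by (rule has_derivative_powr_const[OF coord_smooth_has_derivative[OF assms(1) that] assms(3)[OF that]])
      show "((\<lambda>p. u0 p powr m) has_derivative (\<lambda>b. (m * u0 p powr (m - 1)) * pd b u0 p)) (at p within coord_domain)"
        if "p \<in> coord_domain" for p
        by (rule has_derivative_powr_const[OF coord_smooth_has_derivative[OF assms(2) that] pos0[OF that]])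
      fix b :: "real \<times> complex" assume b: "b \<in> Basis"
      have d: "Cr_lim r F (\<lambda>i. pd b (u i)) (pd b u0)" using Suc.prems b by auto
      have s: "coord_smooth (\<lambda>p. u i p powr (m - 1))" "coord_smooth (\<lambda>p. u0 p powr (m - 1))" for i
        by (rule coord_smooth_powr[OF assms(1) assms(3)] coord_smooth_powr[OF assms(2) pos0]; assumption)+
      have L: "bounded_linear (\<lambda>x::real. m * x)" by (rule bounded_linear_mult_right)
      have 1: "Cr_lim r F (\<lambda>i p. m * u i p powr (m - 1)) (\<lambda>p. m * u0 p powr (m - 1))"
        by (rule Cr_lim_linear_compose[OF L s Suc.IH[OF Cr_lim_SucD[OF Suc.prems]]])
      show "Cr_lim r F (\<lambda>i p. (m * u i p powr (m - 1)) * pd b (u i) p) (\<lambda>p. (m * u0 p powr (m - 1)) * pd b u0 p)"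
        by (rule Cr_lim_bilinear[OF bounded_bilinear_mult coord_smooth_linear_compose[OF L s(1)]
              coord_smooth_linear_compose[OF L s(2)] coord_smooth_pd[OF assms(1)] coord_smooth_pd[OF assms(2)] 1 d])
    qed
  }
qed

section \<open>Convergence of radial quotients\<close>

text \<open>Weighted averaging does not increase the supremum norm on [0, 1]: the weight lies
  between 0 and 1, and u x stays in [0, 1]. The intervals may vary with the index, since the
  estimate takes place on [0, 1].\<close>

lemma uniform_limit_dilation_integral:
  assumes "uniform_limit {0..1} f f0 F" "\<And>i. 1 < a i \<and> continuous_on {-a i<..<a i} (f i)"
    and "1 < a0" "continuous_on {-a0<..<a0} f0"
  shows "uniform_limit {0..1} (\<lambda>i. dilation_integral n (f i)) (dilation_integral n f0) F"
proof (rule uniform_limitI)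
  fix e :: real assume "e > 0"
  \<comment> \<open>Integrating a bound keeps it only as a weak inequality; halving e makes the
    final one strict.\<close>
  then have "e / 2 > 0" by simp
  from uniform_limitD[OF assms(1) this]
  show "\<forall>\<^sub>F i in F. \<forall>x\<in>{0..1}. dist (dilation_integral n (f i) x) (dilation_integral n f0 x) < e"
  proof eventually_elim
    case (elim i)
    show ?case
    proof
      fix x :: real assume x: "x \<in> {0..1}"
      have xi: "x \<in> {-a i<..<a i}" and x0: "x \<in> {-a0<..<a0}" using x assms(2)[of i] assms(3) by auto
      have i1: "(\<lambda>u::real. u ^ n * f i (u * x)) integrable_on {0..1}"
        using assms(2)[of i] by (intro dilation_integrable[OF _ xi]) auto
      have i2: "(\<lambda>u::real. u ^ n * f0 (u * x)) integrable_on {0..1}"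
        by (rule dilation_integrable[OF assms(4) x0])
      let ?g = "\<lambda>u::real. u ^ n * f i (u * x) - u ^ n * f0 (u * x)"
      have "norm (integral {0..1} ?g) \<le> integral {0..1} (\<lambda>u::real. e / 2)"
      proof (rule integral_norm_bound_integral)
        show "?g integrable_on {0..1}" using i1 i2 by (rule integrable_diff)
        fix u :: real assume u: "u \<in> {0..1}"
        then have "u * x \<in> {0..1}" using x by (auto intro: mult_le_one)
        then have le: "\<bar>f i (u * x) - f0 (u * x)\<bar> \<le> e / 2" using elim by (auto simp: dist_real_def less_imp_le)
        have "norm (?g u) = u ^ n * \<bar>f i (u * x) - f0 (u * x)\<bar>"
          using u by (simp add: abs_mult right_diff_distrib[symmetric])
        also have "\<dots> \<le> 1 * (e / 2)"
          using u le by (intro mult_mono power_le_one) auto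
        finally show "norm (?g u) \<le> e / 2" by simp
      qed (intro integrable_continuous_real continuous_on_const)
      also have "integral {0..1} (\<lambda>u::real. e / 2) < e" using \<open>e > 0\<close> by simp
      finally show "dist (dilation_integral n (f i) x) (dilation_integral n f0 x) < e"
        by (simp add: dilation_integral_def dist_real_def integral_diff[OF i1 i2])
    qed
  qed
qed

text \<open>Both quotients have n-th derivatives that are single or double weighted integrals of the
  derivative of K of order n + 2, and uniform convergence passes under these integrals.\<close>

lemma uniform_limit_derivs_even_quotient:
  fixes K :: "'i \<Rightarrow> real \<Rightarrow> real"
  assumes "\<And>i. 1 < a i \<and> Cinf_on {-a i<..<a i} (K i)" "1 < a0" "Cinf_on {-a0<..<a0} K0"
    and "\<And>n. uniform_limit {0..1} (\<lambda>i. (deriv ^^ n) (K i)) ((deriv ^^ n) K0) F"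
  shows "uniform_limit {0..1} (\<lambda>i. (deriv ^^ n) (divide_by_id (deriv (K i)))) ((deriv ^^ n) (divide_by_id (deriv K0))) F"
    and "uniform_limit {0..1} (\<lambda>i. (deriv ^^ n) (radial_quotient (K i))) ((deriv ^^ n) (radial_quotient K0)) F"
proof -
  have C: "Cinf_on {-a i<..<a i} ((deriv ^^ m) (K i))" for i m
    using assms(1)[of i] by (intro Cinf_on_funpow_deriv) auto
  have C0: "Cinf_on {-a0<..<a0} ((deriv ^^ m) K0)" for m
    using assms(3) by (intro Cinf_on_funpow_deriv) auto
  have x: "x \<in> {-a i<..<a i}" "x \<in> {-a0<..<a0}" if "x \<in> {0..1}" for x i
    using that assms(1)[of i] assms(2) by auto
  have E: "(deriv ^^ n) (divide_by_id (deriv L)) x = dilation_integral n ((deriv ^^ (n + 2)) L) x"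
    if "Cinf_on {-b<..<b} ((deriv ^^ 2) L)" "x \<in> {-b<..<b}" for L b x n
  proof -
    have "(deriv ^^ (n + 2)) L = (deriv ^^ n) ((deriv ^^ 2) L)" by (simp only: funpow_add o_def)
    moreover have "divide_by_id (deriv L) = dilation_integral 0 ((deriv ^^ 2) L)"
      by (simp add: divide_by_id_def numeral_2_eq_2)
    ultimately show ?thesis using funpow_deriv_dilation_integral[OF that, of n 0] by simp
  qed
  have U: "uniform_limit {0..1} (\<lambda>i. dilation_integral n ((deriv ^^ (n + 2)) (K i))) (dilation_integral n ((deriv ^^ (n + 2)) K0)) F"
    for n
    by (rule uniform_limit_dilation_integral[where a = a, OF assms(4) _ assms(2) Cinf_on_continuous[OF C0]])
      (use assms(1) Cinf_on_continuous[OF C] in blast)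
  show "uniform_limit {0..1} (\<lambda>i. (deriv ^^ n) (divide_by_id (deriv (K i)))) ((deriv ^^ n) (divide_by_id (deriv K0))) F"
    using U[of n] uniform_limit_cong'[of "{0..1}" "\<lambda>i. (deriv ^^ n) (divide_by_id (deriv (K i)))"
        "\<lambda>i. dilation_integral n ((deriv ^^ (n + 2)) (K i))" "(deriv ^^ n) (divide_by_id (deriv K0))"
        "dilation_integral n ((deriv ^^ (n + 2)) K0)" F] E[OF C x(1)] E[OF C0 x(2)] by simp
  have U2: "uniform_limit {0..1} (\<lambda>i. dilation_integral (Suc n) (dilation_integral n ((deriv ^^ (n + 2)) (K i))))
      (dilation_integral (Suc n) (dilation_integral n ((deriv ^^ (n + 2)) K0))) F"
    by (rule uniform_limit_dilation_integral[where a = a, OF U _ assms(2)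
          Cinf_on_continuous[OF Cinf_on_dilation_integral[OF C0]]])
      (use assms(1) Cinf_on_continuous[OF Cinf_on_dilation_integral[OF C]] in blast)
  have Q: "(deriv ^^ n) (radial_quotient (K i)) x =
      dilation_integral (Suc n) (dilation_integral n ((deriv ^^ (n + 2)) (K i))) x" if "x \<in> {0..1}" for i x
    using funpow_deriv_radial_quotient[OF _ x(1)[OF that]] assms(1)[of i] by blast
  have Q0: "(deriv ^^ n) (radial_quotient K0) x =
      dilation_integral (Suc n) (dilation_integral n ((deriv ^^ (n + 2)) K0)) x" if "x \<in> {0..1}" for x
    by (rule funpow_deriv_radial_quotient[OF assms(3) x(2)[OF that]])
  show "uniform_limit {0..1} (\<lambda>i. (deriv ^^ n) (radial_quotient (K i))) ((deriv ^^ n) (radial_quotient K0)) F"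
    by (rule uniform_limit_cong'[THEN iffD2, OF Q Q0 U2])
qed

lemma unit_mem_Basis: "((0::real), (1::complex)) \<in> Basis"
  by (auto simp: Basis_prod_def Basis_complex_def)

lemma axis_mem_coord_domain: "x \<in> {0..1} \<Longrightarrow> (0, complex_of_real x) \<in> coord_domain"
  by (simp add: coord_domain_def)

text \<open>The direction (0, 1) is that of Re z, so the real segment z = x probes the radius. K and
  u are compared only on [0, 1]; at its end points the derivatives are one-sided, and they are
  unique on a closed interval.\<close>

lemma funpow_deriv_eq_partials:
  fixes K :: "real \<Rightarrow> real"
  assumes "coord_smooth u" "1 < a" "Cinf_on {-a<..<a} K"
    and "\<And>x. x \<in> {0..1} \<Longrightarrow> K x = u (0, complex_of_real x)" "x \<in> {0..1}"
  shows "(deriv ^^ n) K x = partials coord_domain (replicate n (0, 1)) u (0, complex_of_real x)"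
  using assms(1,3,4)
proof (induction n arbitrary: K u)
  case 0
  then show ?case using assms(5) by simp
next
  case (Suc n)
  have d: "deriv K y = pd (0, 1) u (0, complex_of_real y)" if y: "y \<in> {0..1}" for y
  proof -
    let ?e = "\<lambda>x::real. (0::real, complex_of_real x)"
    have yJ: "y \<in> {-a<..<a}" using y assms(2) by auto
    have "(u has_derivative frechet_derivative u (at (?e y) within coord_domain)) (at (?e y) within coord_domain)"
      by (rule coord_smooth_has_derivative[OF Suc.prems(1) axis_mem_coord_domain[OF y]])
    then have D: "(u has_derivative frechet_derivative u (at (?e y) within coord_domain)) (at (?e y) within ?e ` {0..1})"
      by (rule has_derivative_subset) (rule image_subsetI, rule axis_mem_coord_domain)
    have "bounded_linear ?e"
      by (intro bounded_linear_Pair bounded_linear_zero bounded_linear_of_real)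
    then have "(?e has_derivative ?e) (at y within {0..1})"
      by (rule bounded_linear_imp_has_derivative)
    from has_derivative_in_compose[OF this D]
    have c: "((\<lambda>x. u (?e x)) has_derivative (\<lambda>h. frechet_derivative u (at (?e y) within coord_domain) (?e h)))
      (at y within {0..1})" .
    have "frechet_derivative u (at (?e y) within coord_domain) (?e h) = h *\<^sub>R pd (0, 1) u (?e y)" for h
    proof -
      have "linear (frechet_derivative u (at (?e y) within coord_domain))"
        using D by (rule has_derivative_linear)
      from linear_cmul[OF this, of h "(0, 1)"] show ?thesis by (simp add: scaleR_conv_of_real)
    qed
    with c have "((\<lambda>x. u (?e x)) has_vector_derivative pd (0, 1) u (?e y)) (at y within {0..1})"
      by (simp add: has_vector_derivative_def)
    moreover have "((\<lambda>x. u (?e x)) has_vector_derivative deriv K y) (at y within {0..1})"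
    proof -
      have "(K has_vector_derivative deriv K y) (at y within {0..1})"
        using Cinf_on_realD(1)[OF open_greaterThanLessThan Suc.prems(2) yJ]
        by (simp add: has_real_derivative_iff_has_vector_derivative has_vector_derivative_at_within)
      then show ?thesis
        using has_derivative_within_cong[OF y, of K "\<lambda>x. u (?e x)"] Suc.prems(3)
        by (simp add: has_vector_derivative_def)
    qed
    ultimately show ?thesis
      using vector_derivative_unique_within_closed_interval[of 0 1 y "\<lambda>x. u (?e x)"] y by auto
  qed
  have "(deriv ^^ Suc n) K x = (deriv ^^ n) (deriv K) x" by (simp only: funpow_Suc_right o_def)
  also have "\<dots> = partials coord_domain (replicate n (0, 1)) (pd (0, 1) u) (0, complex_of_real x)"
    by (rule Suc.IH[OF coord_smooth_pd[OF Suc.prems(1)] Cinf_on_realD(2)[OF open_greaterThanLessThan Suc.prems(2)] d])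
  finally show ?case by simp
qed

text \<open>One derivative of K(|z|) in a direction v of the disk is the inner product of v and z
  times E(|z|), with E = K'/x. Order n for E takes order n + 2 for K, so convergence of all
  derivatives is assumed: it is reproduced for E, and the induction closes.\<close>

lemma Cr_lim_radial:
  fixes K :: "'i \<Rightarrow> real \<Rightarrow> real"
  assumes "\<And>i. 1 < a i" "\<And>i. Cinf_on {-a i<..<a i} (K i)" "\<And>i x. x \<in> {-a i<..<a i} \<Longrightarrow> K i (- x) = K i x"
    and "1 < a0" "Cinf_on {-a0<..<a0} K0" "\<And>x. x \<in> {-a0<..<a0} \<Longrightarrow> K0 (- x) = K0 x"
    and "\<And>n. uniform_limit {0..1} (\<lambda>i. (deriv ^^ n) (K i)) ((deriv ^^ n) K0) F"
  shows "Cr_lim r F (\<lambda>i p. K i (norm (snd p))) (\<lambda>p. K0 (norm (snd p)))"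
  using assms(2,3,5-)
proof (induction r arbitrary: K K0)
  have ul: "uniform_limit coord_domain (\<lambda>i p. K i (norm (snd p))) (\<lambda>p. K0 (norm (snd p))) F"
    if "uniform_limit {0..1} K K0 F" for K and K0 :: "real \<Rightarrow> real"
    by (rule uniform_limit_compose'[OF that]) (auto simp: coord_domain_def)
  {
    case 0
    then show ?case using ul[of K K0] "0"(5)[of 0] by simp
  next
    case (Suc r)
    let ?E = "\<lambda>L. divide_by_id (deriv L)"
    have dom: "norm (snd p) < b" if "p \<in> coord_domain" "1 < b" for p :: "real \<times> complex" and b
      using that by (auto simp: coord_domain_def)
    have D: "((\<lambda>p. L (norm (snd p))) has_derivative (\<lambda>v. (snd v \<bullet> snd p) * ?E L (norm (snd p)))) (at p within coord_domain)"
      if "Cinf_on {-b<..<b} L" "\<And>x. x \<in> {-b<..<b} \<Longrightarrow> L (- x) = L x" "1 < b" "p \<in> coord_domain"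
      for L b and p :: "real \<times> complex"
      by (rule has_derivative_compose[OF bounded_linear_imp_has_derivative[OF bounded_linear_snd]
            has_derivative_even_norm[OF that(1,2) dom[OF that(4,3)]]])
    note E = even_deriv_quotient(1,2)[OF Suc.prems(1,2)] and E0 = even_deriv_quotient(1,2)[OF Suc.prems(3,4)]
    show ?case
    proof (rule Cr_lim_SucI)
      show "uniform_limit coord_domain (\<lambda>i p. K i (norm (snd p))) (\<lambda>p. K0 (norm (snd p))) F"
        using ul[of K K0] Suc.prems(5)[of 0] by simp
      show "((\<lambda>p. K i (norm (snd p))) has_derivative (\<lambda>v. (snd v \<bullet> snd p) * ?E (K i) (norm (snd p)))) (at p within coord_domain)"
        if "p \<in> coord_domain" for i p
        by (rule D[OF Suc.prems(1,2) assms(1) that])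
      show "((\<lambda>p. K0 (norm (snd p))) has_derivative (\<lambda>v. (snd v \<bullet> snd p) * ?E K0 (norm (snd p)))) (at p within coord_domain)"
        if "p \<in> coord_domain" for p
        by (rule D[OF Suc.prems(3,4) assms(4) that])
      fix b :: "real \<times> complex"
      have lin: "coord_smooth (\<lambda>p. snd b \<bullet> snd p)"
        unfolding coord_smooth_def
        by (auto intro!: smooth_map_on_linear bounded_linear_intros)
      have IH: "Cr_lim r F (\<lambda>i p. ?E (K i) (norm (snd p))) (\<lambda>p. ?E K0 (norm (snd p)))"
      proof (rule Suc.IH)
        show "uniform_limit {0..1} (\<lambda>i. (deriv ^^ n) (?E (K i))) ((deriv ^^ n) (?E K0)) F" for n
          by (rule uniform_limit_derivs_even_quotient(1)[where a = a, OF _ assms(4) Suc.prems(3,5)])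
            (use assms(1) Suc.prems(1) in blast)
      qed (use E E0 in auto)
      show "Cr_lim r F (\<lambda>i p. (snd b \<bullet> snd p) * ?E (K i) (norm (snd p))) (\<lambda>p. (snd b \<bullet> snd p) * ?E K0 (norm (snd p)))"
      proof (rule Cr_lim_bilinear[OF bounded_bilinear_mult lin lin _ _ Cr_lim_const IH])
        show "coord_smooth (\<lambda>p. ?E (K i) (norm (snd p)))" for i
          by (rule coord_smooth_radial[OF assms(1)[of i]]) (use E in auto)
        show "coord_smooth (\<lambda>p. ?E K0 (norm (snd p)))"
          by (rule coord_smooth_radial[OF assms(4)]) (use E0 in auto)
      qed
    qed
  }
qed

section \<open>The homotopy in coordinates\<close>

lemma torus_coords_mem: "p \<in> coord_domain \<Longrightarrow> torus_coords p \<in> solid_torus"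
  by (auto simp: coord_domain_def torus_coords_def mem_solid_torus)

lemma radius_torus_coords [simp]: "radius (torus_coords p) = norm (snd p)"
  by (simp add: torus_coords_def)

lemma coord_smooth_torus:
  assumes "smooth_map_on solid_torus h"
  shows "coord_smooth (\<lambda>p. h (torus_coords p))"
  unfolding coord_smooth_def
proof
  have "smooth_map_on (UNIV :: real set) cis" by (simp add: smooth_map_on_open Cinf_on_def Ck_on_cis)
  then have "smooth_map_on coord_domain (\<lambda>p. cis (fst p))"
    by (rule smooth_map_on_compose[OF smooth_map_on_linear[OF bounded_linear_fst] subset_UNIV])
  then have "smooth_map_on coord_domain torus_coords"
    unfolding torus_coords_def[abs_def]
    by (rule smooth_map_on_Pair[OF _ smooth_map_on_linear[OF bounded_linear_snd]])
  then show "smooth_map_on coord_domain (\<lambda>p. h (torus_coords p))"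
    by (rule smooth_map_on_compose[OF _ _ assms]) (rule image_subsetI, rule torus_coords_mem)
  show "\<forall>p\<in>coord_domain. h (torus_coords (p + (2 * pi, 0))) = h (torus_coords p)"
    by (auto simp: torus_coords_def cis_mult[symmetric] simp flip: cis_mult)
qed

text \<open>The factor |z| / |h_2| becomes Q(|z|)^(-1/2), smooth across the core. The pair is split
  into a sum of two linear embeddings, so that its convergence follows from the rules for sums and
  linear maps.\<close>

lemma radius_homotopy_torus_coords:
  assumes h: "h \<in> fol_diffeos solid_torus torus_foliation" and p: "p \<in> coord_domain"
    and K: "1 < a" "Cinf_on {-a<..<a} K" "\<And>x. K (- x) = K x" "K 0 = 0"
    and KM: "\<And>p. p \<in> solid_torus \<Longrightarrow> K (radius p) = (radius (h p))\<^sup>2"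
  shows "radius_homotopy t h (torus_coords p) =
    (fst (h (torus_coords p)), 0) +
    (0, ((1 - t) + t * radial_quotient K (norm (snd p)) powr (- 1/2)) *\<^sub>R snd (h (torus_coords p)))"
proof -
  let ?x = "torus_coords p"
  have x: "?x \<in> solid_torus" using torus_coords_mem[OF p] .
  have q: "radial_quotient K (norm (snd p)) > 0"
  proof (rule fol_diffeos_radial_quotient(1)[OF h K KM])
    show "norm (snd p) \<in> {-1..1}"
      using p order_trans[of "-1" 0 "norm (snd p)"] by (auto simp: coord_domain_def)
  qed
  have r: "radius (h ?x) = norm (snd p) * sqrt (radial_quotient K (norm (snd p)))"
    using fol_diffeos_radial_quotient(3)[OF h K KM x] by simp
  have pw: "radial_quotient K (norm (snd p)) powr (- 1/2) = 1 / sqrt (radial_quotient K (norm (snd p)))"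
    using q by (simp add: powr_minus_divide powr_half_sqrt)
  show ?thesis
  proof (cases "snd p = 0")
    case True
    then have "radius (h ?x) = 0" using r by simp
    then have "snd (h ?x) = 0" by (simp add: radius_def)
    then show ?thesis using x by (simp add: radius_homotopy_def)
  next
    case False
    then have "radius ?x / radius (h ?x) = radial_quotient K (norm (snd p)) powr (- 1/2)"
      unfolding r pw by simp
    then show ?thesis using x by (simp only: radius_homotopy_def restrict_apply if_True) simp
  qed
qed

text \<open>Convergence passes from h to |h_2|^2, to all derivatives of the profile K on [0, 1], to
  Q(|z|), to its power -1/2, and to the product with h_2. Every order of convergence is assumed
  because the division costs two derivatives.\<close>

lemma Cr_lim_radius_homotopy:
  fixes h :: "'i \<Rightarrow> complex \<times> complex \<Rightarrow> complex \<times> complex"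
  assumes h: "\<And>i. h i \<in> fol_diffeos solid_torus torus_foliation"
    and h0: "h0 \<in> fol_diffeos solid_torus torus_foliation"
    and t: "(t \<longlongrightarrow> t0) F"
    and lim: "\<And>r. Cr_lim r F (\<lambda>i p. h i (torus_coords p)) (\<lambda>p. h0 (torus_coords p))"
  shows "Cr_lim r F (\<lambda>i p. radius_homotopy (t i) (h i) (torus_coords p))
    (\<lambda>p. radius_homotopy t0 h0 (torus_coords p))"
proof -
  let ?P = "\<lambda>h a K. 1 < a \<and> Cinf_on {-a<..<a} K \<and> (\<forall>x. K (- x) = K x) \<and> K 0 = 0 \<and>
    (\<forall>p\<in>solid_torus. K (radius p) = (radius (h p))\<^sup>2)"
  have ex: "\<exists>a K. ?P h a K" if "h \<in> fol_diffeos solid_torus torus_foliation" for h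
    using fol_diffeos_radius_profile[OF that] by metis
  then have "\<forall>i. \<exists>a K. ?P (h i) a K" using h by blast
  \<comment> \<open>The lengths a i need not be bounded away from 1, and the extensions beyond 1 are
    arbitrary. What follows compares the K i on [0, 1], where h i determines them.\<close>
  then obtain a K where "\<forall>i. ?P (h i) (a i) (K i)" by metis
  then have K: "1 < a i" "Cinf_on {-a i<..<a i} (K i)" "K i (- x) = K i x" "K i 0 = 0"
      "p \<in> solid_torus \<Longrightarrow> K i (radius p) = (radius (h i p))\<^sup>2" for i x p by auto
  obtain a0 K0 where "?P h0 a0 K0" using ex[OF h0] by blast
  then have K0: "1 < a0" "Cinf_on {-a0<..<a0} K0" "K0 (- x) = K0 x" "K0 0 = 0"
      "p \<in> solid_torus \<Longrightarrow> K0 (radius p) = (radius (h0 p))\<^sup>2" for x p by auto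
  define u where "u i p = h i (torus_coords p)" for i p
  define u0 where "u0 p = h0 (torus_coords p)" for p
  have su: "coord_smooth (u i)" for i
    unfolding u_def by (rule coord_smooth_torus[OF fol_diffeosD(2)[OF h]])
  have su0: "coord_smooth u0"
    unfolding u0_def by (rule coord_smooth_torus[OF fol_diffeosD(2)[OF h0]])
  have lu: "Cr_lim r F u u0" for r using lim[of r] by (simp add: u_def[abs_def] u0_def[abs_def])
  have s2: "coord_smooth (\<lambda>p. snd (u i p))" "coord_smooth (\<lambda>p. snd (u0 p))" for i
    by (rule coord_smooth_linear_compose[OF bounded_linear_snd su] coord_smooth_linear_compose[OF bounded_linear_snd su0])+
  have l2: "Cr_lim r F (\<lambda>i p. snd (u i p)) (\<lambda>p. snd (u0 p))" for r
    by (rule Cr_lim_linear_compose[OF bounded_linear_snd su su0 lu])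
  let ?N = "\<lambda>v p. snd (v p) \<bullet> snd (v p :: complex \<times> complex)"
  have sN: "coord_smooth (?N (u i))" "coord_smooth (?N u0)" for i
    by (rule coord_smooth_bilinear[OF bounded_bilinear_inner s2(1) s2(1)]
        coord_smooth_bilinear[OF bounded_bilinear_inner s2(2) s2(2)])+
  have lN: "Cr_lim r F (\<lambda>i. ?N (u i)) (?N u0)" for r
    by (rule Cr_lim_bilinear[OF bounded_bilinear_inner s2(1) s2(2) s2(1) s2(2) l2 l2])
  have KN: "K i x = ?N (u i) (0, complex_of_real x)" "K0 x = ?N u0 (0, complex_of_real x)"
    if x: "x \<in> {0..1}" for i x
  proof -
    have m: "torus_coords (0, complex_of_real x) \<in> solid_torus"
      by (rule torus_coords_mem[OF axis_mem_coord_domain[OF x]])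
    have "radius (torus_coords (0, complex_of_real x)) = x" using x by simp
    then show "K i x = ?N (u i) (0, complex_of_real x)" "K0 x = ?N u0 (0, complex_of_real x)"
      using K(5)[OF m, of i] K0(5)[OF m] by (simp_all add: u_def u0_def radius_def power2_norm_eq_inner)
  qed
  \<comment> \<open>The n-th derivative of the profile is the n-fold partial derivative of |h_2|^2
    in the direction Re z along the real segment, which C^n convergence controls.\<close>
  have dK: "uniform_limit {0..1} (\<lambda>i. (deriv ^^ n) (K i)) ((deriv ^^ n) K0) F" for n
  proof -
    have "uniform_limit coord_domain (\<lambda>i. partials coord_domain (replicate n (0, 1)) (?N (u i)))
      (partials coord_domain (replicate n (0, 1)) (?N u0)) F"
      using lN[of n, unfolded Cr_lim_iff_partials, rule_format, of "replicate n (0, 1)"] unit_mem_Basis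
      by (simp add: set_replicate_conv_if)
    then have "uniform_limit {0..1} (\<lambda>i x. partials coord_domain (replicate n (0, 1)) (?N (u i)) (0, complex_of_real x))
      (\<lambda>x. partials coord_domain (replicate n (0, 1)) (?N u0) (0, complex_of_real x)) F"
      by (rule uniform_limit_compose') (rule Pi_I, rule axis_mem_coord_domain)
    then show ?thesis
      by (rule uniform_limit_cong'[THEN iffD1, rotated 2])
        (rule funpow_deriv_eq_partials[OF sN(1) K(1,2) KN(1), symmetric]
          funpow_deriv_eq_partials[OF sN(2) K0(1,2) KN(2), symmetric]; assumption)+
  qed
  let ?Q = "\<lambda>K p. radial_quotient K (norm (snd (p :: real \<times> complex)))"
  note R = radial_quotient[OF K(2) K(3) K(4)] and R0 = radial_quotient[OF K0(2) K0(3) K0(4)]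
  have lQ: "Cr_lim r F (\<lambda>i. ?Q (K i)) (?Q K0)" for r
  proof (rule Cr_lim_radial[OF K(1) R(1) R(2) K0(1) R0(1) R0(2)])
    show "uniform_limit {0..1} (\<lambda>i. (deriv ^^ n) (radial_quotient (K i))) ((deriv ^^ n) (radial_quotient K0)) F" for n
      by (rule uniform_limit_derivs_even_quotient(2)[where a = a, OF _ K0(1,2) dK]) (use K(1,2) in blast)
  qed
  have sQ: "coord_smooth (?Q (K i))" "coord_smooth (?Q K0)" for i
    by (rule coord_smooth_radial[OF K(1) R(1) R(2)] coord_smooth_radial[OF K0(1) R0(1) R0(2)]; assumption)+
  have nm: "norm (snd p) \<in> {-1..1}" if "p \<in> coord_domain" for p :: "real \<times> complex"
    using that order_trans[of "-1" 0 "norm (snd p)"] by (auto simp: coord_domain_def)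
  have pQ: "?Q (K i) p > 0" if "p \<in> coord_domain" for i p
    by (rule fol_diffeos_radial_quotient(1)[OF h K nm[OF that]])
  have pQ0: "radial_quotient K0 x > 0" if "x \<in> {-1..1}" for x
    by (rule fol_diffeos_radial_quotient(1)[OF h0 K0 that])
  \<comment> \<open>The minimum of the positive function Q over the compact interval
    [-1, 1].\<close>
  obtain \<delta> where \<delta>: "\<delta> > 0" "\<And>p. p \<in> coord_domain \<Longrightarrow> ?Q K0 p \<ge> \<delta>"
  proof -
    have "continuous_on {-1..1} (radial_quotient K0)"
      by (rule continuous_on_subset[OF Cinf_on_continuous[OF R0(1)]]) (use K0(1) in auto)
    then obtain x where x: "x \<in> {-1..1}" "\<And>y. y \<in> {-1..1} \<Longrightarrow> radial_quotient K0 x \<le> radial_quotient K0 y"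
      using continuous_attains_inf[of "{-1..1::real}" "radial_quotient K0"] by auto
    then show ?thesis using that[of "radial_quotient K0 x"] pQ0 nm by blast
  qed
  let ?W = "\<lambda>K p. ?Q K p powr (- 1/2)"
  have sW: "coord_smooth (?W (K i))" "coord_smooth (?W K0)" for i
    by (rule coord_smooth_powr[OF sQ(1) pQ] coord_smooth_powr[OF sQ(2) pQ0[OF nm]]; assumption)+
  have lW: "Cr_lim r F (\<lambda>i. ?W (K i)) (?W K0)"
    by (rule Cr_lim_powr[OF sQ pQ \<delta> lQ])
  have tc: "Cr_lim r F (\<lambda>i p. t i) (\<lambda>p. t0)" and tc': "Cr_lim r F (\<lambda>i p. 1 - t i) (\<lambda>p. 1 - t0)"
    by (intro Cr_lim_param tendsto_intros t)+
  let ?M = "\<lambda>t K p. t * ?W K p"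
  have sM: "coord_smooth (?M (t i) (K i))" "coord_smooth (?M t0 K0)" for i
    by (rule coord_smooth_bilinear[OF bounded_bilinear_mult coord_smooth_const sW(1)]
        coord_smooth_bilinear[OF bounded_bilinear_mult coord_smooth_const sW(2)])+
  have lM: "Cr_lim r F (\<lambda>i. ?M (t i) (K i)) (?M t0 K0)"
    by (rule Cr_lim_bilinear[OF bounded_bilinear_mult coord_smooth_const coord_smooth_const sW tc lW])
  let ?A = "\<lambda>t K p. (1 - t) + ?M t K p"
  have sA: "coord_smooth (?A (t i) (K i))" "coord_smooth (?A t0 K0)" for i
    by (rule coord_smooth_add[OF coord_smooth_const sM(1)] coord_smooth_add[OF coord_smooth_const sM(2)])+
  have lA: "Cr_lim r F (\<lambda>i. ?A (t i) (K i)) (?A t0 K0)"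
    by (rule Cr_lim_add[OF coord_smooth_const coord_smooth_const sM tc' lM])
  let ?B = "\<lambda>t K u p. ?A t K p *\<^sub>R snd (u p :: complex \<times> complex)"
  have sB: "coord_smooth (?B (t i) (K i) (u i))" "coord_smooth (?B t0 K0 u0)" for i
    by (rule coord_smooth_bilinear[OF bounded_bilinear_scaleR sA(1) s2(1)]
        coord_smooth_bilinear[OF bounded_bilinear_scaleR sA(2) s2(2)])+
  have lB: "Cr_lim r F (\<lambda>i. ?B (t i) (K i) (u i)) (?B t0 K0 u0)"
    by (rule Cr_lim_bilinear[OF bounded_bilinear_scaleR sA s2 lA l2])
  have L1: "bounded_linear (\<lambda>a :: complex \<times> complex. (fst a, 0::complex))"
    and L2: "bounded_linear (\<lambda>b :: complex. (0::complex, b))"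
    by (intro bounded_linear_Pair bounded_linear_fst bounded_linear_ident bounded_linear_zero)+
  have fin: "Cr_lim r F (\<lambda>i p. (fst (u i p), 0) + (0, ?B (t i) (K i) (u i) p)) (\<lambda>p. (fst (u0 p), 0) + (0, ?B t0 K0 u0 p))"
    by (rule Cr_lim_add[OF coord_smooth_linear_compose[OF L1 su] coord_smooth_linear_compose[OF L1 su0]
          coord_smooth_linear_compose[OF L2 sB(1)] coord_smooth_linear_compose[OF L2 sB(2)]
          Cr_lim_linear_compose[OF L1 su su0 lu] Cr_lim_linear_compose[OF L2 sB lB]])
  have e: "radius_homotopy (t i) (h i) (torus_coords p) = (fst (u i p), 0) + (0, ?B (t i) (K i) (u i) p)"
    if "p \<in> coord_domain" for i p
    unfolding u_def by (rule radius_homotopy_torus_coords[OF h that K])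
  have e0: "radius_homotopy t0 h0 (torus_coords p) = (fst (u0 p), 0) + (0, ?B t0 K0 u0 p)"
    if "p \<in> coord_domain" for p
    unfolding u0_def by (rule radius_homotopy_torus_coords[OF h0 that K0])
  show ?thesis by (rule Cr_lim_cong[THEN iffD2, OF e e0 fin])
qed

section \<open>C^r convergence and the Whitney topology\<close>

text \<open>The pointwise strict bound by \<epsilon> does not display a uniform slack. The union
  over all radii d < \<epsilon> does: each of its members has a bound d to spare, and the triangle
  inequality makes the union open.\<close>

lemma Cr_nbhd_interior:
  assumes "\<epsilon> > 0" "h \<in> smooth_self_maps solid_torus"
  obtains V where "openin whitney_topology V" "h \<in> V" "V \<subseteq> Cr_nbhd r \<epsilon> h"
proof -
  have mono: "Cr_nbhd r d h \<subseteq> Cr_nbhd r e h" if "d \<le> e" for d e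
    using that unfolding Cr_nbhd_def by (fastforce intro: less_le_trans)
  define V where "V = (\<Union>d\<in>{0<..<\<epsilon>}. Cr_nbhd r d h)"
  have "openin whitney_topology V"
    unfolding openin_whitney_topology
  proof (intro conjI ballI)
    show "V \<subseteq> smooth_self_maps solid_torus" by (auto simp: V_def Cr_nbhd_def)
    fix g assume "g \<in> V"
    then obtain d where d: "0 < d" "d < \<epsilon>" "g \<in> Cr_nbhd r d h" by (auto simp: V_def)
    \<comment> \<open>Half of the slack, so that d + e is again a radius below \<epsilon>.\<close>
    define e where "e = (\<epsilon> - d) / 2"
    have e: "0 < e" "d + e < \<epsilon>" using d by (auto simp: e_def field_simps)
    have "Cr_nbhd r e g \<subseteq> Cr_nbhd r (d + e) h"
    proof
      fix f assume f: "f \<in> Cr_nbhd r e g"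
      have "norm (partials coord_domain vs (f \<circ> torus_coords) p - partials coord_domain vs (h \<circ> torus_coords) p) < d + e"
        if vs: "set vs \<subseteq> Basis \<and> length vs \<le> r" "p \<in> coord_domain" for vs p
      proof -
        let ?d = "\<lambda>k. partials coord_domain vs (k \<circ> torus_coords) p"
        have "norm (?d f - ?d g) < e" "norm (?d g - ?d h) < d"
          using f d(3) vs unfolding Cr_nbhd_def by blast+
        moreover have "norm (?d f - ?d h) \<le> norm (?d f - ?d g) + norm (?d g - ?d h)"
          using norm_triangle_ineq[of "?d f - ?d g" "?d g - ?d h"] by simp
        ultimately show ?thesis by linarith
      qed
      then show "f \<in> Cr_nbhd r (d + e) h" using f unfolding Cr_nbhd_def by blast
    qed
    also have "\<dots> \<subseteq> V" using d e by (auto simp: V_def intro!: bexI[of _ "d + e"])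
    finally show "\<exists>r. \<exists>\<epsilon>>0. Cr_nbhd r \<epsilon> g \<subseteq> V" using e(1) by blast
  qed
  moreover have "h \<in> V"
    unfolding V_def by (rule UN_I[of "\<epsilon> / 2"]) (use assms in \<open>simp_all add: Cr_nbhd_def\<close>)
  moreover have "V \<subseteq> Cr_nbhd r \<epsilon> h"
    unfolding V_def by (rule UN_least, rule mono) simp
  ultimately show ?thesis by (rule that)
qed

text \<open>Only finitely many words of basis vectors have length at most r, so the corresponding
  eventual bounds hold simultaneously.\<close>

lemma eventually_Cr_nbhd_if_Cr_lim:
  assumes "Cr_lim r F (\<lambda>i. f i \<circ> torus_coords) (h \<circ> torus_coords)" "\<epsilon> > 0"
    and "\<And>i. f i \<in> smooth_self_maps solid_torus"
  shows "\<forall>\<^sub>F i in F. f i \<in> Cr_nbhd r \<epsilon> h"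
proof -
  let ?L = "{vs :: (real \<times> complex) list. set vs \<subseteq> Basis \<and> length vs \<le> r}"
  have "finite ?L" by (rule finite_lists_length_le) simp
  moreover have "\<forall>\<^sub>F i in F. \<forall>p\<in>coord_domain.
      dist (partials coord_domain vs (f i \<circ> torus_coords) p) (partials coord_domain vs (h \<circ> torus_coords) p) < \<epsilon>"
    if "vs \<in> ?L" for vs
    by (rule uniform_limitD[OF _ assms(2)]) (use assms(1) that in \<open>auto simp: Cr_lim_iff_partials\<close>)
  ultimately have "\<forall>\<^sub>F i in F. \<forall>vs\<in>?L. \<forall>p\<in>coord_domain.
      dist (partials coord_domain vs (f i \<circ> torus_coords) p) (partials coord_domain vs (h \<circ> torus_coords) p) < \<epsilon>"
    by (rule eventually_ball_finite[OF _ ballI])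
  then show ?thesis
    by eventually_elim (use assms(3) in \<open>simp add: Cr_nbhd_def dist_norm\<close>)
qed

lemma Cr_lim_if_limitin:
  assumes "limitin whitney_topology f h F"
  shows "Cr_lim r F (\<lambda>i. f i \<circ> torus_coords) (h \<circ> torus_coords)"
  unfolding Cr_lim_iff_partials
proof (intro allI impI uniform_limitI)
  fix vs :: "(real \<times> complex) list" and \<epsilon> :: real
  assume vs: "set vs \<subseteq> Basis \<and> length vs \<le> r" and \<epsilon>: "\<epsilon> > 0"
  have "h \<in> smooth_self_maps solid_torus"
    using limitin_topspace[OF assms] by (simp add: topspace_whitney_topology)
  then obtain V where V: "openin whitney_topology V" "h \<in> V" "V \<subseteq> Cr_nbhd r \<epsilon> h"
    using Cr_nbhd_interior[OF \<epsilon>] by metis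
  then have "\<forall>\<^sub>F i in F. f i \<in> V" using assms by (simp add: limitin_def)
  then show "\<forall>\<^sub>F i in F. \<forall>p\<in>coord_domain.
      dist (partials coord_domain vs (f i \<circ> torus_coords) p) (partials coord_domain vs (h \<circ> torus_coords) p) < \<epsilon>"
  proof eventually_elim
    case (elim i)
    then have "f i \<in> Cr_nbhd r \<epsilon> h" using V(3) by blast
    then show ?case using vs by (simp add: Cr_nbhd_def dist_norm)
  qed
qed

abbreviation (input) fol :: "(complex \<times> complex \<Rightarrow> complex \<times> complex) set" where
  "fol \<equiv> fol_diffeos solid_torus torus_foliation"

lemma fol_diffeos_smooth_self_maps: "fol \<subseteq> smooth_self_maps solid_torus"
  by (auto simp: fol_diffeos_def diffeos_def)

lemma continuous_map_radius_homotopy: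
  "continuous_map (prod_topology (top_of_set {0..1}) (subtopology whitney_topology fol))
    (subtopology whitney_topology fol) (\<lambda>(t, h). radius_homotopy t h)"
proof -
  let ?X = "subtopology whitney_topology fol"
  let ?P = "prod_topology (top_of_set {0..1::real}) ?X"
  have tX: "topspace ?X = fol"
    using fol_diffeos_smooth_self_maps by (auto simp: topspace_whitney_topology)
  have tP: "topspace ?P = {0..1} \<times> fol" unfolding topspace_prod_topology tX by simp
  have im: "radius_homotopy (fst x) (snd x) \<in> fol" if "x \<in> topspace ?P" for x
    using that radius_homotopy_fol_diffeos(1) unfolding tP by (auto simp: mem_Times_iff)
  have "continuous_map ?P whitney_topology (\<lambda>x. radius_homotopy (fst x) (snd x))"
    unfolding continuous_map_atin
  proof
    fix x assume x: "x \<in> topspace ?P"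
    let ?F = "atin ?P x"
    have ev: "\<forall>\<^sub>F y in ?F. y \<in> topspace ?P"
      unfolding eventually_atin using x openin_topspace[of ?P] by blast
    \<comment> \<open>The filter puts y in the space only eventually, while the convergence result
      wants every index to give a foliated diffeomorphism. Stray indices are sent to the limit point
      x, which changes no limit.\<close>
    define c where "c y = (if y \<in> topspace ?P then y else x)" for y
    have c: "c y \<in> topspace ?P" for y using x by (simp add: c_def)
    have evc: "\<forall>\<^sub>F y in ?F. c y = y" using ev by eventually_elim (simp add: c_def)
    have l1: "limitin (top_of_set {0..1}) fst (fst x) ?F" and l2: "limitin ?X snd (snd x) ?F"
      using continuous_map_fst[of "top_of_set {0..1::real}" ?X] continuous_map_snd[of "top_of_set {0..1::real}" ?X] x
      unfolding continuous_map_atin by blast+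
    have "(fst \<longlongrightarrow> fst x) ?F" using l1 by (simp add: limitin_subtopology)
    then have t: "((\<lambda>y. fst (c y)) \<longlongrightarrow> fst x) ?F"
      by (rule tendsto_cong[THEN iffD1, rotated]) (use evc in \<open>eventually_elim, simp\<close>)
    have "limitin whitney_topology snd (snd x) ?F" using l2 by (simp add: limitin_subtopology)
    then have "limitin whitney_topology (\<lambda>y. snd (c y)) (snd x) ?F"
      by (rule limitin_transform_eventually[rotated]) (use evc in \<open>eventually_elim, simp\<close>)
    then have s: "Cr_lim r ?F (\<lambda>y. snd (c y) \<circ> torus_coords) (snd x \<circ> torus_coords)" for r
      by (rule Cr_lim_if_limitin)
    have sf: "snd (c y) \<in> fol" for y using c[of y] unfolding tP by (simp add: mem_Times_iff)
    have xf: "snd x \<in> fol" using x unfolding tP by (simp add: mem_Times_iff)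
    have lim: "Cr_lim r ?F (\<lambda>y. radius_homotopy (fst (c y)) (snd (c y)) \<circ> torus_coords)
        (radius_homotopy (fst x) (snd x) \<circ> torus_coords)" for r
      using Cr_lim_radius_homotopy[OF sf xf t s[unfolded o_def]] by (simp add: o_def)
    show "limitin whitney_topology (\<lambda>x. radius_homotopy (fst x) (snd x)) (radius_homotopy (fst x) (snd x)) ?F"
      unfolding limitin_def
    proof (intro conjI allI impI)
      show "radius_homotopy (fst x) (snd x) \<in> topspace whitney_topology"
        using im[OF x] fol_diffeos_smooth_self_maps by (auto simp: topspace_whitney_topology)
      fix U assume U: "openin whitney_topology U \<and> radius_homotopy (fst x) (snd x) \<in> U"
      then obtain r \<epsilon> where e: "\<epsilon> > 0" "Cr_nbhd r \<epsilon> (radius_homotopy (fst x) (snd x)) \<subseteq> U"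
        unfolding openin_whitney_topology by blast
      have "\<forall>\<^sub>F y in ?F. radius_homotopy (fst (c y)) (snd (c y)) \<in> Cr_nbhd r \<epsilon> (radius_homotopy (fst x) (snd x))"
        by (rule eventually_Cr_nbhd_if_Cr_lim[OF lim e(1) subsetD[OF fol_diffeos_smooth_self_maps im[OF c]]])
      with evc show "\<forall>\<^sub>F y in ?F. radius_homotopy (fst y) (snd y) \<in> U"
        by eventually_elim (use e(2) in auto)
    qed
  qed
  then have "continuous_map ?P ?X (\<lambda>x. radius_homotopy (fst x) (snd x))"
    using im by (simp add: continuous_map_in_subtopology image_subset_iff Pi_iff)
  then show ?thesis by (simp add: case_prod_beta')
qed

theorem theorem2p1:
  shows "strong_deformation_retract_of_pair
           (lp_diffeos solid_torus torus_foliation)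
           (lp_diffeos_rel solid_torus torus_foliation solid_torus_boundary)
           (subtopology whitney_topology (fol_diffeos solid_torus torus_foliation))
           (fol_diffeos_rel solid_torus torus_foliation solid_torus_boundary)"
proof -
  let ?X = "subtopology whitney_topology fol"
  let ?lp = "lp_diffeos solid_torus torus_foliation"
  have tX: "topspace ?X = fol"
    using fol_diffeos_smooth_self_maps by (auto simp: topspace_whitney_topology)
  have lp_fol: "?lp \<subseteq> fol"
    by (auto simp: lp_diffeos_def fol_diffeos_def leaf_preserving_def foliated_def)
  have lpD: "radius (h p) = radius p" if "h \<in> ?lp" "p \<in> solid_torus" for h p
    using that by (auto simp: lp_diffeos_def intro: leaf_preserving_torusD)
  have bd: "p \<in> solid_torus" "radius p = 1" if "p \<in> solid_torus_boundary" for p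
    using that by (auto simp: solid_torus_boundary_def mem_solid_torus)
  \<comment> \<open>Equal radii make the factor 1. On the core the quotient evaluates to 0 instead,
    but the second component of h p vanishes there.\<close>
  have stationary: "radius_homotopy t h p = h p"
    if "p \<in> solid_torus" "radius (h p) = radius p" for t h p
  proof (cases "radius p = 0")
    case True
    then have "snd (h p) = 0" using that(2) by (simp add: radius_def)
    then show ?thesis using that(1) by (simp add: radius_homotopy_def prod_eq_iff)
  next
    case False
    then show ?thesis using that by (simp add: radius_homotopy_def prod_eq_iff)
  qed
  \<comment> \<open>Off the torus both maps are \<open>undefined\<close>, so agreement on the torus
    is equality.\<close>
  have ext: "radius_homotopy t h = h" if "h \<in> fol" "\<And>p. p \<in> solid_torus \<Longrightarrow> radius_homotopy t h p = h p" for t h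
  proof
    fix p show "radius_homotopy t h p = h p"
      using that(2)[of p] PiE_arb[OF fol_diffeosD(1)[OF that(1)], of p]
      by (cases "p \<in> solid_torus") (auto simp: radius_homotopy_def)
  qed
  \<comment> \<open>A boundary point fixed by a keeps its radius, so the homotopy does not move it:
    the subgroup relative to the boundary is preserved at all times.\<close>
  have rel: "radius_homotopy t a p = p"
    if "a \<in> fol_diffeos_rel solid_torus torus_foliation solid_torus_boundary" "p \<in> solid_torus_boundary" for t a p
    using stationary[OF bd(1)[OF that(2)], of a t] that by (simp add: fol_diffeos_rel_def)
  have end_lp: "radius_homotopy 1 h \<in> ?lp" if "h \<in> fol" for h
  proof -
    have d: "radius_homotopy 1 h \<in> fol" using radius_homotopy_fol_diffeos(1)[OF that] by simp
    have "leaf_preserving torus_foliation (radius_homotopy 1 h)"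
      by (rule leaf_preserving_torusI[OF fol_diffeosD(3)[OF d]])
        (use radius_homotopy_fol_diffeos(2)[OF that, of 1] in simp)
    then show ?thesis using d by (simp add: lp_diffeos_def fol_diffeos_def)
  qed
  show ?thesis
    unfolding strong_deformation_retract_of_pair_def tX
  proof (intro conjI exI[of _ "\<lambda>(t, h). radius_homotopy t h"] ballI)
    show "fol_diffeos_rel solid_torus torus_foliation solid_torus_boundary \<subseteq> fol"
      by (auto simp: fol_diffeos_rel_def)
    show "?lp \<subseteq> fol" by (rule lp_fol)
    show "lp_diffeos_rel solid_torus torus_foliation solid_torus_boundary
        \<subseteq> ?lp \<inter> fol_diffeos_rel solid_torus torus_foliation solid_torus_boundary"
      using lp_fol by (auto simp: lp_diffeos_rel_def fol_diffeos_rel_def)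
    show "continuous_map (prod_topology (top_of_set {0..1}) ?X) ?X (\<lambda>(t, h). radius_homotopy t h)"
      by (rule continuous_map_radius_homotopy)
    \<comment> \<open>At t = 0 the quotient of radii has coefficient 0, so the factor is 1 on the
      core as well.\<close>
    show "(case (0, h) of (t, h) \<Rightarrow> radius_homotopy t h) = h" if "h \<in> fol" for h
      using ext[OF that, of 0] by (simp add: radius_homotopy_def)
    show "(case (t, h) of (t, h) \<Rightarrow> radius_homotopy t h) = h" if "t \<in> {0..1}" "h \<in> ?lp" for t h
      using ext[of h t] stationary lpD[OF that(2)] lp_fol that(2) by auto
    show "(case (t, a) of (t, h) \<Rightarrow> radius_homotopy t h) \<in> fol_diffeos_rel solid_torus torus_foliation solid_torus_boundary"
      if "t \<in> {0..1}" "a \<in> fol_diffeos_rel solid_torus torus_foliation solid_torus_boundary" for t a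
      using rel[OF that(2)] radius_homotopy_fol_diffeos(1)[OF _ that(1), of a] that(2)
      by (simp add: fol_diffeos_rel_def)
    show "(case (1, h) of (t, h) \<Rightarrow> radius_homotopy t h) \<in> ?lp" if "h \<in> fol" for h
      using end_lp[OF that] by simp
    show "(case (1, a) of (t, h) \<Rightarrow> radius_homotopy t h) \<in> lp_diffeos_rel solid_torus torus_foliation solid_torus_boundary"
      if "a \<in> fol_diffeos_rel solid_torus torus_foliation solid_torus_boundary" for a
      using rel[OF that] end_lp[of a] that by (simp add: fol_diffeos_rel_def lp_diffeos_rel_def)
  qed
qed

end
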